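(* For every finitely generated group $G$ there exist a finite alphabet $\widetilde B$ and a $(G\times\mathbb Z)$-effectively closed subshift $U\subset\widetilde B^{G\times\mathbb Z}$ such that for every finite alphabet $A$ and every $G$-effectively closed subshift $X\subset A^G$ which contains a uniform configuration (i.e. there is $\bar a\in A$ with the constant configuration $\bar a^G\in X$), there exist a finite alphabet $B$, a finite set $\mathcal F$ of patterns over the alphabet $\widetilde B\times B$ on the group $G\times\mathbb Z$, and a 1-block code $\phi$ such that $$\pi_G\left(\phi\left(\left(U\times B^{G\times\mathbb Z}\right)\setminus\bigcup_{p\in\mathcal F,\;h\in G\times\mathbb Z}[p]_h\right)\right)=X .$$
   Context: Let $K$ be a finitely generated group and $S\subset K$ a finite generating set closed under inverses and containing $1_K$. Words in $S^*$ represent elements of $K$; write $u=_K v$ if they represent the same element, and $\mathtt{WP}(K)=\{w\in S^*: w=_K 1_K\}$. For a finite alphabet $A$, $A^K$ has the product topology and the left shift action $(\sigma_g x)_h=x_{g^{-1}h}$. A subshift is a closed shift-invariant subset of some $A^K$. Put $[a]_g=\{x\in A^K: x_g=a\}$. A pattern is an element $p\in A^F$ with $F\subset K$ finite, and $[p]_g=\bigcap_{h\in F}[p_h]_{gh}$. A pattern coding over $A$ is a finite set $c$ of pairs $(w,a)$ with $w\in S^*$, $a\in A$. For a set $\mathcal C$ of pattern codings, $X_{\mathcal C}=\bigcap_{g\in K,\,c\in\mathcal C}\big(A^K\setminus\bigcap_{(w,a)\in c}[a]_{gw}\big)$. A subshift $X\subset A^K$ is $K$-effectively closed if $X=X_{\mathcal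 C}$ for some set of pattern codings $\mathcal C$ that is recursively enumerable by a Turing machine with oracle $\mathtt{WP}(K)$. $U\times B^{G\times\mathbb Z}$ is regarded as a subshift of $(\widetilde B\times B)^{G\times\mathbb Z}$. A 1-block code here is a map $\phi:(\widetilde B\times B)^{G\times\mathbb Z}\to A^{G\times\mathbb Z}$ of the form $\phi(x)_h=\Phi(x_h)$ for some $\Phi:\widetilde B\times B\to A$. For $Z\subset A^{G\times\mathbb Z}$, the $G$-projective subdynamics is $\pi_G(Z)=\{x\in A^G:\exists z\in Z,\ \forall g\in G,\ x_g=z_{(g,0)}\}$. *)

theory Defs
  imports "HOL-Analysis.Function_Topology" "HOL-Algebra.Elementary_Groups"
    "HOL-Algebra.Generated_Groups"
begin

section \<open>Generating sets and words\<close>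

definition finitely_generated_group :: "('k, 'm) monoid_scheme \<Rightarrow> bool" where
  "finitely_generated_group K \<longleftrightarrow>
     group K \<and> (\<exists>S. finite S \<and> S \<subseteq> carrier K \<and> generate K S = carrier K)"

definition symmetric_generating_set :: "('k, 'm) monoid_scheme \<Rightarrow> 'k set \<Rightarrow> bool" where
  "symmetric_generating_set K S \<longleftrightarrow>
     finite S \<and> S \<subseteq> carrier K \<and> generate K S = carrier K \<and>
     \<one>\<^bsub>K\<^esub> \<in> S \<and> (\<forall>s\<in>S. inv\<^bsub>K\<^esub> s \<in> S)"

definition word_value :: "('k, 'm) monoid_scheme \<Rightarrow> 'k list \<Rightarrow> 'k" where
  "word_value K w = foldr (\<otimes>\<^bsub>K\<^esub>) w \<one>\<^bsub>K\<^esub>"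

definition word_problem :: "('k, 'm) monoid_scheme \<Rightarrow> 'k set \<Rightarrow> 'k list set" where
  "word_problem K S = {w \<in> lists S. word_value K w = \<one>\<^bsub>K\<^esub>}"


section \<open>Turing machines with an oracle\<close>

text \<open>
  Deterministic machines with one two-way infinite work tape and a write-only query tape.
  An ordinary step rewrites the scanned cell, moves the head by at most one cell and possibly
  appends one symbol to the query tape. In the query state the machine goes to the yes- or
  the no-state according to whether the word on the query tape lies in the oracle, and the query
  tape is erased. Reaching the accepting state means acceptance; rejecting by a halt and running
  forever are not distinguished, which is immaterial for semi-decidability.
\<close>

datatype 'i tape_symbol = Blank | Input 'i | Aux nat

datatype move = Move_Left | Stay | Move_Right

fun displacement :: "move \<Rightarrow> int" where
  "displacement Move_Left = -1"
| "displacement Stay = 0"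
| "displacement Move_Right = 1"

record ('i, 'o) oracle_machine =
  states :: "nat set"
  tape_alphabet :: "'i tape_symbol set"
  start_state :: nat
  accept_state :: nat
  query_state :: nat
  yes_state :: nat
  no_state :: nat
  transition :: "nat \<Rightarrow> 'i tape_symbol \<Rightarrow> nat \<times> 'i tape_symbol \<times> move \<times> 'o option"

definition oracle_machine_over ::
    "'i set \<Rightarrow> 'o set \<Rightarrow> ('i, 'o) oracle_machine \<Rightarrow> bool" where
  "oracle_machine_over I Q M \<longleftrightarrow>
     finite (states M) \<and> finite (tape_alphabet M) \<and>
     Blank \<in> tape_alphabet M \<and> Input ` I \<subseteq> tape_alphabet M \<and>
     {start_state M, accept_state M, query_state M, yes_state M, no_state M} \<subseteq> states M \<and>
     accept_state M \<noteq> query_state M \<and>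
     (\<forall>q\<in>states M. \<forall>a\<in>tape_alphabet M.
        transition M q a \<in> states M \<times> tape_alphabet M \<times> UNIV \<times> insert None (Some ` Q))"

record ('i, 'o) machine_config =
  state :: nat
  tape :: "int \<Rightarrow> 'i tape_symbol"
  head :: int
  query_tape :: "'o list"

definition machine_step ::
    "('i, 'o) oracle_machine \<Rightarrow> 'o list set \<Rightarrow> ('i, 'o) machine_config \<Rightarrow> ('i, 'o) machine_config"
  where
  "machine_step M L c =
     (if state c = accept_state M then c
      else if state c = query_state M then
        c\<lparr>state := (if query_tape c \<in> L then yes_state M else no_state M), query_tape := []\<rparr>
      else
        (case transition M (state c) (tape c (head c)) of (q, a, d, u) \<Rightarrow>
           \<lparr>state = q,
            tape = (tape c)(head c := a),
            head = head c + displacement d,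
            query_tape = query_tape c @ (case u of None \<Rightarrow> [] | Some b \<Rightarrow> [b])\<rparr>))"

definition initial_config :: "('i, 'o) oracle_machine \<Rightarrow> 'i list \<Rightarrow> ('i, 'o) machine_config" where
  "initial_config M w =
     \<lparr>state = start_state M,
      tape = (\<lambda>i. if 0 \<le> i \<and> i < int (length w) then Input (w ! nat i) else Blank),
      head = 0,
      query_tape = []\<rparr>"

definition machine_accepts ::
    "('i, 'o) oracle_machine \<Rightarrow> 'o list set \<Rightarrow> 'i list \<Rightarrow> bool" where
  "machine_accepts M L w \<longleftrightarrow>
     (\<exists>n. state ((machine_step M L ^^ n) (initial_config M w)) = accept_state M)"

definition re_language_with_oracle ::
    "'i set \<Rightarrow> 'o set \<Rightarrow> 'o list set \<Rightarrow> 'i list set \<Rightarrow> bool" where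
  "re_language_with_oracle I Q L R \<longleftrightarrow>
     (\<exists>M. oracle_machine_over I Q M \<and> R = {w \<in> lists I. machine_accepts M L w})"


section \<open>Subshifts\<close>

text \<open>Alphabets are finite sets; a configuration is a function on the carrier of the group,
  extended by \<^const>\<open>undefined\<close> outside of it.\<close>

definition full_shift :: "('k, 'm) monoid_scheme \<Rightarrow> 'a set \<Rightarrow> ('k \<Rightarrow> 'a) set" where
  "full_shift K A = (carrier K \<rightarrow>\<^sub>E A)"

definition shift :: "('k, 'm) monoid_scheme \<Rightarrow> 'k \<Rightarrow> ('k \<Rightarrow> 'a) \<Rightarrow> ('k \<Rightarrow> 'a)" where
  "shift K g x = (\<lambda>h\<in>carrier K. x (inv\<^bsub>K\<^esub> g \<otimes>\<^bsub>K\<^esub> h))"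

definition subshift :: "('k, 'm) monoid_scheme \<Rightarrow> 'a set \<Rightarrow> ('k \<Rightarrow> 'a) set \<Rightarrow> bool" where
  "subshift K A X \<longleftrightarrow>
     closedin (product_topology (\<lambda>_. discrete_topology A) (carrier K)) X \<and>
     (\<forall>g\<in>carrier K. \<forall>x\<in>X. shift K g x \<in> X)"

definition cylinder ::
    "('k, 'm) monoid_scheme \<Rightarrow> 'a set \<Rightarrow> 'a \<Rightarrow> 'k \<Rightarrow> ('k \<Rightarrow> 'a) set" where
  "cylinder K A a g = {x \<in> full_shift K A. x g = a}"

text \<open>A pattern is a finite partial map; its support is its domain. The intersection with the
  full shift only matters for the pattern with empty support.\<close>

definition is_pattern :: "('k, 'm) monoid_scheme \<Rightarrow> 'a set \<Rightarrow> ('k \<rightharpoonup> 'a) \<Rightarrow> bool" where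
  "is_pattern K A p \<longleftrightarrow> finite (dom p) \<and> dom p \<subseteq> carrier K \<and> ran p \<subseteq> A"

definition pattern_cylinder ::
    "('k, 'm) monoid_scheme \<Rightarrow> 'a set \<Rightarrow> ('k \<rightharpoonup> 'a) \<Rightarrow> 'k \<Rightarrow> ('k \<Rightarrow> 'a) set" where
  "pattern_cylinder K A p g =
     full_shift K A \<inter> (\<Inter>h\<in>dom p. cylinder K A (the (p h)) (g \<otimes>\<^bsub>K\<^esub> h))"


section \<open>Pattern codings and effectively closed subshifts\<close>

type_synonym ('k, 'a) pattern_coding = "('k list \<times> 'a) set"

definition is_pattern_coding :: "'k set \<Rightarrow> 'a set \<Rightarrow> ('k, 'a) pattern_coding \<Rightarrow> bool" where
  "is_pattern_coding S A c \<longleftrightarrow> finite c \<and> c \<subseteq> lists S \<times> A"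

definition subshift_of_codings ::
    "('k, 'm) monoid_scheme \<Rightarrow> 'a set \<Rightarrow> ('k, 'a) pattern_coding set \<Rightarrow> ('k \<Rightarrow> 'a) set" where
  "subshift_of_codings K A C =
     {x \<in> full_shift K A. \<forall>g\<in>carrier K. \<forall>c\<in>C.
        x \<notin> (\<Inter>(w, a)\<in>c. cylinder K A a (g \<otimes>\<^bsub>K\<^esub> word_value K w))}"

text \<open>A finite listing of the pairs of a coding is written on the tape by concatenating
  the words \<open>w a\<close>; each letter \<open>a\<close> also serves as the end marker of its pair,
  so this is injective on listings.\<close>

definition encode_listing :: "('k list \<times> 'a) list \<Rightarrow> ('k + 'a) list" where
  "encode_listing l = concat (map (\<lambda>(w, a). map Inl w @ [Inr a]) l)"

text \<open>A set of codings is recursively enumerable if it consists of the sets underlying the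
  listings in some recursively enumerable set of listings. (Requiring all listings of a coding
  in the set to be accepted gives the same notion, by enumeration.)\<close>

definition re_codings_with_oracle ::
    "'k set \<Rightarrow> 'a set \<Rightarrow> 'k list set \<Rightarrow> ('k, 'a) pattern_coding set \<Rightarrow> bool" where
  "re_codings_with_oracle S A L C \<longleftrightarrow>
     (\<exists>E. E \<subseteq> lists (lists S \<times> A) \<and>
          re_language_with_oracle (S <+> A) S L (encode_listing ` E) \<and>
          C = set ` E)"

text \<open>Effective closedness does not depend on the finite generating set, since words over one
  generating set are computably rewritten over another one; hence the generating set is
  existentially quantified and not a parameter.\<close>

definition effectively_closed ::
    "('k, 'm) monoid_scheme \<Rightarrow> 'a set \<Rightarrow> ('k \<Rightarrow> 'a) set \<Rightarrow> bool" where
  "effectively_closed K A X \<longleftrightarrow>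
     (\<exists>S C. symmetric_generating_set K S \<and>
            (\<forall>c\<in>C. is_pattern_coding S A c) \<and>
            re_codings_with_oracle S A (word_problem K S) C \<and>
            X = subshift_of_codings K A C)"

definition contains_uniform_configuration ::
    "('k, 'm) monoid_scheme \<Rightarrow> 'a set \<Rightarrow> ('k \<Rightarrow> 'a) set \<Rightarrow> bool" where
  "contains_uniform_configuration K A X \<longleftrightarrow> (\<exists>a\<in>A. (\<lambda>g\<in>carrier K. a) \<in> X)"


section \<open>Products, block codes, projective subdynamics\<close>

definition config_product ::
    "('k, 'm) monoid_scheme \<Rightarrow> ('k \<Rightarrow> 'a) set \<Rightarrow> ('k \<Rightarrow> 'b) set \<Rightarrow> ('k \<Rightarrow> 'a \<times> 'b) set" where
  "config_product K X Y = {(\<lambda>h\<in>carrier K. (x h, y h)) | x y. x \<in> X \<and> y \<in> Y}"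

definition one_block_code ::
    "('k, 'm) monoid_scheme \<Rightarrow> 'c set \<Rightarrow> 'a set \<Rightarrow> (('k \<Rightarrow> 'c) \<Rightarrow> ('k \<Rightarrow> 'a)) \<Rightarrow> bool" where
  "one_block_code K C A \<phi> \<longleftrightarrow>
     (\<exists>\<Phi> \<in> C \<rightarrow> A. \<forall>x\<in>full_shift K C. \<phi> x = (\<lambda>h\<in>carrier K. \<Phi> (x h)))"

abbreviation times_integers :: "('g, 'm) monoid_scheme \<Rightarrow> ('g \<times> int) monoid" where
  "times_integers G \<equiv> G \<times>\<times> integer_group"

definition projective_subdynamics ::
    "('g, 'm) monoid_scheme \<Rightarrow> 'a set \<Rightarrow> ('g \<times> int \<Rightarrow> 'a) set \<Rightarrow> ('g \<Rightarrow> 'a) set" where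
  "projective_subdynamics G A Z =
     {x \<in> full_shift G A. \<exists>z\<in>Z. \<forall>g\<in>carrier G. x g = z (g, 0)}"

end

theory Submission
  imports Defs "HOL-Library.Countable_Set"
begin

text \<open>
Why the theorem holds. In a configuration of the universal subshift \<open>U\<close> every fiber \<open>{g} \<times> \<int>\<close>
carries a text, and this text can contain a program for a machine together with a mark whose
position encodes one letter. The subshift \<open>U\<close> forbids the codings that are enumerated by the programs
written in the configuration itself. The finitely many local rules merely write one fixed program, the one
belonging to \<open>X\<close>, periodically and synchronously into all fibers, together with one letter \<open>x\<^sub>g\<close> in
the fiber of \<open>g\<close>. The second layer \<open>B\<close> stores this letter and the position modulo the period, which
is what allows nearest-neighbour rules to enforce such a text. Reading the letters along \<open>G \<times> {0}\<close>
gives exactly the elements of \<open>X\<close>.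

The difficulty is that \<open>U\<close> must be defined by a single enumerable set of codings which does not know
\<open>X\<close>. A listing in this set has three parts. A \<^emph>\<open>stream\<close> of pairs \<open>(t\<^sup>n, b)\<close>, with \<open>t\<close> the generator of
\<open>\<int>\<close>, says that the cell \<open>b\<close> stands at height \<open>n\<close>. The pair of the empty word and a marker fixes the
phase of the periodic rows. A \<^emph>\<open>text\<close> of pairs \<open>(w t\<^sup>k, Flag)\<close> says that the letter with number \<open>k\<close>
stands at the group element \<open>w\<close>. One fixed oracle machine, the interpreter, decides which listings
belong to the set: it executes the cells of the stream, one after the other, as instructions acting
on a queue that initially contains the text. Since the stream is part of the forbidden pattern, this
pattern occurs only where the executed instructions really are written; hence the interpreter never
has to know the program. Heights inside an instruction block must be consecutive,
but every block may start at an arbitrary height. So the streams that hold in a row with a given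
program are precisely the sequences of rules of this program, and the listing acts as the witness of
a nondeterministic computation: a wrong guess makes some \<open>Pop\<close> fail and does no harm.

An oracle machine becomes such a program by keeping its configuration in the queue as a cyclic word
which is rewritten around the symbol for its state, as in Post's rewriting systems. Queries are
passed on to the oracle of the interpreter after replacing each generator by a word.

The proof rests on \<open>interpreter_accepts_iff\<close> (what the interpreter accepts),
\<open>queue_program_accepts_iff\<close> (a program accepts a text iff the machine accepts the word it spells),
\<open>opens_matching_is_bracket\<close> (streams that hold in a row are sequences of rules) and their
combination \<open>universal_iff\<close>: a configuration with correct rows lies in \<open>U\<close> iff its letters form a
configuration in \<open>X\<close>.
\<close>


section \<open>Words over generating sets\<close>

lemma word_value_simps [simp]:
  "word_value K [] = \<one>\<^bsub>K\<^esub>"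
  "word_value K (s # w) = s \<otimes>\<^bsub>K\<^esub> word_value K w"
  by (simp_all add: word_value_def)

lemma word_value_closed:
  assumes "group K" "set w \<subseteq> carrier K"
  shows "word_value K w \<in> carrier K"
proof -
  interpret group K by fact
  show ?thesis using assms(2) by (induction w) auto
qed

lemma word_value_append:
  assumes "group K" "set v \<subseteq> carrier K" "set w \<subseteq> carrier K"
  shows "word_value K (v @ w) = word_value K v \<otimes>\<^bsub>K\<^esub> word_value K w"
proof -
  interpret group K by fact
  show ?thesis using assms(2,3) by (induction v) (auto simp: m_assoc word_value_closed)
qed

lemma word_value_concat_map:
  assumes "group K" "\<And>s. s \<in> set w \<Longrightarrow> set (f s) \<subseteq> carrier K \<and> word_value K (f s) = g s"
  shows "word_value K (concat (map f w)) = word_value K (map g w)"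
  using assms(2)
  by (induction w) (auto simp: word_value_append[OF assms(1)] UN_subset_iff)

lemma generate_word_value:
  assumes "group K" "S \<subseteq> carrier K" "\<And>s. s \<in> S \<Longrightarrow> inv\<^bsub>K\<^esub> s \<in> S" "\<one>\<^bsub>K\<^esub> \<in> S"
    "x \<in> generate K S"
  shows "\<exists>w. w \<noteq> [] \<and> set w \<subseteq> S \<and> word_value K w = x"
proof -
  interpret group K by fact
  have *: "word_value K [s] = s" if "s \<in> S" for s using that assms(2) by auto
  show ?thesis using assms(5)
  proof (induction rule: generate.induct)
    case one show ?case using *[of "\<one>\<^bsub>K\<^esub>"] assms(4) by (intro exI[of _ "[\<one>\<^bsub>K\<^esub>]"]) auto
  next
    case (incl h) then show ?case using * by (intro exI[of _ "[h]"]) auto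
  next
    case (inv h) then show ?case using *[of "inv\<^bsub>K\<^esub> h"] assms(3)
      by (intro exI[of _ "[inv\<^bsub>K\<^esub> h]"]) auto
  next
    case (eng h1 h2)
    then obtain v w where "v \<noteq> []" "set v \<subseteq> S" "word_value K v = h1"
      "w \<noteq> []" "set w \<subseteq> S" "word_value K w = h2" by blast
    then show ?case using assms(2)
      by (intro exI[of _ "v @ w"]) (auto simp: word_value_append[OF assms(1)])
  qed
qed

lemma ex_symmetric_generating_set:
  assumes "finitely_generated_group K"
  shows "\<exists>S. symmetric_generating_set K S"
proof -
  from assms obtain S where K: "group K" and S: "finite S" "S \<subseteq> carrier K" "generate K S = carrier K"
    unfolding finitely_generated_group_def by auto
  interpret group K by fact
  let ?S = "S \<union> m_inv K ` S \<union> {\<one>\<^bsub>K\<^esub>}"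
  have "carrier K \<subseteq> generate K ?S"
    using S(3) mono_generate[of S ?S] by auto
  moreover have "generate K ?S \<subseteq> carrier K" using S by (intro generate_incl) auto
  ultimately have "symmetric_generating_set K ?S"
    using S unfolding symmetric_generating_set_def by (auto simp: subset_iff)
  then show ?thesis by blast
qed

section \<open>Codings define subshifts\<close>

text \<open>
The conditions of a coding at a fixed group element form a finite intersection of cylinders, hence
an open set, and a translate of a configuration meets the same codings at translated elements.
\<close>

lemma subshift_subshift_of_codings:
  assumes "group K" "symmetric_generating_set K S" "\<forall>c\<in>C. is_pattern_coding S A c"
  shows "subshift K A (subshift_of_codings K A C)"
proof -
  interpret group K by fact
  let ?T = "product_topology (\<lambda>_. discrete_topology A) (carrier K)"
  have top: "topspace ?T = full_shift K A" by (simp add: full_shift_def)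
  have S: "S \<subseteq> carrier K" using assms(2) by (simp add: symmetric_generating_set_def)
  have val: "word_value K w \<in> carrier K" if "c \<in> C" "(w, a) \<in> c" for c w a
    using assms(3) that S
    by (intro word_value_closed[OF assms(1)]) (fastforce simp: is_pattern_coding_def)
  have cyl: "openin ?T (cylinder K A a g)" if "a \<in> A" "g \<in> carrier K" for a g
  proof -
    have "openin ?T {x \<in> topspace ?T. x g \<in> {a}}"
      by (rule openin_continuous_map_preimage[OF continuous_map_product_projection])
        (use that in auto)
    then show ?thesis by (simp add: full_shift_def cylinder_def)
  qed
  have op: "openin ?T (topspace ?T \<inter> (\<Inter>(w, a)\<in>c. cylinder K A a (g \<otimes>\<^bsub>K\<^esub> word_value K w)))"
    if "g \<in> carrier K" "c \<in> C" for g c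
  proof -
    have c: "finite c" "c \<subseteq> lists S \<times> A" using assms(3) that by (auto simp: is_pattern_coding_def)
    have "openin ?T (\<Inter>(insert (topspace ?T)
        ((\<lambda>(w, a). cylinder K A a (g \<otimes>\<^bsub>K\<^esub> word_value K w)) ` c)))"
    proof (rule openin_Inter)
      fix U
      assume "U \<in> insert (topspace ?T) ((\<lambda>(w, a). cylinder K A a (g \<otimes>\<^bsub>K\<^esub> word_value K w)) ` c)"
      then consider "U = topspace ?T"
        | w a where "(w, a) \<in> c" "U = cylinder K A a (g \<otimes>\<^bsub>K\<^esub> word_value K w)" by auto
      then show "openin ?T U"
      proof cases
        case 1 then show ?thesis by (simp only: openin_topspace)
      next
        case 2 then show ?thesis using c cyl val[OF that(2)] that(1) by auto
      qed
    qed (use c in auto)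
    then show ?thesis by simp
  qed
  have "subshift_of_codings K A C = topspace ?T -
     (\<Union>g\<in>carrier K. \<Union>c\<in>C. topspace ?T \<inter>
        (\<Inter>(w, a)\<in>c. cylinder K A a (g \<otimes>\<^bsub>K\<^esub> word_value K w)))"
    unfolding top subshift_of_codings_def by auto
  moreover have "closedin ?T \<dots>"
  proof (intro closedin_diff closedin_topspace openin_Union, elim imageE, hypsubst)
    fix g assume "g \<in> carrier K"
    then show "openin ?T (\<Union>c\<in>C. topspace ?T \<inter>
        (\<Inter>(w, a)\<in>c. cylinder K A a (g \<otimes>\<^bsub>K\<^esub> word_value K w)))"
      by (intro openin_Union, elim imageE, hypsubst, intro op)
  qed
  ultimately have "closedin ?T (subshift_of_codings K A C)" by simp
  moreover have "shift K g x \<in> subshift_of_codings K A C"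
    if g: "g \<in> carrier K" and x: "x \<in> subshift_of_codings K A C" for g x
  proof -
    have full: "x \<in> full_shift K A" using x by (simp add: subshift_of_codings_def)
    then have full': "shift K g x \<in> full_shift K A" using g
      by (auto simp: full_shift_def shift_def)
    have "\<exists>(w, a)\<in>c. shift K g x (h \<otimes>\<^bsub>K\<^esub> word_value K w) \<noteq> a"
      if h: "h \<in> carrier K" "c \<in> C" for h c
    proof -
      have "inv\<^bsub>K\<^esub> g \<otimes>\<^bsub>K\<^esub> h \<in> carrier K" using g h by auto
      then obtain w a where wa: "(w, a) \<in> c"
          "x (inv\<^bsub>K\<^esub> g \<otimes>\<^bsub>K\<^esub> h \<otimes>\<^bsub>K\<^esub> word_value K w) \<noteq> a"
        using x full h unfolding subshift_of_codings_def cylinder_def by fastforce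
      have "shift K g x (h \<otimes>\<^bsub>K\<^esub> word_value K w) \<noteq> a"
        using wa(2) val[OF h(2) wa(1)] g h by (simp add: shift_def m_assoc)
      then show ?thesis using wa(1) by blast
    qed
    then show ?thesis using full' unfolding subshift_of_codings_def cylinder_def by fastforce
  qed
  ultimately show ?thesis by (simp add: subshift_def)
qed

lemma mem_subshift_of_codings:
  assumes "x \<in> full_shift K A"
  shows "x \<in> subshift_of_codings K A C \<longleftrightarrow>
    (\<forall>g\<in>carrier K. \<forall>c\<in>C. \<exists>q\<in>c. x (g \<otimes>\<^bsub>K\<^esub> word_value K (fst q)) \<noteq> snd q)"
  using assms unfolding subshift_of_codings_def cylinder_def by (simp add: case_prod_beta)

section \<open>Machines acting on finite tape segments\<close>

text \<open>
A machine configuration is represented by the state, the tape to the left of the head in reversed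
order, the tape from the head on to the right, and the query tape; cells beyond the two lists are
blank. The lists are not normalized: trailing blanks may be present or absent. The position of the
head disappears, so that computations can be described by equations between lists.
\<close>

type_synonym ('i, 'o) segment = "nat \<times> 'i tape_symbol list \<times> 'i tape_symbol list \<times> 'o list"

definition scanned :: "'i tape_symbol list \<Rightarrow> 'i tape_symbol" where
  "scanned rs = (case rs of [] \<Rightarrow> Blank | a # _ \<Rightarrow> a)"

lemma scanned_simps [simp]: "scanned [] = Blank" "scanned (a # rs) = a"
  by (simp_all add: scanned_def)

fun write_move :: "move \<Rightarrow> 'i tape_symbol \<Rightarrow> 'i tape_symbol list \<Rightarrow> 'i tape_symbol list \<Rightarrow>
    'i tape_symbol list \<times> 'i tape_symbol list" where
  "write_move Move_Left a [] rs = ([], Blank # a # rs)"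
| "write_move Move_Left a (b # ls) rs = (ls, b # a # rs)"
| "write_move Stay a ls rs = (ls, a # rs)"
| "write_move Move_Right a ls rs = (a # ls, rs)"

fun segment_step :: "('i, 'o) oracle_machine \<Rightarrow> 'o list set \<Rightarrow> ('i, 'o) segment \<Rightarrow> ('i, 'o) segment"
  where
  "segment_step M L (q, ls, rs, u) =
     (if q = accept_state M then (q, ls, rs, u)
      else if q = query_state M then (if u \<in> L then yes_state M else no_state M, ls, rs, [])
      else (case transition M q (scanned rs) of (q', a, d, b) \<Rightarrow>
        (q', fst (write_move d a ls (tl rs)), snd (write_move d a ls (tl rs)),
         u @ (case b of None \<Rightarrow> [] | Some b \<Rightarrow> [b]))))"

definition accepts_from :: "('i, 'o) oracle_machine \<Rightarrow> 'o list set \<Rightarrow> ('i, 'o) segment \<Rightarrow> bool" where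
  "accepts_from M L c \<longleftrightarrow> (\<exists>n. fst ((segment_step M L ^^ n) c) = accept_state M)"

text \<open>
Padding by blanks makes all representations of the same tape indistinguishable.
\<close>

definition blank_nth :: "'i tape_symbol list \<Rightarrow> nat \<Rightarrow> 'i tape_symbol" where
  "blank_nth xs k = (if k < length xs then xs ! k else Blank)"

lemma blank_nth_simps [simp]:
  "blank_nth [] k = Blank" "blank_nth (a # xs) 0 = a" "blank_nth (a # xs) (Suc k) = blank_nth xs k"
  by (auto simp: blank_nth_def)

lemma blank_nth_0: "blank_nth xs 0 = scanned xs"
  by (cases xs) auto

lemma blank_nth_Suc: "blank_nth xs (Suc k) = blank_nth (tl xs) k"
  by (cases xs) auto

definition represents :: "('i, 'o) machine_config \<Rightarrow> ('i, 'o) segment \<Rightarrow> bool" where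
  "represents c s = (case s of (q, ls, rs, u) \<Rightarrow>
     state c = q \<and> query_tape c = u \<and>
     (\<forall>k. tape c (head c + int k) = blank_nth rs k \<and> tape c (head c - 1 - int k) = blank_nth ls k))"

lemma represents_step:
  assumes "represents c s"
  shows "represents (machine_step M L c) (segment_step M L s)"
proof -
  obtain q ls rs u where s: "s = (q, ls, rs, u)" by (cases s)
  note r = assms[unfolded s represents_def, simplified]
  have q: "state c = q" and u: "query_tape c = u"
    and R: "\<And>k. tape c (head c + int k) = blank_nth rs k"
    and L: "\<And>k. tape c (head c - 1 - int k) = blank_nth ls k"
    using r by auto
  have sc: "tape c (head c) = scanned rs" using R[of 0] by (simp add: blank_nth_0)
  show ?thesis
  proof (cases "q = accept_state M \<or> q = query_state M")
    case True
    then show ?thesis using r by (auto simp: s represents_def machine_step_def)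
  next
    case False
    obtain q' a d b where t: "transition M q (scanned rs) = (q', a, d, b)"
      by (cases "transition M q (scanned rs)") auto
    let ?T = "(tape c)(head c := a)"
    have TR: "?T (head c + 1 + int k) = blank_nth (tl rs) k" for k
      using R[of "Suc k"] by (simp add: blank_nth_Suc algebra_simps)
    have TL: "?T (head c - 1 - int k) = blank_nth ls k" for k
      using L[of k] by simp
    have T0: "?T (head c) = a" by simp
    have "(\<forall>k. ?T (head c + displacement d + int k)
              = blank_nth (snd (write_move d a ls (tl rs))) k \<and>
            ?T (head c + displacement d - 1 - int k)
              = blank_nth (fst (write_move d a ls (tl rs))) k)" (is "\<forall>k. ?P k")
    proof
      fix k
      show "?P k"
      proof (cases d)
        case Move_Left
        have 1: "?T (head c - 1 + int k) = blank_nth (scanned ls # a # tl rs) k"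
        proof (cases k)
          case 0 then show ?thesis using TL[of 0] by (simp add: blank_nth_0)
        next
          case (Suc k')
          then show ?thesis using TR[of "k' - 1"] T0
            by (cases k') (auto simp: algebra_simps)
        qed
        have 2: "?T (head c - 1 - 1 - int k) = blank_nth (tl ls) k"
          using TL[of "Suc k"] by (simp add: blank_nth_Suc algebra_simps)
        show ?thesis using 1 2 Move_Left by (cases ls) auto
      next
        case Stay
        have "?T (head c + int k) = blank_nth (a # tl rs) k"
          using TR[of "k - 1"] T0 by (cases k) (auto simp: algebra_simps)
        then show ?thesis using Stay TL[of k] by simp
      next
        case Move_Right
        have "?T (head c + 1 - 1 - int k) = blank_nth (a # ls) k"
          using TL[of "k - 1"] T0 by (cases k) (auto simp: algebra_simps)
        then show ?thesis using Move_Right TR[of k] by simp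
      qed
    qed
    then show ?thesis using False
      by (simp add: s represents_def machine_step_def q u sc t)
  qed
qed

lemma represents_initial: "represents (initial_config M w) (start_state M, [], map Input w, [])"
  by (auto simp: represents_def initial_config_def blank_nth_def)

lemma machine_accepts_iff_accepts_from:
  "machine_accepts M L w \<longleftrightarrow> accepts_from M L (start_state M, [], map Input w, [])"
proof -
  have "represents ((machine_step M L ^^ n) (initial_config M w))
      ((segment_step M L ^^ n) (start_state M, [], map Input w, []))" for n
    by (induction n) (auto intro: represents_step represents_initial)
  then have "state ((machine_step M L ^^ n) (initial_config M w)) =
      fst ((segment_step M L ^^ n) (start_state M, [], map Input w, []))" for n
    by (metis (mono_tags, lifting) represents_def case_prod_beta)
  then show ?thesis by (simp add: machine_accepts_def accepts_from_def)
qed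

text \<open>
Machines are deterministic, so acceptance is invariant under a step in both directions. The runs of
the interpreter are therefore described by equivalences between acceptance from two configurations,
which cover completeness and soundness at once.
\<close>

lemma accepts_from_step: "accepts_from M L c = accepts_from M L (segment_step M L c)"
proof
  assume "accepts_from M L c"
  then obtain n where n: "fst ((segment_step M L ^^ n) c) = accept_state M"
    by (auto simp: accepts_from_def)
  then have "fst ((segment_step M L ^^ Suc n) c) = accept_state M"
    by (cases "(segment_step M L ^^ n) c") auto
  then have "fst ((segment_step M L ^^ n) (segment_step M L c)) = accept_state M"
    by (simp only: funpow_Suc_right o_apply)
  then show "accepts_from M L (segment_step M L c)"
    unfolding accepts_from_def by blast
next
  assume "accepts_from M L (segment_step M L c)"
  then obtain n where "fst ((segment_step M L ^^ n) (segment_step M L c)) = accept_state M"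
    by (auto simp: accepts_from_def)
  then have "fst ((segment_step M L ^^ Suc n) c) = accept_state M"
    by (simp only: funpow_Suc_right o_apply)
  then show "accepts_from M L c" unfolding accepts_from_def by blast
qed

lemma accepts_from_accept [simp]: "accepts_from M L (accept_state M, ls, rs, u)"
  unfolding accepts_from_def by (rule exI[of _ 0]) simp

lemma accepts_from_query:
  assumes "query_state M \<noteq> accept_state M"
  shows "accepts_from M L (query_state M, ls, rs, u) =
    accepts_from M L (if u \<in> L then yes_state M else no_state M, ls, rs, [])"
  by (subst accepts_from_step) (use assms in simp)

lemma accepts_from_transition:
  assumes "q \<noteq> accept_state M" "q \<noteq> query_state M" "transition M q (scanned rs) = (q', a, d, b)"
  shows "accepts_from M L (q, ls, rs, u) =
    accepts_from M L (q', fst (write_move d a ls (tl rs)), snd (write_move d a ls (tl rs)),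
      u @ (case b of None \<Rightarrow> [] | Some b \<Rightarrow> [b]))"
  by (subst accepts_from_step) (use assms in simp)

lemma accepts_from_trapped:
  assumes "q \<noteq> accept_state M" "\<And>s. fst s = q \<Longrightarrow> fst (segment_step M L s) = q" "fst s = q"
  shows "\<not> accepts_from M L s"
proof -
  have "fst ((segment_step M L ^^ n) s) = q" for n by (induction n) (use assms in auto)
  then show ?thesis using assms(1) by (simp add: accepts_from_def)
qed

lemma accepts_from_sweep_right:
  assumes "q \<noteq> accept_state M" "q \<noteq> query_state M"
    "\<And>a. a \<in> set as \<Longrightarrow> transition M q a = (q, a, Move_Right, None)"
  shows "accepts_from M L (q, ls, as @ rs, u) = accepts_from M L (q, rev as @ ls, rs, u)"
  using assms(3)
proof (induction as arbitrary: ls)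
  case (Cons a as)
  have "accepts_from M L (q, ls, (a # as) @ rs, u) = accepts_from M L (q, a # ls, as @ rs, u)"
    using Cons.prems by (subst accepts_from_transition[OF assms(1,2)]) auto
  then show ?case using Cons by simp
qed simp

lemma accepts_from_sweep_left:
  assumes "q \<noteq> accept_state M" "q \<noteq> query_state M"
    "\<And>a. a \<in> set as \<Longrightarrow> transition M q a = (q, a, Move_Left, None)"
  shows "accepts_from M L (q, fst (write_move Move_Left a (as @ b # ls) rs),
      snd (write_move Move_Left a (as @ b # ls) rs), u) =
    accepts_from M L (q, ls, b # rev as @ a # rs, u)"
  using assms(3)
proof (induction as arbitrary: a rs)
  case (Cons a' as)
  have "accepts_from M L (q, as @ b # ls, a' # a # rs, u) =
    accepts_from M L (q, fst (write_move Move_Left a' (as @ b # ls) (a # rs)),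
      snd (write_move Move_Left a' (as @ b # ls) (a # rs)), u)"
    using Cons.prems by (subst accepts_from_transition[OF assms(1,2)]) auto
  then show ?case using Cons by simp
qed simp

section \<open>Programs for a queue\<close>

text \<open>
The letters \<open>Gen i\<close> and \<open>Star\<close> stand for the generators and the flags of a text, \<open>End\<close> follows
the text, and \<open>Zero\<close> and \<open>One\<close> are left for the use of programs. Cells are the symbols that fill the
fibers; \<open>Void\<close>, \<open>Mark\<close> and \<open>Flag\<close> are not instructions. The type \<open>scratch\<close> contains the symbols
which the interpreter writes on its tape, and \<open>control\<close> its states.
\<close>

datatype queue_letter = Gen nat | Star | End | Zero | One

datatype cell = Void | Mark | Flag | Open | Close
  | Pop queue_letter | Push queue_letter | Emit nat | Ask bool | Accept

datatype scratch = Used | Here | Item queue_letter | Check cell | Asked bool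

datatype control = Start | Enter | Ready | Between | Back | Measure | Compare
  | Query | Yes | No | Text | TextEnd | Rewind | Fetch
  | Find queue_letter | Take queue_letter | Append queue_letter | Return | Halt | Stuck

instance queue_letter :: countable by countable_datatype
instance cell :: countable by countable_datatype
instance scratch :: countable by countable_datatype
instance control :: countable by countable_datatype

text \<open>
Instructions act on a queue and on a query tape. A mismatch in \<open>Pop\<close> or \<open>Ask\<close> is a dead end, like the
end of the list; this is what makes wrong guesses harmless.
\<close>

fun runs :: "'k set \<Rightarrow> 'k list set \<Rightarrow> cell list \<Rightarrow> queue_letter list \<Rightarrow> 'k list \<Rightarrow> bool" where
  "runs S L [] q u \<longleftrightarrow> False"
| "runs S L (c # cs) q u \<longleftrightarrow> (case c of
      Open \<Rightarrow> runs S L cs q u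
    | Close \<Rightarrow> runs S L cs q u
    | Pop x \<Rightarrow> (case q of [] \<Rightarrow> False | y # q' \<Rightarrow> x = y \<and> runs S L cs q' u)
    | Push x \<Rightarrow> runs S L cs (q @ [x]) u
    | Emit i \<Rightarrow> runs S L cs q (u @ [from_nat_into S i])
    | Ask b \<Rightarrow> (u \<in> L \<longleftrightarrow> b) \<and> runs S L cs q []
    | Accept \<Rightarrow> True
    | _ \<Rightarrow> False)"

text \<open>
The admissible streams: blocks which lead from \<open>Open\<close> to \<open>Close\<close> through consecutive heights; the
height of \<open>Open\<close> is arbitrary.
\<close>

fun opens :: "(nat \<times> cell) list \<Rightarrow> bool" and continues :: "nat \<Rightarrow> (nat \<times> cell) list \<Rightarrow> bool" where
  "opens [] \<longleftrightarrow> True"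
| "opens ((n, c) # bs) \<longleftrightarrow> c = Open \<and> continues n bs"
| "continues n [] \<longleftrightarrow> False"
| "continues n ((m, c) # bs) \<longleftrightarrow> m = Suc n \<and> c \<noteq> Open \<and> c \<noteq> Mark \<and>
     (if c = Close then opens bs else continues m bs)"

section \<open>The interpreter\<close>

text \<open>
A tape symbol with the natural number in it decoded.
\<close>

datatype 'k content = Nothing | Letter 'k | Cell cell | Scratch scratch

fun view :: "('k + nat) tape_symbol \<Rightarrow> 'k content" where
  "view Blank = Nothing"
| "view (Input (Inl s)) = Letter s"
| "view (Input (Inr b)) = Cell (from_nat b)"
| "view (Aux n) = Scratch (from_nat n)"

abbreviation write_cell :: "cell \<Rightarrow> ('k + nat) tape_symbol" where
  "write_cell c \<equiv> Input (Inr (to_nat c))"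

abbreviation write_scratch :: "scratch \<Rightarrow> ('k + nat) tape_symbol" where
  "write_scratch x \<equiv> Aux (to_nat x)"

fun queue_value :: "'k set \<Rightarrow> 'k content \<Rightarrow> queue_letter option" where
  "queue_value S (Letter s) = Some (Gen (to_nat_on S s))"
| "queue_value S (Cell c) = (if c = Flag then Some Star else None)"
| "queue_value S (Scratch (Item x)) = Some x"
| "queue_value S _ = None"

type_synonym 'k move_result = "control \<times> ('k + nat) tape_symbol \<times> move \<times> 'k option"

abbreviation (input) go_right :: "control \<Rightarrow> ('k + nat) tape_symbol \<Rightarrow> 'k move_result" where
  "go_right q a \<equiv> (q, a, Move_Right, None)"
abbreviation (input) go_left :: "control \<Rightarrow> ('k + nat) tape_symbol \<Rightarrow> 'k move_result" where
  "go_left q a \<equiv> (q, a, Move_Left, None)"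
abbreviation (input) stay :: "control \<Rightarrow> ('k + nat) tape_symbol \<Rightarrow> 'k move_result" where
  "stay q a \<equiv> (q, a, Stay, None)"

text \<open>
The interpreter works in two phases. In the first one (up to \<open>Rewind\<close>) it checks the format of
the listing. Whether two successive heights \<open>n\<close> and \<open>m\<close> satisfy \<open>m = n + 1\<close> is left to the oracle:
\<open>Measure\<close> and \<open>Compare\<close> emit the word \<open>t\<^sup>n t t'\<^sup>m\<close>. A height inside a block is compared
with the preceding and with the following one, so the head goes \<open>Back\<close> over it after the first query.
In the second phase the interpreter executes the cells. A cell that is being executed is overwritten by \<open>Here\<close> so that \<open>Return\<close> finds it
again; the front of the queue is the first symbol behind the marker which is not \<open>Used\<close>.

There is only one state for queries, and it leads to fixed states for the two answers. What has to
survive a query is therefore written into the scanned cell, as \<open>Check c\<close> or \<open>Asked b\<close>.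
\<close>

fun action :: "'k set \<Rightarrow> 'k \<Rightarrow> 'k \<Rightarrow> control \<Rightarrow> ('k + nat) tape_symbol \<Rightarrow> 'k move_result" where
  "action S t t' Start a = go_left Enter a"
| "action S t t' Enter a = go_right Ready a"
| "action S t t' Ready a = (case view a of
     Letter s \<Rightarrow> if s = t then go_right Between a else stay Stuck a
   | Cell c \<Rightarrow> if c = Open then go_left Back a else if c = Mark then go_right TextEnd a
       else stay Stuck a
   | _ \<Rightarrow> stay Stuck a)"
| "action S t t' Between a = (case view a of
     Letter s \<Rightarrow> if s = t then go_right Between a else stay Stuck a
   | Cell c \<Rightarrow> if c = Open then go_left Back a else stay Stuck a
   | _ \<Rightarrow> stay Stuck a)"
| "action S t t' Back a = (case view a of
     Letter s \<Rightarrow> go_left Back a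
   | _ \<Rightarrow> go_right Measure a)"
| "action S t t' Measure a = (case view a of
     Letter s \<Rightarrow> (Measure, a, Move_Right, Some t)
   | Cell c \<Rightarrow> (Compare, a, Move_Right, Some t)
   | _ \<Rightarrow> stay Stuck a)"
| "action S t t' Compare a = (case view a of
     Letter s \<Rightarrow> if s = t then (Compare, a, Move_Right, Some t') else stay Stuck a
   | Cell c \<Rightarrow> if c = Open \<or> c = Mark then stay Stuck a
       else stay Query (write_scratch (Check c))
   | _ \<Rightarrow> stay Stuck a)"
| "action S t t' Query a = stay Stuck a"
| "action S t t' Yes a = (case view a of
     Scratch (Check c) \<Rightarrow>
       if c = Close then go_right Ready (write_cell c) else go_left Back (write_cell c)
   | Scratch (Asked b) \<Rightarrow> if b then go_right Fetch (write_scratch Used) else stay Stuck a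
   | _ \<Rightarrow> stay Stuck a)"
| "action S t t' No a = (case view a of
     Scratch (Asked b) \<Rightarrow> if b then stay Stuck a else go_right Fetch (write_scratch Used)
   | _ \<Rightarrow> stay Stuck a)"
| "action S t t' Text a = (case view a of
     Letter s \<Rightarrow> go_right Text a
   | Cell c \<Rightarrow> if c = Flag then go_right TextEnd a else stay Stuck a
   | _ \<Rightarrow> stay Stuck a)"
| "action S t t' TextEnd a = (case view a of
     Letter s \<Rightarrow> go_right Text a
   | Cell c \<Rightarrow> if c = Flag then go_right TextEnd a else stay Stuck a
   | Nothing \<Rightarrow> go_left Rewind (write_scratch (Item End))
   | _ \<Rightarrow> stay Stuck a)"
| "action S t t' Rewind a = (if a = Blank then go_right Fetch a else go_left Rewind a)"
| "action S t t' Fetch a = (case view a of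
     Letter s \<Rightarrow> go_right Fetch a
   | Cell c \<Rightarrow> (case c of
       Open \<Rightarrow> go_right Fetch a
     | Close \<Rightarrow> go_right Fetch a
     | Pop x \<Rightarrow> go_right (Find x) (write_scratch Here)
     | Push x \<Rightarrow> go_right (Append x) (write_scratch Here)
     | Emit i \<Rightarrow> (Fetch, a, Move_Right, Some (from_nat_into S i))
     | Ask b \<Rightarrow> stay Query (write_scratch (Asked b))
     | Accept \<Rightarrow> stay Halt a
     | _ \<Rightarrow> stay Stuck a)
   | _ \<Rightarrow> stay Stuck a)"
| "action S t t' (Find x) a =
     (if a = write_cell Mark then go_right (Take x) a else go_right (Find x) a)"
| "action S t t' (Take x) a =
     (if a = write_scratch Used then go_right (Take x) a
      else if queue_value S (view a) = Some x then go_left Return (write_scratch Used)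
      else stay Stuck a)"
| "action S t t' (Append x) a =
     (if a = Blank then go_left Return (write_scratch (Item x)) else go_right (Append x) a)"
| "action S t t' Return a =
     (if a = write_scratch Here then go_right Fetch (write_scratch Used) else go_left Return a)"
| "action S t t' Halt a = stay Halt a"
| "action S t t' Stuck a = stay Stuck a"

text \<open>
Generators enter the finite alphabets of natural numbers through their index in a fixed
enumeration of the generating set.
\<close>

definition generator_codes :: "'k set \<Rightarrow> nat set" where
  "generator_codes S = to_nat_on S ` S"

definition queue_alphabet :: "'k set \<Rightarrow> queue_letter set" where
  "queue_alphabet S = {Star, End, Zero, One} \<union> Gen ` generator_codes S"

definition cell_alphabet :: "'k set \<Rightarrow> cell set" where
  "cell_alphabet S = {Void, Mark, Flag, Open, Close, Accept} \<union> range Ask \<union>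
     Pop ` queue_alphabet S \<union> Push ` queue_alphabet S \<union> Emit ` generator_codes S"

definition scratch_alphabet :: "'k set \<Rightarrow> scratch set" where
  "scratch_alphabet S = {Used, Here} \<union> range Asked \<union> Item ` queue_alphabet S \<union>
     Check ` cell_alphabet S"

definition control_set :: "'k set \<Rightarrow> control set" where
  "control_set S = {Start, Enter, Ready, Between, Back, Measure, Compare, Query, Yes, No, Text,
     TextEnd, Rewind, Fetch, Return, Halt, Stuck} \<union>
     Find ` queue_alphabet S \<union> Take ` queue_alphabet S \<union> Append ` queue_alphabet S"

definition row_alphabet :: "'k set \<Rightarrow> nat set" where
  "row_alphabet S = to_nat ` cell_alphabet S"

definition interpreter :: "'k set \<Rightarrow> 'k \<Rightarrow> 'k \<Rightarrow> ('k + nat, 'k) oracle_machine" where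
  "interpreter S t t' = \<lparr>
     states = to_nat ` control_set S,
     tape_alphabet = {Blank} \<union> Input ` (S <+> row_alphabet S) \<union> Aux ` to_nat ` scratch_alphabet S,
     start_state = to_nat Start,
     accept_state = to_nat Halt,
     query_state = to_nat Query,
     yes_state = to_nat Yes,
     no_state = to_nat No,
     transition = (\<lambda>q a. case action S t t' (from_nat q) a of (q', r) \<Rightarrow> (to_nat q', r))\<rparr>"

lemma finite_alphabets:
  assumes "finite S"
  shows "finite (generator_codes S)" "finite (queue_alphabet S)" "finite (cell_alphabet S)"
    "finite (row_alphabet S)" "finite (scratch_alphabet S)" "finite (control_set S)"
proof -
  show 1: "finite (generator_codes S)" using assms by (simp add: generator_codes_def)
  then show 2: "finite (queue_alphabet S)" by (simp add: queue_alphabet_def)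
  then show 3: "finite (cell_alphabet S)" using 1 by (simp add: cell_alphabet_def)
  show "finite (row_alphabet S)" using 3 by (simp add: row_alphabet_def)
  show "finite (scratch_alphabet S)" using 2 3 by (simp add: scratch_alphabet_def)
  show "finite (control_set S)" using 2 by (simp add: control_set_def)
qed

lemma alphabet_simps [simp]:
  "Find x \<in> control_set S \<longleftrightarrow> x \<in> queue_alphabet S"
  "Take x \<in> control_set S \<longleftrightarrow> x \<in> queue_alphabet S"
  "Append x \<in> control_set S \<longleftrightarrow> x \<in> queue_alphabet S"
  "{Start, Enter, Ready, Between, Back, Measure, Compare, Query, Yes, No, Text, TextEnd, Rewind,
    Fetch, Return, Halt, Stuck} \<subseteq> control_set S"
  "Item x \<in> scratch_alphabet S \<longleftrightarrow> x \<in> queue_alphabet S"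
  "Check c \<in> scratch_alphabet S \<longleftrightarrow> c \<in> cell_alphabet S"
  "{Used, Here, Asked b} \<subseteq> scratch_alphabet S"
  "Pop x \<in> cell_alphabet S \<longleftrightarrow> x \<in> queue_alphabet S"
  "Push x \<in> cell_alphabet S \<longleftrightarrow> x \<in> queue_alphabet S"
  "{Void, Mark, Flag, Open, Close, Accept, Ask b} \<subseteq> cell_alphabet S"
  "End \<in> queue_alphabet S"
  by (auto simp: control_set_def scratch_alphabet_def cell_alphabet_def queue_alphabet_def)

lemma tape_alphabet_simps [simp]:
  "Blank \<in> tape_alphabet (interpreter S t t')"
  "Input (Inl s) \<in> tape_alphabet (interpreter S t t') \<longleftrightarrow> s \<in> S"
  "write_cell c \<in> tape_alphabet (interpreter S t t') \<longleftrightarrow> c \<in> cell_alphabet S"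
  "write_scratch x \<in> tape_alphabet (interpreter S t t') \<longleftrightarrow> x \<in> scratch_alphabet S"
  by (auto simp: interpreter_def row_alphabet_def)

lemma action_closed:
  assumes "t \<in> S" "t' \<in> S" "q \<in> control_set S" "a \<in> tape_alphabet (interpreter S t t')"
  shows "action S t t' q a \<in>
    control_set S \<times> tape_alphabet (interpreter S t t') \<times> UNIV \<times> insert None (Some ` S)"
proof -
  have S: "from_nat_into S i \<in> S" for i using assms(1) by (intro from_nat_into) auto
  note alph = alphabet_simps[unfolded insert_subset]
  consider (blank) "a = Blank" | (letter) s where "s \<in> S" "a = Input (Inl s)"
    | (cell) c where "c \<in> cell_alphabet S" "a = write_cell c"
    | (scratch) x where "x \<in> scratch_alphabet S" "a = write_scratch x"
    using assms(4) by (auto simp: interpreter_def row_alphabet_def)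
  then show ?thesis
  proof cases
    case blank
    then show ?thesis using assms(1-3) by (cases q) (simp_all add: alph)
  next
    case letter
    then show ?thesis using assms(1-3) by (cases q) (simp_all add: alph)
  next
    case cell
    then show ?thesis using assms(1-3) S by (cases q; cases c) (simp_all add: alph)
  next
    case scratch
    then show ?thesis using assms(1-3) by (cases q; cases x) (simp_all add: alph)
  qed
qed

lemma oracle_machine_over_interpreter:
  assumes "finite S" "t \<in> S" "t' \<in> S"
  shows "oracle_machine_over (S <+> row_alphabet S) S (interpreter S t t')"
proof -
  have "transition (interpreter S t t') q a \<in> states (interpreter S t t') \<times>
      tape_alphabet (interpreter S t t') \<times> UNIV \<times> insert None (Some ` S)"
    if q: "q \<in> states (interpreter S t t')" and a: "a \<in> tape_alphabet (interpreter S t t')" for q a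
  proof -
    from q obtain c where "q = to_nat c" "c \<in> control_set S" by (auto simp: interpreter_def)
    then show ?thesis using action_closed[OF assms(2,3) _ a, of c]
      by (auto simp: interpreter_def split: prod.splits)
  qed
  then show ?thesis unfolding oracle_machine_over_def
    using finite_alphabets[OF assms(1)] assms(1)
    by (auto simp: interpreter_def control_set_def)
qed

section \<open>Correctness of the interpreter\<close>

text \<open>
The listing of a stream, written in the format of \<^const>\<open>encode_listing\<close>.
\<close>

fun block_word :: "'k \<Rightarrow> (nat \<times> cell) list \<Rightarrow> ('k + nat) list" where
  "block_word t [] = []"
| "block_word t ((n, c) # bs) = replicate n (Inl t) @ Inr (to_nat c) # block_word t bs"

text \<open>
Texts are the words in generators and flags that end with a flag, that is, with a complete pair;
the Boolean argument tells whether the preceding symbol ended a pair.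
\<close>

fun text_ends :: "bool \<Rightarrow> ('k + nat) list \<Rightarrow> bool" where
  "text_ends e [] \<longleftrightarrow> e"
| "text_ends e (Inl s # w) \<longleftrightarrow> text_ends False w"
| "text_ends e (Inr b # w) \<longleftrightarrow> from_nat b = Flag \<and> text_ends True w"

fun text_queue :: "'k set \<Rightarrow> ('k + nat) list \<Rightarrow> queue_letter list" where
  "text_queue S [] = []"
| "text_queue S (Inl s # w) = Gen (to_nat_on S s) # text_queue S w"
| "text_queue S (Inr b # w) = Star # text_queue S w"

fun cells_of :: "('k + nat) list \<Rightarrow> cell list" where
  "cells_of [] = []"
| "cells_of (Inl s # w) = cells_of w"
| "cells_of (Inr b # w) = from_nat b # cells_of w"

lemma cells_of_append: "cells_of (v @ w) = cells_of v @ cells_of w"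
  by (induction v rule: cells_of.induct) auto

lemma cells_of_block_word:
  fixes t :: 'k
  shows "cells_of (block_word t bs) = map snd bs"
proof -
  have "cells_of (replicate n (Inl t)) = []" for n and t :: 'k by (induction n) auto
  then show ?thesis by (induction t bs rule: block_word.induct) (auto simp: cells_of_append)
qed

text \<open>
All that is required of the oracle is that it can compare unary heights.
\<close>

locale interpreter_oracle =
  fixes S :: "'k set" and t t' :: 'k and L :: "'k list set"
  assumes consecutive_iff: "replicate n t @ t # replicate m t' \<in> L \<longleftrightarrow> m = Suc n"
begin

abbreviation accepting :: "control \<Rightarrow> ('k + nat) tape_symbol list \<Rightarrow>
    ('k + nat) tape_symbol list \<Rightarrow> 'k list \<Rightarrow> bool" where
  "accepting q ls rs u \<equiv> accepts_from (interpreter S t t') L (to_nat q, ls, rs, u)"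

abbreviation accepting_left where
  "accepting_left q a ls rs u \<equiv>
     accepting q (fst (write_move Move_Left a ls rs)) (snd (write_move Move_Left a ls rs)) u"

abbreviation tick :: "('k + nat) tape_symbol" where "tick \<equiv> Input (Inl t)"
abbreviation mark :: "('k + nat) tape_symbol" where "mark \<equiv> write_cell Mark"
abbreviation used :: "('k + nat) tape_symbol" where "used \<equiv> write_scratch Used"
abbreviation here :: "('k + nat) tape_symbol" where "here \<equiv> write_scratch Here"

text \<open>
The format of a word that passes the first phase; \<open>P\<close> is the condition for the rest of the run.
\<close>

abbreviation stream_and_text where
  "stream_and_text admissible w \<equiv> \<lambda>P. \<exists>bs v. w = block_word t bs @ Inr (to_nat Mark) # v \<and>
     admissible bs \<and> text_ends True v \<and> P"

lemma accepting_step: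
  assumes "q \<noteq> Halt" "q \<noteq> Query" "action S t t' q (scanned rs) = (q', a, d, b)"
  shows "accepting q ls rs u =
    accepting q' (fst (write_move d a ls (tl rs))) (snd (write_move d a ls (tl rs)))
      (u @ (case b of None \<Rightarrow> [] | Some b \<Rightarrow> [b]))"
  by (rule accepts_from_transition) (use assms in \<open>simp_all add: interpreter_def\<close>)

lemma
  assumes "q \<noteq> Halt" "q \<noteq> Query"
  shows step_right: "action S t t' q (scanned rs) = go_right q' a \<Longrightarrow>
      accepting q ls rs u \<longleftrightarrow> accepting q' (a # ls) (tl rs) u"
    and step_left: "action S t t' q (scanned rs) = go_left q' a \<Longrightarrow>
      accepting q ls rs u \<longleftrightarrow> accepting_left q' a ls (tl rs) u"
    and step_stay: "action S t t' q (scanned rs) = stay q' a \<Longrightarrow>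
      accepting q ls rs u \<longleftrightarrow> accepting q' ls (a # tl rs) u"
  by - (subst accepting_step[OF assms], assumption, simp)+

lemma accepting_Halt: "accepting Halt ls rs u"
  using accepts_from_accept[of "interpreter S t t'" L] by (simp add: interpreter_def)

lemma accepting_Query:
  "accepting Query ls rs u = accepting (if u \<in> L then Yes else No) ls rs []"
  using accepts_from_query[of "interpreter S t t'" L ls rs u] by (simp add: interpreter_def)

lemma not_accepting_Stuck [simp]: "\<not> accepting Stuck ls rs u"
proof (rule accepts_from_trapped[where q = "to_nat Stuck"])
  fix s :: "('k + nat, 'k) segment"
  assume "fst s = to_nat Stuck"
  then show "fst (segment_step (interpreter S t t') L s) = to_nat Stuck"
    by (cases s) (simp add: interpreter_def)
qed (simp_all add: interpreter_def)

lemma accepting_stuck: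
  assumes "q \<noteq> Halt" "q \<noteq> Query" "action S t t' q (scanned rs) = stay Stuck a"
  shows "\<not> accepting q ls rs u" by (subst accepting_step[OF assms]) simp

lemma sweep_right:
  assumes "q \<noteq> Halt" "q \<noteq> Query" "\<And>a. a \<in> set as \<Longrightarrow> action S t t' q a = go_right q a"
  shows "accepting q ls (as @ rs) u = accepting q (rev as @ ls) rs u"
  by (rule accepts_from_sweep_right) (use assms in \<open>simp_all add: interpreter_def\<close>)

lemma sweep_left:
  assumes "q \<noteq> Halt" "q \<noteq> Query" "\<And>a. a \<in> set as \<Longrightarrow> action S t t' q a = go_left q a"
  shows "accepting_left q a (as @ b # ls) rs u = accepting q ls (b # rev as @ a # rs) u"
  by (rule accepts_from_sweep_left) (use assms in \<open>simp_all add: interpreter_def\<close>)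

lemma return_over_ticks:
  assumes "\<forall>s. view y \<noteq> Letter s"
  shows "accepting_left Back a (replicate m tick @ y # ls) rs u =
    accepting Measure (y # ls) (replicate m tick @ a # rs) u"
proof -
  have "accepting_left Back a (replicate m tick @ y # ls) rs u =
    accepting Back ls (y # rev (replicate m tick) @ a # rs) u" by (rule sweep_left) auto
  also have "\<dots> = accepting Measure (y # ls) (replicate m tick @ a # rs) u"
    by (subst step_right[where q' = Measure and a = y])
      (use assms in \<open>auto split: content.split\<close>)
  finally show ?thesis .
qed

lemma measure_ticks:
  "accepting Measure ls (replicate n tick @ rs) u =
    accepting Measure (replicate n tick @ ls) rs (u @ replicate n t)"
proof (induction n arbitrary: ls u)
  case (Suc n)
  have "accepting Measure ls (replicate (Suc n) tick @ rs) u =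
    accepting Measure (tick # ls) (replicate n tick @ rs) (u @ [t])"
    by (subst accepting_step[where q' = Measure and a = tick and d = Move_Right and b = "Some t"])
      auto
  then show ?case using Suc by (simp add: replicate_app_Cons_same)
qed simp

lemma compare_ticks:
  "accepting Compare ls (replicate n tick @ rs) u =
    accepting Compare (replicate n tick @ ls) rs (u @ replicate n t')"
proof (induction n arbitrary: ls u)
  case (Suc n)
  have "accepting Compare ls (replicate (Suc n) tick @ rs) u =
    accepting Compare (tick # ls) (replicate n tick @ rs) (u @ [t'])"
    by (subst accepting_step[where q' = Compare and a = tick and d = Move_Right and b = "Some t'"])
      auto
  then show ?case using Suc by (simp add: replicate_app_Cons_same)
qed simp

lemma strip_ticks:
  obtains n v where "w = replicate n (Inl t) @ v" "v = [] \<or> (\<exists>x v'. v = x # v' \<and> x \<noteq> Inl t)"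
proof -
  have "w = takeWhile ((=) (Inl t)) w @ dropWhile ((=) (Inl t)) w" by simp
  moreover have "takeWhile ((=) (Inl t)) w = replicate (length (takeWhile ((=) (Inl t)) w)) (Inl t)"
    by (induction w) auto
  moreover have "dropWhile ((=) (Inl t)) w = [] \<or>
      (\<exists>x v'. dropWhile ((=) (Inl t)) w = x # v' \<and> x \<noteq> Inl t)"
    by (cases "dropWhile ((=) (Inl t)) w") (auto dest: hd_dropWhile[rotated] simp: dropWhile_eq_Cons_conv)
  ultimately show thesis using that by metis
qed

lemma ticks_eq_iff:
  assumes "v = [] \<or> (\<exists>x v'. v = x # v' \<and> x \<noteq> Inl t)" "x \<noteq> Inl t"
  shows "replicate n (Inl t) @ v = replicate m (Inl t) @ x # v' \<longleftrightarrow> n = m \<and> v = x # v'"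
proof (induction n arbitrary: m)
  case 0 show ?case using assms by (cases m) auto
next
  case (Suc n)
  then show ?case using assms(2) by (cases m) auto
qed

lemma scan_text:
  "accepting (if e then TextEnd else Text) ls (map Input w) u \<longleftrightarrow>
    text_ends e w \<and> accepting TextEnd (rev (map Input w) @ ls) [] u"
proof (induction w arbitrary: e ls)
  case Nil
  show ?case by (cases e) (auto simp: accepting_stuck[of Text "[]" Blank])
next
  case (Cons x w)
  show ?case
  proof (cases x)
    case (Inl s)
    have "accepting (if e then TextEnd else Text) ls (map Input (x # w)) u =
        accepting Text (Input x # ls) (map Input w) u"
      by (subst step_right[where q' = Text and a = "Input x"])
        (use Inl in auto)
    then show ?thesis using Cons[of False] Inl by simp
  next
    case (Inr b)
    show ?thesis
    proof (cases "from_nat b = Flag")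
      case True
      have "accepting (if e then TextEnd else Text) ls (map Input (x # w)) u =
          accepting TextEnd (Input x # ls) (map Input w) u"
        by (subst step_right[where q' = TextEnd and a = "Input x"])
          (use Inr True in auto)
      then show ?thesis using Cons[of True] Inr True by simp
    next
      case False
      then have "\<not> accepting (if e then TextEnd else Text) ls (map Input (x # w)) u"
        by (intro accepting_stuck[where a = "Input x"]) (use Inr in auto)
      then show ?thesis using Inr False by simp
    qed
  qed
qed

text \<open>
The first phase, by induction on the unread part of the word. The two statements describe the two
situations of the head: outside of a block, and in front of a cell within a
block whose height has still to be compared with the next one. The tape is restored after each
query, so that the second phase starts from the complete word.
\<close>

lemma scan_stream:
  assumes "\<forall>x\<in>set w. \<forall>b. x = Inr b \<longrightarrow> b \<in> range (to_nat :: cell \<Rightarrow> nat)"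
    "\<forall>s. view y \<noteq> Letter s"
  shows "accepting Ready (y # ls) (map Input w) [] = stream_and_text opens w
    (accepting TextEnd (rev (map Input w) @ y # ls) [] [])" (is ?thesis1)
    and "accepting Measure (y # ls) (replicate n tick @ write_cell c # map Input w) [] =
      stream_and_text (continues n) w
        (accepting TextEnd (rev (map Input w) @ write_cell c # replicate n tick @ y # ls) [] [])"
      (is ?thesis2)
proof -
  have "?thesis1 \<and> ?thesis2" using assms
  proof (induction "length w" arbitrary: w y ls n c rule: less_induct)
    case less
    \<comment> \<open>Split off the unary height in front of the next cell.\<close>
    obtain m v where w: "w = replicate m (Inl t) @ v"
      and v: "v = [] \<or> (\<exists>x v'. v = x # v' \<and> x \<noteq> Inl t)" by (rule strip_ticks)
    let ?ready = "accepting Ready (y # ls) (map Input w) []"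
    let ?measure = "accepting Measure (y # ls) (replicate n tick @ write_cell c # map Input w) []"
    let ?end1 = "accepting TextEnd (rev (map Input w) @ y # ls) [] []"
    let ?end2 = "accepting TextEnd (rev (map Input w) @ write_cell c # replicate n tick @ y # ls) [] []"
    have split: "w = block_word t bs @ Inr (to_nat Mark) # r \<longleftrightarrow>
        (bs = [] \<and> m = 0 \<and> v = Inr (to_nat Mark) # r) \<or>
        (\<exists>c' bs'. bs = (m, c') # bs' \<and>
           v = Inr (to_nat c') # block_word t bs' @ Inr (to_nat Mark) # r)" for bs r
    proof (cases bs)
      case Nil
      have "replicate m (Inl t) @ v = replicate 0 (Inl t) @ Inr (to_nat Mark) # r \<longleftrightarrow>
          m = 0 \<and> v = Inr (to_nat Mark) # r" by (rule ticks_eq_iff[OF v]) simp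
      then show ?thesis by (simp add: w Nil)
    next
      case (Cons b bs')
      obtain k c' where b: "b = (k, c')" by (cases b)
      have "replicate m (Inl t) @ v =
          replicate k (Inl t) @ Inr (to_nat c') # block_word t bs' @ Inr (to_nat Mark) # r \<longleftrightarrow>
          m = k \<and> v = Inr (to_nat c') # block_word t bs' @ Inr (to_nat Mark) # r"
        by (rule ticks_eq_iff[OF v]) simp
      then show ?thesis by (auto simp: w Cons b)
    qed
    have sweep: "?ready =
        accepting (if m = 0 then Ready else Between) (replicate m tick @ y # ls) (map Input v) []"
    proof (cases m)
      case (Suc m')
      have "?ready = accepting Between (tick # y # ls) (replicate m' tick @ map Input v) []"
        by (subst step_right[where q' = Between and a = tick]) (auto simp: w Suc)
      also have "\<dots> = accepting Between (rev (replicate m' tick) @ tick # y # ls) (map Input v) []"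
        by (rule sweep_right) auto
      finally show ?thesis by (simp add: Suc replicate_app_Cons_same)
    qed (simp add: w)
    have compare: "?measure =
        accepting Compare (replicate m tick @ write_cell c # replicate n tick @ y # ls) (map Input v)
          (replicate n t @ t # replicate m t')"
    proof -
      have "?measure = accepting Compare (write_cell c # replicate n tick @ y # ls) (map Input w)
          (replicate n t @ [t])"
        by (subst measure_ticks, subst accepting_step[where q' = Compare and a = "write_cell c"
              and d = Move_Right and b = "Some t"]) auto
      then show ?thesis using compare_ticks[of _ m "map Input v"] by (simp add: w)
    qed
    consider (empty) "v = []" | (letter) s v' where "v = Inl s # v'" "s \<noteq> t"
      | (cell) c' v' where "v = Inr (to_nat (c' :: cell)) # v'"
    proof (cases v)
      case (Cons x v')
      show thesis
      proof (cases x)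
        case (Inl s)
        then show thesis using v Cons letter by auto
      next
        case (Inr b)
        then have "b \<in> range (to_nat :: cell \<Rightarrow> nat)" using less.prems(1) w Cons by auto
        then obtain c' :: cell where "b = to_nat c'" by blast
        then show thesis using cell[of c' v'] Cons Inr by simp
      qed
    qed
    then show ?case
    proof cases
      case empty
      have "\<not> accepting q (replicate m tick @ ls') (map Input v) u"
        if "q \<in> {Ready, Between, Compare}" for q ls' u
        using that empty by (intro accepting_stuck[where a = Blank]) auto
      then show ?thesis unfolding sweep compare using split empty by auto
    next
      case letter
      have "\<not> accepting q (replicate m tick @ ls') (map Input v) u"
        if "q \<in> {Ready, Between, Compare}" for q ls' u
        using that letter by (intro accepting_stuck[where a = "Input (Inl s)"]) auto
      then show ?thesis unfolding sweep compare using split letter by auto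
    next
      case cell
      have len: "length v' < length w" and pre: "\<forall>x\<in>set v'. \<forall>b. x = Inr b \<longrightarrow> b \<in> range (to_nat :: cell \<Rightarrow> nat)"
        using w cell less.prems(1) by auto
      note IH = less.hyps[OF len pre]
      have ex_cell: "stream_and_text opn w Z \<longleftrightarrow> m = 0 \<and> c' = Mark \<and> opn [] \<and> text_ends True v' \<and> Z \<or>
          stream_and_text (\<lambda>bs. opn ((m, c') # bs)) v' Z" (is "?l = ?r") for opn Z
      proof
        assume ?l
        then obtain bs r where "w = block_word t bs @ Inr (to_nat Mark) # r" "opn bs"
          "text_ends True r" Z by blast
        then show ?r unfolding split cell by auto
      next
        assume ?r
        then consider "m = 0" "c' = Mark" "opn []" "text_ends True v'" Z
          | bs r where "v' = block_word t bs @ Inr (to_nat Mark) # r" "opn ((m, c') # bs)"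
            "text_ends True r" Z by blast
        then show ?l
        proof cases
          case 1
          then show ?thesis by - (rule exI[where x = "[]"], rule exI[where x = v'], simp add: w cell)
        next
          case 2
          then show ?thesis
            by - (rule exI[where x = "(m, c') # bs"], rule exI[where x = r], simp add: w cell)
        qed
      qed
      have 1: "?ready = stream_and_text opens w ?end1"
      proof -
        consider "c' = Open" | "c' = Mark" "m = 0" | "c' = Mark" "m \<noteq> 0" | "c' \<noteq> Open" "c' \<noteq> Mark"
          by blast
        then show ?thesis
        proof cases
          case 1
          have "?ready =
            accepting_left Back (write_cell Open) (replicate m tick @ y # ls) (map Input v') []"
            unfolding sweep by (subst step_left[where q' = Back and a = "write_cell Open"]) (auto simp: cell 1)
          also have "\<dots> =
              accepting Measure (y # ls) (replicate m tick @ write_cell Open # map Input v') []"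
            by (rule return_over_ticks) (use less.prems in auto)
          also have "\<dots> = stream_and_text (continues m) v'
            (accepting TextEnd (rev (map Input v') @ write_cell Open # replicate m tick @ y # ls) [] [])"
            using IH[OF less.prems(2), where c = Open and n = m] by blast
          also have "\<dots> = stream_and_text opens w ?end1"
            unfolding ex_cell by (simp add: cell 1 w)
          finally show ?thesis .
        next
          case 2
          have "?ready =
              accepting (if True then TextEnd else Text) (mark # y # ls) (map Input v') []"
            unfolding sweep by (subst step_right[where q' = TextEnd and a = mark]) (auto simp: cell 2)
          also have "\<dots> \<longleftrightarrow> text_ends True v' \<and>
              accepting TextEnd (rev (map Input v') @ mark # y # ls) [] []" by (rule scan_text)
          also have "\<dots> = stream_and_text opens w ?end1"
            unfolding ex_cell by (simp add: cell 2 w)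
          finally show ?thesis .
        next
          case 3
          have "\<not> ?ready"
            unfolding sweep by (intro accepting_stuck[where a = mark]) (auto simp: cell 3)
          then show ?thesis unfolding ex_cell by (simp add: 3)
        next
          case 4
          have "\<not> ?ready"
            unfolding sweep by (intro accepting_stuck[where a = "write_cell c'"]) (auto simp: cell 4)
          then show ?thesis unfolding ex_cell by (simp add: 4)
        qed
      qed
      have 2: "?measure = stream_and_text (continues n) w ?end2"
      proof (cases "c' = Open \<or> c' = Mark")
        case True
        have "\<not> ?measure"
          unfolding compare
          by (intro accepting_stuck[where a = "write_cell c'"]) (use True in \<open>auto simp: cell\<close>)
        then show ?thesis unfolding ex_cell using True by auto
      next
        case False
        let ?ls = "replicate m tick @ write_cell c # replicate n tick @ y # ls"
        have "?measure = accepting Query ?ls (write_scratch (Check c') # map Input v')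
            (replicate n t @ t # replicate m t')"
          unfolding compare by (subst step_stay[where q' = Query and a = "write_scratch (Check c')"])
            (use False in \<open>auto simp: cell\<close>)
        also have "\<dots> = accepting (if m = Suc n then Yes else No) ?ls
            (write_scratch (Check c') # map Input v') []"
          by (simp only: accepting_Query consecutive_iff)
        finally have query: "?measure
          = accepting (if m = Suc n then Yes else No) ?ls (write_scratch (Check c') # map Input v') []" .
        show ?thesis
        proof (cases "m = Suc n")
          case m: True
          show ?thesis
          proof (cases "c' = Close")
            case True
            have "?measure = accepting Ready (write_cell Close # ?ls) (map Input v') []"
              unfolding query by (subst step_right[where q' = Ready and a = "write_cell Close"]) (auto simp: m True)
            also have "\<dots> = stream_and_text opens v'
              (accepting TextEnd (rev (map Input v') @ write_cell Close # ?ls) [] [])"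
              by (rule conjunct1[OF IH]) auto
            also have "\<dots> = stream_and_text (continues n) w ?end2"
              unfolding ex_cell by (simp add: cell True w m replicate_app_Cons_same)
            finally show ?thesis .
          next
            case c': False
            have "?measure = accepting_left Back (write_cell c') ?ls (map Input v') []"
              unfolding query by (subst step_left[where q' = Back and a = "write_cell c'"]) (auto simp: m c')
            also have "\<dots> = accepting Measure (write_cell c # replicate n tick @ y # ls)
                (replicate m tick @ write_cell c' # map Input v') []"
              by (rule return_over_ticks) auto
            also have "\<dots> = stream_and_text (continues m) v'
              (accepting TextEnd (rev (map Input v') @ write_cell c' # ?ls) [] [])"
              by (rule conjunct2[OF IH]) auto
            also have "\<dots> = stream_and_text (continues n) w ?end2"
              unfolding ex_cell using False by (simp add: cell w m c' replicate_app_Cons_same)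
            finally show ?thesis .
          qed
        next
          case m: False
          have "\<not> accepting No ?ls (write_scratch (Check c') # map Input v') []"
            by (intro accepting_stuck[where a = "write_scratch (Check c')"]) auto
          then show ?thesis unfolding query ex_cell using m False by simp
        qed
      qed
      show ?thesis using 1 2 by blast
    qed
  qed
  then show ?thesis1 ?thesis2 by blast+
qed

lemma rewind:
  assumes "\<forall>a\<in>set as. a \<noteq> Blank"
  shows "accepting TextEnd (rev as @ [Blank]) [] [] =
    accepting Fetch [Blank] (as @ [write_scratch (Item End)]) []"
proof -
  have "accepting TextEnd (rev as @ [Blank]) [] [] =
    accepting_left Rewind (write_scratch (Item End)) (rev as @ [Blank]) [] []"
    by (subst step_left[where q' = Rewind and a = "write_scratch (Item End)"]) auto
  also have "\<dots> = accepting Rewind [] (Blank # rev (rev as) @ [write_scratch (Item End)]) []"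
    by (rule sweep_left) (use assms in auto)
  also have "\<dots> = accepting Fetch [Blank] (as @ [write_scratch (Item End)]) []"
    by (subst step_right[where q' = Fetch and a = Blank]) auto
  finally show ?thesis .
qed

text \<open>
The second phase. Behind the marker the tape consists of the consumed letters, all overwritten by
\<open>Used\<close>, and the current content of the queue.
\<close>

lemma execute:
  assumes "\<forall>b. Inr b \<in> set s \<longrightarrow> from_nat b \<noteq> Mark"
    "map (\<lambda>a. queue_value S (view a)) Q = map Some q"
  shows "accepting Fetch ls
      (map Input s @ mark # replicate k used @ Q) u = runs S L (cells_of s) q u"
  using assms
proof (induction s arbitrary: ls k Q q u)
  case Nil
  have "\<not> accepting Fetch ls (mark # replicate k used @ Q) u"
    by (intro accepting_stuck[where a = mark]) auto
  then show ?case by simp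
next
  case (Cons x s)
  have Mark: "Input y \<noteq> mark" if "y \<in> set s" for y
    using Cons.prems(1) that by auto
  have Q: "a \<noteq> Blank \<and> a \<noteq> here" if "a \<in> set Q" for a
  proof -
    from that obtain i where "i < length Q" "a = Q ! i" by (auto simp: in_set_conv_nth)
    then have "queue_value S (view a) \<noteq> None"
      using arg_cong[OF Cons.prems(2), of "\<lambda>xs. xs ! i"] arg_cong[OF Cons.prems(2), of length]
      by auto
    then show ?thesis by auto
  qed
  let ?U = "replicate k used"
  let ?R = "map Input s @ mark # ?U @ Q"
  let ?fetch = "accepting Fetch ls (Input x # ?R) u"
  have IH: "accepting Fetch ls' (map Input s @ mark # replicate k' used @ Q') u'
     = runs S L (cells_of s) q' u'"
    if "map (\<lambda>a. queue_value S (view a)) Q' = map Some q'" for ls' k' Q' q' u'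
    by (rule Cons.IH) (use Cons.prems that in auto)
  show ?case
  proof (cases x)
    case (Inl a)
    have "?fetch = accepting Fetch (Input x # ls) ?R u"
      by (subst step_right[where q' = Fetch and a = "Input x"]) (auto simp: Inl)
    then show ?thesis using IH[OF Cons.prems(2)] Inl by simp
  next
    case (Inr b)
    define c where "c = (from_nat b :: cell)"
    have c: "c \<noteq> Mark" using Cons.prems(1) Inr by (auto simp: c_def)
    note x = Inr c_def[symmetric]
    consider (skip) "c = Open \<or> c = Close" | (pop) y where "c = Pop y" | (push) y where "c = Push y"
      | (emit) i where "c = Emit i" | (ask) e where "c = Ask e" | (accept) "c = Accept"
      | (stuck) "c = Void \<or> c = Flag"
      using c by (cases c) auto
    then show ?thesis
    proof cases
      case skip
      have "?fetch = accepting Fetch (Input x # ls) ?R u"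
        by (subst step_right[where q' = Fetch and a = "Input x"])
          (use skip in \<open>auto simp: x\<close>)
      then show ?thesis using IH[OF Cons.prems(2)] skip by (auto simp: x)
    next
      case pop
      let ?ls = "?U @ mark # rev (map Input s) @ here # ls"
      have "?fetch = accepting (Find y) (here # ls) ?R u"
        by (subst step_right[where q' = "Find y" and a = here]) (use pop in \<open>auto simp: x\<close>)
      also have "\<dots> = accepting (Find y) (rev (map Input s) @ here # ls)
          (mark # ?U @ Q) u" by (rule sweep_right) (use Mark in auto)
      also have "\<dots> = accepting (Take y)
          (mark # rev (map Input s) @ here # ls) (?U @ Q) u"
        by (subst step_right[where q' = "Take y" and a = mark]) auto
      also have "\<dots> = accepting (Take y)
          (rev ?U @ mark # rev (map Input s) @ here # ls) Q u" by (rule sweep_right) auto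
      finally have 1: "?fetch = accepting (Take y) ?ls Q u" by simp
      show ?thesis
      proof (cases Q)
        case Nil
        have "\<not> accepting (Take y) ?ls Q u"
          by (intro accepting_stuck[where a = Blank]) (auto simp: Nil)
        then show ?thesis using 1 Nil Cons.prems(2) pop by (simp add: x)
      next
        case (Cons a Q')
        then obtain z q' where q: "q = z # q'" "queue_value S (view a) = Some z"
            "map (\<lambda>a. queue_value S (view a)) Q' = map Some q'"
          using Cons.prems(2) by (cases q) auto
        have a: "a \<noteq> used" using q(2) by auto
        show ?thesis
        proof (cases "y = z")
          case True
          have "accepting (Take y) ?ls Q u = accepting_left Return used ?ls Q' u"
            by (subst step_left[where q' = Return and a = used]) (use True q a in \<open>auto simp: Cons\<close>)
          also have "\<dots> = accepting Return ls (here # rev (?U @ mark # rev (map Input s))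
              @ used # Q') u"
          proof -
            have "?ls = (?U @ mark # rev (map Input s)) @ here # ls" by simp
            then show ?thesis by (simp only:) (rule sweep_left, auto)
          qed
          also have "\<dots> = accepting Fetch (used # ls)
              (map Input s @ mark # replicate (Suc k) used @ Q') u"
            by (subst step_right[where q' = Fetch and a = used]) (auto simp: rev_map replicate_app_Cons_same)
          finally show ?thesis using 1 IH[OF q(3), of _ "Suc k"] pop True q(1) by (simp add: x)
        next
          case False
          have "\<not> accepting (Take y) ?ls Q u"
            by (intro accepting_stuck[where a = a]) (use q a False in \<open>auto simp: Cons\<close>)
          then show ?thesis using 1 False pop q(1) by (simp add: x)
        qed
      qed
    next
      case push
      have "?fetch = accepting (Append y) (here # ls) ?R u"
        by (subst step_right[where q' = "Append y" and a = here]) (use push in \<open>auto simp: x\<close>)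
      also have "\<dots> = accepting (Append y) (rev ?R @ here # ls) [] u"
      proof -
        have "accepting (Append y) (here # ls) (?R @ []) u =
            accepting (Append y) (rev ?R @ here # ls) [] u" by (rule sweep_right) (use Q in auto)
        then show ?thesis by simp
      qed
      also have "\<dots> = accepting_left Return (write_scratch (Item y)) (rev ?R @ here # ls) [] u"
        by (subst step_left[where q' = Return and a = "write_scratch (Item y)"]) auto
      also have "\<dots> = accepting Return ls (here # rev (rev ?R) @ [write_scratch (Item y)]) u"
        by (rule sweep_left) (use Q in auto)
      also have "\<dots> = accepting Fetch (used # ls)
         (map Input s @ mark # ?U @ (Q @ [write_scratch (Item y)])) u"
        by (subst step_right[where q' = Fetch and a = used]) auto
      also have "\<dots> = runs S L (cells_of s) (q @ [y]) u" by (rule IH) (use Cons.prems(2) in simp)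
      finally show ?thesis using push by (simp add: x)
    next
      case emit
      have "?fetch =
          accepting Fetch (Input x # ls) ?R (u @ [from_nat_into S i])"
        by (subst accepting_step[where q' = Fetch and a = "Input x" and d = Move_Right
              and b = "Some (from_nat_into S i)"]) (use emit in \<open>auto simp: x\<close>)
      then show ?thesis using IH[OF Cons.prems(2)] emit by (simp add: x)
    next
      case ask
      have "?fetch =
          accepting Query ls (write_scratch (Asked e) # ?R) u"
        by (subst step_stay[where q' = Query and a = "write_scratch (Asked e)"]) (use ask in \<open>auto simp: x\<close>)
      also have "\<dots> = accepting (if u \<in> L then Yes else No) ls (write_scratch (Asked e) # ?R) []"
        by (rule accepting_Query)
      finally have 1: "?fetch = \<dots>" .
      show ?thesis
      proof (cases "u \<in> L \<longleftrightarrow> e")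
        case True
        have "accepting (if u \<in> L then Yes else No) ls (write_scratch (Asked e) # ?R) [] =
            accepting Fetch (used # ls) ?R []"
          by (subst step_right[where q' = Fetch and a = used]) (use True in auto)
        then show ?thesis using 1 IH[OF Cons.prems(2)] ask True by (simp add: x)
      next
        case False
        have "\<not> accepting (if u \<in> L then Yes else No) ls (write_scratch (Asked e) # ?R) []"
          by (intro accepting_stuck[where a = "write_scratch (Asked e)"]) (use False in auto)
        then show ?thesis using 1 ask False by (simp add: x)
      qed
    next
      case accept
      have "?fetch = accepting Halt ls (Input x # ?R) u"
        by (subst step_stay[where q' = Halt and a = "Input x"])
          (use accept in \<open>auto simp: x\<close>)
      then show ?thesis using accept accepting_Halt by (simp add: x)
    next
      case stuck
      have "\<not> ?fetch"
        by (intro accepting_stuck[where a = "Input x"]) (use stuck in \<open>auto simp: x\<close>)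
      then show ?thesis using stuck by (auto simp: x)
    qed
  qed
qed

lemma opens_continues_no_Mark:
  "opens bs \<Longrightarrow> \<forall>(n, c)\<in>set bs. c \<noteq> Mark"
  "continues n bs \<Longrightarrow> \<forall>(n, c)\<in>set bs. c \<noteq> Mark"
  by (induction bs and n bs rule: opens_continues.induct) (auto split: if_splits)

lemma Inr_in_block_word: "Inr b \<in> set (block_word t bs) \<longleftrightarrow> (\<exists>c\<in>snd ` set bs. b = to_nat c)"
proof (induction bs)
  case (Cons p bs)
  then show ?case by (cases p) auto
qed simp

lemma text_queue_values:
  assumes "text_ends e v"
  shows "map (\<lambda>a. queue_value S (view a)) (map Input v) = map Some (text_queue S v)"
  using assms by (induction e v rule: text_ends.induct) auto

lemma interpreter_accepts_iff:
  assumes "w \<in> lists (S <+> row_alphabet S)"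
  shows "machine_accepts (interpreter S t t') L w \<longleftrightarrow>
    (\<exists>bs v. w = block_word t bs @ Inr (to_nat Mark) # v \<and> opens bs \<and> text_ends True v \<and>
       runs S L (map snd bs) (text_queue S v @ [End]) [])"
proof (cases w)
  case Nil
  have "accepting Start [] [] [] \<longleftrightarrow> accepting Enter [] [Blank, Blank] []"
    by (subst step_left[where q' = Enter and a = Blank]) auto
  also have "\<dots> \<longleftrightarrow> accepting Ready [Blank] [Blank] []"
    by (subst step_right[where q' = Ready and a = Blank]) auto
  also have "\<dots> \<longleftrightarrow> False"
    using accepting_stuck[of Ready "[Blank]" Blank] by simp
  finally show ?thesis using Nil by (simp add: machine_accepts_iff_accepts_from interpreter_def)
next
  case (Cons x w')
  \<comment> \<open>One step to the left and back adds the blank in front of the word to the segment, so that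
    every block is preceded by some symbol at which the head turns round.\<close>
  have "machine_accepts (interpreter S t t') L w \<longleftrightarrow> accepting Start [] (map Input w) []"
    by (simp add: machine_accepts_iff_accepts_from interpreter_def)
  also have "\<dots> \<longleftrightarrow> accepting Enter [] (Blank # map Input w) []"
    by (subst step_left[where q' = Enter and a = "Input x"]) (auto simp: Cons)
  also have "\<dots> \<longleftrightarrow> accepting Ready [Blank] (map Input w) []"
    by (subst step_right[where q' = Ready and a = Blank]) auto
  also have "\<dots> \<longleftrightarrow> stream_and_text opens w (accepting TextEnd (rev (map Input w) @ [Blank]) [] [])"
    by (rule scan_stream(1)) (use assms in \<open>auto simp: row_alphabet_def\<close>)
  also have "accepting TextEnd (rev (map Input w) @ [Blank]) [] [] \<longleftrightarrow>
      accepting Fetch [Blank] (map Input w @ [write_scratch (Item End)]) []" by (rule rewind) auto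
  also have "(\<exists>bs v. w = block_word t bs @ Inr (to_nat Mark) # v \<and> opens bs \<and>
        text_ends True v \<and> accepting Fetch [Blank] (map Input w @ [write_scratch (Item End)]) []) \<longleftrightarrow>
      (\<exists>bs v. w = block_word t bs @ Inr (to_nat Mark) # v \<and> opens bs \<and> text_ends True v \<and>
       runs S L (map snd bs) (text_queue S v @ [End]) [])"
  proof (intro ex_cong1 conj_cong refl)
    fix bs v
    assume w: "w = block_word t bs @ Inr (to_nat Mark) # v" and bs: "opens bs"
      and v: "text_ends True v"
    have "accepting Fetch [Blank] (map Input (block_word t bs) @ write_cell Mark #
         replicate 0 (write_scratch Used) @ (map Input v @ [write_scratch (Item End)])) [] \<longleftrightarrow>
       runs S L (cells_of (block_word t bs)) (text_queue S v @ [End]) []"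
    proof (rule execute)
      show "\<forall>b. Inr b \<in> set (block_word t bs) \<longrightarrow> from_nat b \<noteq> Mark"
        using opens_continues_no_Mark(1)[OF bs] unfolding Inr_in_block_word by fastforce
      show "map (\<lambda>a. queue_value S (view a)) (map Input v @ [write_scratch (Item End)]) =
          map Some (text_queue S v @ [End])"
        using text_queue_values[OF v] by simp
    qed
    then show "accepting Fetch [Blank] (map Input w @ [write_scratch (Item End)]) [] \<longleftrightarrow>
       runs S L (map snd bs) (text_queue S v @ [End]) []" by (simp add: w cells_of_block_word)
  qed
  finally show ?thesis .
qed

end

section \<open>Oracle machines as queue programs\<close>

text \<open>
A configuration of a machine is written as a cyclic word: the state, the tape from the head on, a
border, the tape to the left of the head. Removing letters at the front of the queue and appending
their replacement at its end rewrites a factor of this cyclic word.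
\<close>

datatype 'i config_letter = Symbol "'i tape_symbol" | State nat | Border

text \<open>
The arguments are the letters removed, the generator emitted, the expected answer of the oracle, and
the letters appended. The rule \<open>extend\<close> makes room when the head reaches the border on the right,
\<open>left_end\<close> does so on the left, and \<open>rotate\<close> turns the cyclic word. As every other rule requires the
state at a fixed place near the front, needless rotations are harmless.
\<close>

inductive machine_rule :: "('i, 'o) oracle_machine \<Rightarrow> 'i config_letter list \<Rightarrow> 'o option \<Rightarrow>
    bool option \<Rightarrow> 'i config_letter list \<Rightarrow> bool" for M where
  extend: "q \<in> states M \<Longrightarrow> q \<noteq> accept_state M \<Longrightarrow> q \<noteq> query_state M \<Longrightarrow>
    machine_rule M [State q, Border] None None [State q, Symbol Blank, Border]"
| right: "q \<in> states M \<Longrightarrow> q \<noteq> accept_state M \<Longrightarrow> q \<noteq> query_state M \<Longrightarrow> a \<in> tape_alphabet M \<Longrightarrow>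
    transition M q a = (q', a', Move_Right, e) \<Longrightarrow>
    machine_rule M [State q, Symbol a] e None [Symbol a', State q']"
| stay: "q \<in> states M \<Longrightarrow> q \<noteq> accept_state M \<Longrightarrow> q \<noteq> query_state M \<Longrightarrow> a \<in> tape_alphabet M \<Longrightarrow>
    transition M q a = (q', a', Stay, e) \<Longrightarrow>
    machine_rule M [State q, Symbol a] e None [State q', Symbol a']"
| left: "q \<in> states M \<Longrightarrow> q \<noteq> accept_state M \<Longrightarrow> q \<noteq> query_state M \<Longrightarrow> a \<in> tape_alphabet M \<Longrightarrow>
    b \<in> tape_alphabet M \<Longrightarrow> transition M q a = (q', a', Move_Left, e) \<Longrightarrow>
    machine_rule M [Symbol b, State q, Symbol a] e None [State q', Symbol b, Symbol a']"
| left_end: "q \<in> states M \<Longrightarrow> q \<noteq> accept_state M \<Longrightarrow> q \<noteq> query_state M \<Longrightarrow> a \<in> tape_alphabet M \<Longrightarrow>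
    transition M q a = (q', a', Move_Left, e) \<Longrightarrow>
    machine_rule M [Border, State q, Symbol a] e None [Border, State q', Symbol Blank, Symbol a']"
| ask: "machine_rule M [State (query_state M)] None (Some b)
      [State (if b then yes_state M else no_state M)]"
| rotate: "x \<in> {Border} \<union> Symbol ` tape_alphabet M \<union> State ` states M \<Longrightarrow>
    machine_rule M [x] None None [x]"

definition bracket :: "cell list list \<Rightarrow> cell list" where
  "bracket rl = concat (map (\<lambda>r. Open # r @ [Close]) rl)"

lemma bracket_simps [simp]:
  "bracket [] = []" "bracket (r # rl) = Open # r @ Close # bracket rl"
  by (simp_all add: bracket_def)

lemma runs_Pop: "runs S L (map Pop x @ cs) q u \<longleftrightarrow> (\<exists>q'. q = x @ q' \<and> runs S L cs q' u)"
proof (induction x arbitrary: q)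
  case (Cons a x)
  then show ?case by (cases q) auto
qed simp

lemma runs_Push: "runs S L (map Push x @ cs) q u \<longleftrightarrow> runs S L cs (q @ x) u"
  by (induction x arbitrary: q) auto

lemma runs_Emit:
  "runs S L (map Emit x @ cs) q u \<longleftrightarrow> runs S L cs q (u @ map (from_nat_into S) x)"
  by (induction x arbitrary: u) auto

text \<open>
Used for the letter \<open>End\<close>: loading rules cannot reach beyond the text.
\<close>

lemma prefix_before_marker:
  assumes "x @ z # r = y @ r'" "z \<notin> set y"
  shows "\<exists>y'. x = y @ y' \<and> r' = y' @ z # r"
  using assms
proof (induction y arbitrary: x)
  case (Cons a y)
  then show ?case by (cases x) auto
qed simp

text \<open>
The machine \<open>M\<close> has its own alphabets and its own oracle; \<open>load c\<close> is the part of the text that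
spells the letter \<open>c\<close>, and \<open>emission b\<close> is the word over the generators of the interpreter which
replaces \<open>b\<close> in queries.
\<close>

locale queue_simulation =
  fixes M :: "('i, 'o) oracle_machine" and I :: "'i set" and Q :: "'o set" and LM :: "'o list set"
    and S :: "'k set" and L :: "'k list set"
    and load :: "'i \<Rightarrow> queue_letter list" and emission :: "'o \<Rightarrow> nat list"
  assumes over: "oracle_machine_over I Q M" and finite_Q: "finite Q"
    and load_nonempty: "c \<in> I \<Longrightarrow> load c \<noteq> []"
    and load_letters: "c \<in> I \<Longrightarrow> set (load c) \<subseteq> queue_alphabet S - {End, Zero, One}"
    and emission_codes: "b \<in> Q \<Longrightarrow> set (emission b) \<subseteq> generator_codes S"
    and oracle_iff: "u \<in> lists Q \<Longrightarrow>
      map (from_nat_into S) (concat (map emission u)) \<in> L \<longleftrightarrow> u \<in> LM"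
begin

abbreviation instructions :: "cell set" where
  "instructions \<equiv> cell_alphabet S - {Void, Mark, Flag, Open, Close}"

abbreviation accepts :: "('i, 'o) segment \<Rightarrow> bool" where
  "accepts \<equiv> accepts_from M LM"

definition config_alphabet :: "'i config_letter set" where
  "config_alphabet = {Border} \<union> Symbol ` tape_alphabet M \<union> State ` states M"

text \<open>
A prefix code, so that a queue that encodes a word determines at its front which letter comes next.
\<close>

definition code :: "'i config_letter \<Rightarrow> queue_letter list" where
  "code x = replicate (to_nat_on config_alphabet x) Zero @ [One]"

definition encode :: "'i config_letter list \<Rightarrow> queue_letter list" where
  "encode W = concat (map code W)"

definition emitted :: "'o list \<Rightarrow> 'k list" where
  "emitted u = map (from_nat_into S) (concat (map emission u))"

abbreviation emits :: "'o option \<Rightarrow> 'o list" where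
  "emits e \<equiv> (case e of None \<Rightarrow> [] | Some b \<Rightarrow> [b])"

definition rule_cells :: "'i config_letter list \<Rightarrow> 'o option \<Rightarrow> bool option \<Rightarrow>
    'i config_letter list \<Rightarrow> cell list" where
  "rule_cells x e a y = map Pop (encode x) @ map Emit (concat (map emission (emits e))) @
     (case a of None \<Rightarrow> [] | Some b \<Rightarrow> [Ask b]) @ map Push (encode y)"

definition load_cells :: "'i \<Rightarrow> cell list" where
  "load_cells c = map Pop (load c) @ map Push (code (Symbol (Input c)))"

definition start_cells :: "cell list" where
  "start_cells = Pop End # map Push (encode [Border, State (start_state M)])"

definition accept_cells :: "cell list" where
  "accept_cells = map Pop (code (State (accept_state M))) @ [Accept]"

text \<open>
Besides the rules of the machine, a program contains rules which read the text and rules to start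
and to accept. The text is spelled in letters other than \<open>Zero\<close> and \<open>One\<close>, hence no rule of the
machine applies before the text has been consumed; \<open>start_cells\<close> consumes \<open>End\<close> and can be used only
once, and none of the loading rules applies afterwards.
\<close>

definition program :: "cell list set" where
  "program = {rule_cells x e a y | x e a y. machine_rule M x e a y} \<union> load_cells ` I \<union>
     {start_cells, accept_cells}"

lemma finite_machine: "finite (states M)" "finite (tape_alphabet M)"
  and machine_members: "Blank \<in> tape_alphabet M" "Input ` I \<subseteq> tape_alphabet M"
    "start_state M \<in> states M" "accept_state M \<in> states M" "query_state M \<in> states M"
    "yes_state M \<in> states M" "no_state M \<in> states M"
  and accept_not_query: "accept_state M \<noteq> query_state M"
  and machine_transition: "q \<in> states M \<Longrightarrow> a \<in> tape_alphabet M \<Longrightarrow>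
    transition M q a \<in> states M \<times> tape_alphabet M \<times> UNIV \<times> insert None (Some ` Q)"
  using over by (auto simp: oracle_machine_over_def)

lemma transition_closed:
  assumes "q \<in> states M" "a \<in> tape_alphabet M" "transition M q a = (q', a', d, e)"
  shows "q' \<in> states M" "a' \<in> tape_alphabet M" "e = None \<or> e \<in> Some ` Q" "set (emits e) \<subseteq> Q"
  using machine_transition[OF assms(1,2)] assms(3) by auto

lemma finite_I: "finite I"
  using finite_subset[OF machine_members(2) finite_machine(2)] by (simp add: finite_image_iff inj_on_def)

lemma finite_config_alphabet: "finite config_alphabet"
  using finite_machine by (simp add: config_alphabet_def)

lemma config_alphabet_simps [simp]:
  "Border \<in> config_alphabet" "Symbol a \<in> config_alphabet \<longleftrightarrow> a \<in> tape_alphabet M"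
  "State q \<in> config_alphabet \<longleftrightarrow> q \<in> states M" by (auto simp: config_alphabet_def)

lemma encode_simps [simp]: "encode [] = []" "encode (x # W) = code x @ encode W"
    "encode (V @ W) = encode V @ encode W" by (simp_all add: encode_def)

lemma emitted_simps [simp]: "emitted [] = []" "emitted (u @ v) = emitted u @ emitted v"
  by (simp_all add: emitted_def)

lemma code_cancel:
  assumes "code x @ r = code y @ r'" "x \<in> config_alphabet" "y \<in> config_alphabet"
  shows "x = y \<and> r = r'"
proof -
  have "n = m \<and> r = r'" if "replicate n Zero @ One # r = replicate m Zero @ One # r'" for n m
    using that
  proof (induction n arbitrary: m)
    case 0 then show ?case by (cases m) auto
  next
    case (Suc n) then show ?case by (cases m) auto
  qed
  from this[of "to_nat_on config_alphabet x" "to_nat_on config_alphabet y"] show ?thesis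
    using assms finite_config_alphabet by (simp add: code_def countable_finite)
qed

lemma encode_prefix:
  assumes "encode W = encode x @ r" "set W \<subseteq> config_alphabet" "set x \<subseteq> config_alphabet"
  shows "\<exists>W'. W = x @ W' \<and> r = encode W'"
  using assms
proof (induction x arbitrary: W)
  case (Cons a x)
  show ?case
  proof (cases W)
    case Nil
    then show ?thesis using Cons.prems(1) by (simp add: code_def)
  next
    case (Cons b W')
    then have "b = a \<and> encode W' = encode x @ r"
      using Cons.prems \<open>W = b # W'\<close> by (intro code_cancel) auto
    then show ?thesis using Cons.IH[of W'] Cons.prems Cons by auto
  qed
qed simp

lemma code_hd: "hd (code x @ r) \<in> {Zero, One}"
  by (cases "to_nat_on config_alphabet x") (auto simp: code_def)

lemma code_nonempty [simp]: "code x \<noteq> []"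
  by (simp add: code_def)

lemma machine_rule_letters:
  assumes "machine_rule M x e a y"
  shows "x \<noteq> [] \<and> set x \<subseteq> config_alphabet \<and> set y \<subseteq> config_alphabet \<and>
    length x \<le> 4 \<and> length y \<le> 4 \<and> (e = None \<or> e \<in> Some ` Q)"
  using assms
proof (cases rule: machine_rule.cases)
  case (extend q)
  then show ?thesis using machine_members by simp
next
  case (right q b q' b')
  show ?thesis using transition_closed(1-3)[OF right(4,7,8)] right(1,3,4,7) by simp
next
  case (stay q b q' b')
  show ?thesis using transition_closed(1-3)[OF stay(4,7,8)] stay(1,3,4,7) by simp
next
  case (left q b c q' b')
  show ?thesis using transition_closed(1-3)[OF left(4,7,9)] left(1,3,4,7,8) by simp
next
  case (left_end q b q' b')
  show ?thesis using transition_closed(1-3)[OF left_end(4,7,8)] left_end(1,3,4,7) machine_members by simp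
next
  case (ask b)
  then show ?thesis using machine_members by simp
next
  case (rotate z)
  then show ?thesis by (auto simp: config_alphabet_def)
qed

lemma finite_program: "finite program"
proof -
  let ?A = "{x. set x \<subseteq> config_alphabet \<and> length x \<le> 4}"
  have "finite ?A" by (rule finite_lists_length_le[OF finite_config_alphabet])
  then have "finite ((\<lambda>(x, e, a, y). rule_cells x e a y) `
      (?A \<times> (insert None (Some ` Q)) \<times> (UNIV :: bool option set) \<times> ?A))"
    using finite_Q by (intro finite_imageI finite_cartesian_product) auto
  moreover have "{rule_cells x e a y | x e a y. machine_rule M x e a y} \<subseteq>
      (\<lambda>(x, e, a, y). rule_cells x e a y) `
      (?A \<times> (insert None (Some ` Q)) \<times> (UNIV :: bool option set) \<times> ?A)"
  proof clarify
    fix x e a y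
    assume "machine_rule M x e a y"
    from machine_rule_letters[OF this]
    have "(x, e, a, y) \<in> ?A \<times> (insert None (Some ` Q)) \<times> (UNIV :: bool option set) \<times> ?A" by simp
    then show "rule_cells x e a y \<in> (\<lambda>(x, e, a, y). rule_cells x e a y) `
      (?A \<times> (insert None (Some ` Q)) \<times> (UNIV :: bool option set) \<times> ?A)"
      by (rule image_eqI[rotated]) simp
  qed
  ultimately have "finite {rule_cells x e a y | x e a y. machine_rule M x e a y}"
    by (rule finite_subset[rotated])
  then show ?thesis using finite_I by (simp add: program_def)
qed

lemma encode_letters: "set (encode W) \<subseteq> queue_alphabet S"
  by (induction W) (auto simp: code_def queue_alphabet_def)

lemma code_letters: "set (code x) \<subseteq> queue_alphabet S"
  using encode_letters[of "[x]"] by simp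

lemma program_cells:
  assumes "r \<in> program"
  shows "set r \<subseteq> instructions"
proof -
  have *: "set (map Pop q) \<subseteq> instructions"
    "set (map Push q) \<subseteq> instructions"
    if "set q \<subseteq> queue_alphabet S" for q
    using that by auto
  have e: "set (map Emit (concat (map emission (emits e)))) \<subseteq>
      instructions" if "e = None \<or> e \<in> Some ` Q" for e
    using that emission_codes by (fastforce simp: cell_alphabet_def)
  have a: "set (case a of None \<Rightarrow> [] | Some b \<Rightarrow> [Ask b]) \<subseteq>
      instructions" for a
    by (auto simp: cell_alphabet_def split: option.split)
  from assms consider x e a y where "machine_rule M x e a y" "r = rule_cells x e a y"
    | c where "c \<in> I" "r = load_cells c" | "r = start_cells" | "r = accept_cells"
    unfolding program_def by blast
  then show ?thesis
  proof cases
    case 1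
    have e': "e = None \<or> e \<in> Some ` Q" using machine_rule_letters[OF 1(1)] by blast
    show ?thesis unfolding 1(2) rule_cells_def set_append
      by (intro Un_least *(1)[OF encode_letters] *(2)[OF encode_letters] e[OF e'] a)
  next
    case 2
    have "set (load c) \<subseteq> queue_alphabet S" using load_letters[OF 2(1)] by blast
    then show ?thesis unfolding 2(2) load_cells_def set_append
      by (intro Un_least *(1) *(2)[OF code_letters])
  next
    case 3
    have "Pop End \<in> instructions" by simp
    then show ?thesis using *(2)[OF encode_letters]
      unfolding 3 start_cells_def list.set(2) by (rule insert_subsetI)
  next
    case 4
    have "set [Accept] \<subseteq> instructions" by (simp add: cell_alphabet_def)
    then show ?thesis unfolding 4 accept_cells_def set_append
      by (intro Un_least *(1)[OF code_letters])
  qed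
qed

lemma runs_rule:
  "runs S L (rule_cells x e a y @ cs) q u \<longleftrightarrow> (\<exists>q'. q = encode x @ q' \<and>
     (case a of None \<Rightarrow> runs S L cs (q' @ encode y) (u @ emitted (emits e))
      | Some b \<Rightarrow> (u @ emitted (emits e) \<in> L \<longleftrightarrow> b) \<and> runs S L cs (q' @ encode y) []))"
  unfolding rule_cells_def append_assoc runs_Pop runs_Emit emitted_def[symmetric]
  by (cases a) (simp_all add: runs_Push)

lemma runs_load: "runs S L (load_cells c @ cs) q u \<longleftrightarrow>
    (\<exists>q'. q = load c @ q' \<and> runs S L cs (q' @ code (Symbol (Input c))) u)"
  unfolding load_cells_def append_assoc runs_Pop runs_Push by simp

lemma runs_start: "runs S L (start_cells @ cs) q u \<longleftrightarrow>
    (\<exists>q'. q = End # q' \<and> runs S L cs (q' @ encode [Border, State (start_state M)]) u)"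
  unfolding start_cells_def by (cases q) (auto simp: runs_Push)

lemma runs_accept: "runs S L (accept_cells @ cs) q u \<longleftrightarrow>
    (\<exists>q'. q = code (State (accept_state M)) @ q')"
  unfolding accept_cells_def append_assoc runs_Pop by simp

definition well_formed :: "('i, 'o) segment \<Rightarrow> bool" where
  "well_formed c = (case c of (q, ls, rs, u) \<Rightarrow>
     q \<in> states M \<and> set ls \<subseteq> tape_alphabet M \<and> set rs \<subseteq> tape_alphabet M \<and> set u \<subseteq> Q)"

definition cyclic_part :: "'i tape_symbol list \<Rightarrow> 'i tape_symbol list \<Rightarrow> 'i config_letter list" where
  "cyclic_part ls rs = map Symbol rs @ Border # rev (map Symbol ls)"

text \<open>
A depiction is any rotation of the cyclic word; cutting it at the state gives a normal form
because the state occurs only once.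
\<close>

definition depicts :: "'i config_letter list \<Rightarrow> ('i, 'o) segment \<Rightarrow> bool" where
  "depicts W c = (case c of (q, ls, rs, u) \<Rightarrow>
     \<exists>V R. W = V @ State q # R \<and> R @ V = cyclic_part ls rs)"

lemma no_State: "State q \<notin> set (cyclic_part ls rs)"
  by (auto simp: cyclic_part_def)

lemma depicts_letters:
  assumes "depicts W c" "well_formed c"
  shows "set W \<subseteq> config_alphabet"
proof -
  obtain q ls rs u where c: "c = (q, ls, rs, u)" by (cases c)
  then obtain V R where W: "W = V @ State q # R" "R @ V = cyclic_part ls rs"
    using assms(1) by (auto simp: depicts_def)
  have "set R \<union> set V \<subseteq> config_alphabet"
    using assms(2) arg_cong[OF W(2), of set] by (auto simp: c well_formed_def cyclic_part_def)
  then show ?thesis using W(1) assms(2) by (auto simp: c well_formed_def)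
qed

lemma depicts_State_first:
  assumes "depicts (State q # R) (q', ls, rs, u)"
  shows "q' = q \<and> R = cyclic_part ls rs"
proof -
  obtain V R' where W: "State q # R = V @ State q' # R'" "R' @ V = cyclic_part ls rs"
    using assms by (auto simp: depicts_def)
  have "State q \<notin> set V" using W(2) no_State[of q ls rs] by (metis Un_iff set_append)
  then have "V = []" using W(1) by (cases V) auto
  then show ?thesis using W by auto
qed

lemma depicts_State_second:
  assumes "depicts (x # State q # R) (q', ls, rs, u)" "x \<notin> range State"
  shows "q' = q \<and> R @ [x] = cyclic_part ls rs"
proof -
  obtain V R' where W: "x # State q # R = V @ State q' # R'" "R' @ V = cyclic_part ls rs"
    using assms by (auto simp: depicts_def)
  have "State q \<notin> set V" using W(2) no_State[of q ls rs] by (metis Un_iff set_append)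
  then have "V = [x]" using W(1) assms(2)
    by (cases V; cases "tl V") auto
  then show ?thesis using W by auto
qed

lemma depictsI:
  assumes "R @ V = cyclic_part ls rs"
  shows "depicts (V @ State q # R) (q, ls, rs, u)"
  using assms by (auto simp: depicts_def)

lemma cyclic_part_Symbol:
  "Symbol a # R = cyclic_part ls rs \<longleftrightarrow> (\<exists>rs'. rs = a # rs' \<and> R = cyclic_part ls rs')"
  by (cases rs) (auto simp: cyclic_part_def)

lemma cyclic_part_Border:
  "Border # R = cyclic_part ls rs \<longleftrightarrow> rs = [] \<and> R = rev (map Symbol ls)"
  by (cases rs) (auto simp: cyclic_part_def)

lemma cyclic_part_last_Symbol:
  "R @ [Symbol b] = cyclic_part ls rs \<longleftrightarrow> (\<exists>ls'. ls = b # ls' \<and> R = cyclic_part ls' rs)"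
  by (cases ls) (auto simp: cyclic_part_def)

lemma cyclic_part_last_Border:
  "R @ [Border] = cyclic_part ls rs \<longleftrightarrow> ls = [] \<and> R = map Symbol rs"
  by (cases ls) (auto simp: cyclic_part_def)

lemma depicts_rotate:
  assumes "depicts (x # W) (q, ls, rs, u)"
  shows "depicts (W @ [x]) (q, ls, rs, u)"
proof -
  obtain V R where W: "x # W = V @ State q # R" "R @ V = cyclic_part ls rs"
    using assms by (auto simp: depicts_def)
  show ?thesis
  proof (cases V)
    case Nil
    then show ?thesis using W depictsI[of "[]" R] by auto
  next
    case (Cons y V')
    then show ?thesis using W depictsI[of "R @ [x]" V'] by auto
  qed
qed

lemma step_accepts:
  assumes "q \<noteq> accept_state M" "q \<noteq> query_state M" "transition M q (scanned rs) = (q', a, d, e)"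
  shows "accepts (q, ls, rs, u) \<longleftrightarrow>
    accepts (q', fst (write_move d a ls (tl rs)), snd (write_move d a ls (tl rs)), u @ emits e)"
  by (rule accepts_from_transition[OF assms])

text \<open>
A rule which applies to a depicted configuration either changes only its representation or performs
its unique successor step. The target may depict any query tape \<open>u'\<close>, since the query tape is not
part of the cyclic word.
\<close>

lemma machine_rule_sound:
  assumes "machine_rule M x e a y" "depicts (x @ W) (q, ls, rs, u)" "well_formed (q, ls, rs, u)"
    "\<And>b. a = Some b \<Longrightarrow> u \<in> LM \<longleftrightarrow> b"
  shows "\<exists>q' ls' rs'. depicts (W @ y) (q', ls', rs', u') \<and>
    well_formed (q', ls', rs', if a = None then u @ emits e else []) \<and>
    (accepts (q, ls, rs, u) \<longleftrightarrow> accepts (q', ls', rs', if a = None then u @ emits e else []))"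
  using assms
proof (cases rule: machine_rule.cases)
  case (extend p)
  have *: "q = p" "rs = []" "W = rev (map Symbol ls)"
    using depicts_State_first[of p "Border # W" q ls rs u] assms(2) extend cyclic_part_Border by auto
  have "depicts (W @ y) (q, ls, [Blank], u')"
    using depictsI[of "[Symbol Blank, Border]" W ls "[Blank]" q] * extend by (auto simp: cyclic_part_def)
  moreover have "well_formed (q, ls, [Blank], u)"
    using assms(3) machine_members by (auto simp: well_formed_def)
  moreover have "accepts (q, ls, rs, u) = accepts (q, ls, [Blank], u)"
    using * extend by (subst (1 2) accepts_from_step) simp
  ultimately show ?thesis using extend by auto
next
  case (right p b p' b')
  have "q = p" "Symbol b # W = cyclic_part ls rs"
    using depicts_State_first[of p "Symbol b # W" q ls rs u] assms(2) right by auto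
  then obtain rs' where *: "q = p" "rs = b # rs'" "W = cyclic_part ls rs'"
    using cyclic_part_Symbol by blast
  have "depicts (W @ y) (p', b' # ls, rs', u')"
    using depictsI[of "[]" "W @ [Symbol b']" "b' # ls" rs' p'] * right by (auto simp: cyclic_part_def)
  moreover have "well_formed (p', b' # ls, rs', u @ emits e)"
    using assms(3) transition_closed[of p b p' b' Move_Right e] right * by (auto simp: well_formed_def)
  moreover have "accepts (q, ls, rs, u) = accepts (p', b' # ls, rs', u @ emits e)"
    using * right by (subst step_accepts) auto
  ultimately show ?thesis using right by auto
next
  case (stay p b p' b')
  have "q = p" "Symbol b # W = cyclic_part ls rs"
    using depicts_State_first[of p "Symbol b # W" q ls rs u] assms(2) stay by auto
  then obtain rs' where *: "q = p" "rs = b # rs'" "W = cyclic_part ls rs'"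
    using cyclic_part_Symbol by blast
  have "depicts (W @ y) (p', ls, b' # rs', u')"
    using depictsI[of "[Symbol b']" W ls "b' # rs'" p'] * stay by (auto simp: cyclic_part_def)
  moreover have "well_formed (p', ls, b' # rs', u @ emits e)"
    using assms(3) transition_closed[of p b p' b' Stay e] stay * by (auto simp: well_formed_def)
  moreover have "accepts (q, ls, rs, u) = accepts (p', ls, b' # rs', u @ emits e)"
    using * stay by (subst step_accepts) auto
  ultimately show ?thesis using stay by auto
next
  case (left p b l p' b')
  have "q = p" "Symbol b # W @ [Symbol l] = cyclic_part ls rs"
    using depicts_State_second[of "Symbol l" p "Symbol b # W" q ls rs u] assms(2) left by auto
  then obtain rs' ls' where *: "q = p" "rs = b # rs'" "ls = l # ls'" "W = cyclic_part ls' rs'"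
    using cyclic_part_Symbol cyclic_part_last_Symbol by metis
  have "depicts (W @ y) (p', ls', l # b' # rs', u')"
    using depictsI[of "[Symbol l, Symbol b']" W ls' "l # b' # rs'" p'] * left
    by (auto simp: cyclic_part_def)
  moreover have "well_formed (p', ls', l # b' # rs', u @ emits e)"
    using assms(3) transition_closed[of p b p' b' Move_Left e] left * by (auto simp: well_formed_def)
  moreover have "accepts (q, ls, rs, u) =
      accepts (p', ls', l # b' # rs', u @ emits e)"
    using * left by (subst step_accepts) auto
  ultimately show ?thesis using left by auto
next
  case (left_end p b p' b')
  have "q = p" "Symbol b # W @ [Border] = cyclic_part ls rs"
    using depicts_State_second[of Border p "Symbol b # W" q ls rs u] assms(2) left_end by auto
  then obtain rs' where *: "q = p" "rs = b # rs'" "ls = []" "W = map Symbol rs'"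
    using cyclic_part_Symbol cyclic_part_last_Border by metis
  have "depicts (W @ y) (p', [], Blank # b' # rs', u')"
    using depictsI[of "[Symbol Blank, Symbol b']" "W @ [Border]" "[]" "Blank # b' # rs'" p'] * left_end
    by (auto simp: cyclic_part_def)
  moreover have "well_formed (p', [], Blank # b' # rs', u @ emits e)"
    using assms(3) transition_closed[of p b p' b' Move_Left e] left_end * machine_members
    by (auto simp: well_formed_def)
  moreover have "accepts (q, ls, rs, u) =
      accepts (p', [], Blank # b' # rs', u @ emits e)"
    using * left_end by (subst step_accepts) auto
  ultimately show ?thesis using left_end by auto
next
  case (ask b)
  let ?p = "if b then yes_state M else no_state M"
  have *: "q = query_state M" "W = cyclic_part ls rs"
    using depicts_State_first[of "query_state M" W q ls rs u] assms(2) ask by auto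
  have "depicts (W @ y) (?p, ls, rs, u')"
    using depictsI[of "[]" W ls rs ?p] * ask by auto
  moreover have "well_formed (?p, ls, rs, [])"
    using assms(3) machine_members by (auto simp: well_formed_def)
  moreover have "accepts (q, ls, rs, u) = accepts (?p, ls, rs, [])"
    using accepts_from_query[of M LM ls rs u] accept_not_query assms(4) ask * by auto
  ultimately have "depicts (W @ y) (?p, ls, rs, u') \<and>
    well_formed (?p, ls, rs, if a = None then u @ emits e else []) \<and>
    (accepts (q, ls, rs, u) \<longleftrightarrow> accepts (?p, ls, rs, if a = None then u @ emits e else []))"
    using ask(3) by simp
  then show ?thesis by blast
next
  case (rotate z)
  have "depicts (W @ y) (q, ls, rs, u)" using depicts_rotate[of z W] assms(2) rotate by auto
  then have "depicts (W @ y) (q, ls, rs, u')" by (simp add: depicts_def)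
  then show ?thesis using rotate assms(3) by auto
qed

lemma loaded_sound:
  assumes "set rl \<subseteq> program" "depicts W (q, ls, rs, u)" "well_formed (q, ls, rs, u)"
    "runs S L (bracket rl) (encode W) (emitted u)"
  shows "accepts (q, ls, rs, u)"
  using assms
proof (induction rl arbitrary: W q ls rs u)
  case (Cons r rl)
  have letters: "set W \<subseteq> config_alphabet" by (rule depicts_letters[OF Cons.prems(2,3)])
  have "W \<noteq> []" using Cons.prems(2) by (auto simp: depicts_def)
  then have hd: "hd (encode W) \<in> {Zero, One}" using code_hd by (cases W) auto
  have run: "runs S L (r @ Close # bracket rl) (encode W) (emitted u)" using Cons.prems(4) by simp
  have "r \<in> program" using Cons.prems(1) by simp
  then consider (rule) x e a y where "machine_rule M x e a y" "r = rule_cells x e a y"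
    | (load) c where "c \<in> I" "r = load_cells c" | (start) "r = start_cells"
    | (accept) "r = accept_cells"
    unfolding program_def by blast
  then show ?case
  proof cases
    case rule
    obtain v where v: "encode W = encode x @ v"
      and run': "case a of None \<Rightarrow> runs S L (Close # bracket rl) (v @ encode y) (emitted u @ emitted (emits e))
      | Some b \<Rightarrow> (emitted u @ emitted (emits e) \<in> L \<longleftrightarrow> b) \<and>
           runs S L (Close # bracket rl) (v @ encode y) []"
      using run unfolding rule(2) runs_rule by blast
    obtain W' where W': "W = x @ W'" "v = encode W'"
      using encode_prefix[OF v letters] machine_rule_letters[OF rule(1)] by blast
    have u: "u \<in> lists Q" using Cons.prems(3) by (auto simp: well_formed_def)
    have eNone: "e = None" if "a = Some b" for b using rule(1) that by (cases rule: machine_rule.cases) auto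
    have ans: "u \<in> LM \<longleftrightarrow> b" if "a = Some b" for b
      using run' eNone[OF that] that oracle_iff[OF u] by (simp add: emitted_def)
    obtain q' ls' rs' where new: "depicts (W' @ y) (q', ls', rs', if a = None then u @ emits e else [])"
      "well_formed (q', ls', rs', if a = None then u @ emits e else [])"
      "accepts (q, ls, rs, u) =
         accepts (q', ls', rs', if a = None then u @ emits e else [])"
      using machine_rule_sound[OF rule(1) Cons.prems(2)[unfolded W'] Cons.prems(3) ans] by blast
    have "runs S L (bracket rl) (encode (W' @ y)) (emitted (if a = None then u @ emits e else []))"
      using run' W'(2) by (cases a) auto
    then show ?thesis using Cons.IH[OF _ new(1,2)] Cons.prems(1) new(3) by auto
  next
    case load
    obtain v where "encode W = load c @ v" using run unfolding load(2) runs_load by blast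
    then have "hd (load c) \<in> {Zero, One}" "hd (load c) \<in> set (load c)"
      using hd load_nonempty[OF load(1)] by auto
    then show ?thesis using load_letters[OF load(1)] by blast
  next
    case start
    then show ?thesis using run hd unfolding start runs_start by auto
  next
    case accept
    obtain v where v: "encode W = encode [State (accept_state M)] @ v"
      using run unfolding accept runs_accept by auto
    then obtain W' where "W = State (accept_state M) # W'"
      using encode_prefix[OF v letters] machine_members by auto
    then have "q = accept_state M" using depicts_State_first Cons.prems(2) by blast
    then show ?thesis by simp
  qed
qed simp

text \<open>
Completeness proceeds backwards: from runs that accept a later queue one obtains runs that accept an
earlier one by putting a rule in front.
\<close>

definition runnable :: "queue_letter list \<Rightarrow> 'k list \<Rightarrow> bool" where
  "runnable v u \<longleftrightarrow> (\<exists>rl. set rl \<subseteq> program \<and> runs S L (bracket rl) v u)"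

lemma runnableI:
  assumes "runs S L (r @ Close # bracket rl) v u" "set rl \<subseteq> program" "r \<in> program"
  shows "runnable v u"
  unfolding runnable_def by (rule exI[of _ "r # rl"]) (use assms in simp)

lemma runnable_rule:
  assumes "machine_rule M x e None y" "runnable (encode (W @ y)) (u @ emitted (emits e))"
  shows "runnable (encode (x @ W)) u"
proof -
  obtain rl where "set rl \<subseteq> program" "runs S L (bracket rl) (encode (W @ y)) (u @ emitted (emits e))"
    using assms(2) by (auto simp: runnable_def)
  then show ?thesis
    by (intro runnableI[of "rule_cells x e None y" rl])
      (use assms(1) in \<open>auto simp: runs_rule program_def\<close>)
qed

lemma runnable_ask:
  assumes "machine_rule M x None (Some b) y" "u \<in> L \<longleftrightarrow> b" "runnable (encode (W @ y)) []"
  shows "runnable (encode (x @ W)) u"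
proof -
  obtain rl where "set rl \<subseteq> program" "runs S L (bracket rl) (encode (W @ y)) []"
    using assms(3) by (auto simp: runnable_def)
  then show ?thesis
    by (intro runnableI[of "rule_cells x None (Some b) y" rl])
      (use assms(1,2) in \<open>auto simp: runs_rule program_def\<close>)
qed

lemma runnable_rotate:
  assumes "set V \<subseteq> config_alphabet" "runnable (encode (W @ V)) u"
  shows "runnable (encode (V @ W)) u"
  using assms
proof (induction V arbitrary: W)
  case (Cons x V)
  have "machine_rule M [x] None None [x]"
    using Cons.prems(1) by (intro machine_rule.rotate) (auto simp: config_alphabet_def)
  moreover have "runnable (encode (V @ (W @ [x]))) u"
    using Cons.prems by (intro Cons.IH) auto
  ultimately show ?case using runnable_rule[of "[x]" None "[x]" "V @ W" u] by simp
qed simp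

text \<open>
By induction on the length of the computation. In each case the cyclic word is rotated so that the
letters which the applicable rule removes are in front.
\<close>

lemma loaded_complete:
  assumes "well_formed (q, ls, rs, u)"
    "fst ((segment_step M LM ^^ n) (q, ls, rs, u)) = accept_state M"
  shows "runnable (encode (State q # cyclic_part ls rs)) (emitted u)"
  using assms
proof (induction n arbitrary: q ls rs u)
  case 0
  then have "runs S L (accept_cells @ Close # bracket []) (encode (State q # cyclic_part ls rs)) (emitted u)"
    by (simp add: runs_accept)
  then show ?case by (rule runnableI) (auto simp: program_def)
next
  case (Suc n)
  have letters: "set (map Symbol ls) \<subseteq> config_alphabet" "set (map Symbol rs) \<subseteq> config_alphabet"
      "set (cyclic_part ls rs) \<subseteq> config_alphabet" "q \<in> states M"
    using Suc.prems(1) by (auto simp: well_formed_def cyclic_part_def)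
  have next_step: "fst ((segment_step M LM ^^ n) (segment_step M LM (q, ls, rs, u))) = accept_state M"
    using Suc.prems(2) by (simp only: funpow_Suc_right o_apply)
  have final: "runnable (encode (State q' # cyclic_part ls' rs')) (emitted u')"
    if "segment_step M LM (q, ls, rs, u) = (q', ls', rs', u')" "well_formed (q', ls', rs', u')"
    for q' ls' rs' u'
    using Suc.IH[OF that(2)] next_step that(1) by simp
  consider "q = accept_state M" | "q = query_state M" "q \<noteq> accept_state M"
    | "q \<noteq> accept_state M" "q \<noteq> query_state M" by blast
  then show ?case
  proof cases
    case 1
    then have "runs S L (accept_cells @ Close # bracket []) (encode (State q # cyclic_part ls rs)) (emitted u)"
      by (simp add: runs_accept)
    then show ?thesis by (rule runnableI) (auto simp: program_def)
  next
    case 2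
    let ?p = "if u \<in> LM then yes_state M else no_state M"
    have "runnable (encode ([State ?p] @ cyclic_part ls rs)) (emitted [])"
      using final[of ?p ls rs "[]"] 2 Suc.prems(1) machine_members by (auto simp: well_formed_def)
    then have "runnable (encode (cyclic_part ls rs @ [State ?p])) []"
      using runnable_rotate[OF letters(3), of "[State ?p]" "[]"] by simp
    moreover have "emitted u \<in> L \<longleftrightarrow> u \<in> LM"
      using oracle_iff[of u] Suc.prems(1) by (auto simp: emitted_def well_formed_def)
    ultimately show ?thesis
      using runnable_ask[OF machine_rule.ask[of M "u \<in> LM"], of "emitted u" "cyclic_part ls rs"] 2 by simp
  next
    case 3
    obtain a rs' where rs: "a = scanned rs" "rs' = tl rs" by simp
    have a: "a \<in> tape_alphabet M" "set rs' \<subseteq> tape_alphabet M"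
      using rs Suc.prems(1) machine_members by (cases rs; auto simp: well_formed_def)+
    have full: "runnable (encode (State q # cyclic_part ls (a # rs'))) (emitted u)"
    proof -
      obtain q' a' d e where tr: "transition M q a = (q', a', d, e)" by (cases "transition M q a") auto
      note cl = transition_closed[OF letters(4) a(1) tr]
      have step: "segment_step M LM (q, ls, rs, u) =
          (q', fst (write_move d a' ls rs'), snd (write_move d a' ls rs'), u @ emits e)"
        using 3 tr rs by simp
      have out: "emitted u @ emitted (emits e) = emitted (u @ emits e)" by simp
      have wf: "well_formed (q', ls', rs'', u @ emits e)"
        if "set ls' \<subseteq> tape_alphabet M" "set rs'' \<subseteq> tape_alphabet M" for ls' rs''
        using that cl Suc.prems(1) by (auto simp: well_formed_def)
      have ls: "set ls \<subseteq> tape_alphabet M" using Suc.prems(1) by (auto simp: well_formed_def)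
      let ?C = "cyclic_part ls rs'"
      have C: "set ?C \<subseteq> config_alphabet" using ls a(2) by (auto simp: cyclic_part_def)
      show ?thesis
      proof (cases d)
        case Move_Right
        have "runnable (encode ([State q'] @ cyclic_part (a' # ls) rs')) (emitted (u @ emits e))"
          using final[OF step] wf[of "a' # ls" rs'] cl ls a(2) Move_Right by simp
        then have "runnable (encode ((?C @ [Symbol a']) @ [State q'])) (emitted (u @ emits e))"
          using runnable_rotate[of "?C @ [Symbol a']" "[State q']"] C cl by (simp add: cyclic_part_def)
        then show ?thesis
          using runnable_rule[OF machine_rule.right[OF letters(4) 3 a(1) tr[unfolded Move_Right]],
              of ?C "emitted u"] by (simp add: cyclic_part_def)
      next
        case Stay
        have "runnable (encode ([State q', Symbol a'] @ ?C)) (emitted (u @ emits e))"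
          using final[OF step] wf[of ls "a' # rs'"] cl ls a(2) Stay by (simp add: cyclic_part_def)
        then have "runnable (encode (?C @ [State q', Symbol a'])) (emitted (u @ emits e))"
          using runnable_rotate[of ?C "[State q', Symbol a']"] C by simp
        then show ?thesis
          using runnable_rule[OF machine_rule.stay[OF letters(4) 3 a(1) tr[unfolded Stay]],
              of ?C "emitted u"] by (simp add: cyclic_part_def)
      next
        case Move_Left
        show ?thesis
        proof (cases ls)
          case Nil
          let ?D = "map Symbol rs' :: 'i config_letter list"
          have D: "set ?D \<subseteq> config_alphabet" using a(2) by auto
          have "runnable (encode ([State q', Symbol Blank, Symbol a'] @ ?D @ [Border]))
              (emitted (u @ emits e))"
            using final[OF step] wf[of "[]" "Blank # a' # rs'"] cl a(2) machine_members Move_Left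
            by (simp add: cyclic_part_def Nil)
          then have "runnable (encode ((?D @ [Border]) @ [State q', Symbol Blank, Symbol a']))
              (emitted (u @ emits e))"
            using runnable_rotate[of "?D @ [Border]" "[State q', Symbol Blank, Symbol a']"] D by simp
          then have "runnable (encode ([Border, State q, Symbol a] @ ?D)) (emitted u)"
            using runnable_rule[OF machine_rule.left_end[OF letters(4) 3 a(1) tr[unfolded Move_Left]],
              of ?D "emitted u"] by simp
          then show ?thesis
            using runnable_rotate[of "State q # Symbol a # ?D" "[Border]"] D a letters
            by (simp add: cyclic_part_def Nil)
        next
          case (Cons b ls')
          let ?D = "cyclic_part ls' rs'"
          have b: "b \<in> tape_alphabet M" "set ls' \<subseteq> tape_alphabet M" using ls Cons by auto
          have D: "set ?D \<subseteq> config_alphabet" using a(2) b by (auto simp: cyclic_part_def)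
          have "runnable (encode ([State q', Symbol b, Symbol a'] @ ?D)) (emitted (u @ emits e))"
            using final[OF step] wf[of ls' "b # a' # rs'"] cl a(2) b Move_Left
            by (simp add: cyclic_part_def Cons)
          then have "runnable (encode (?D @ [State q', Symbol b, Symbol a'])) (emitted (u @ emits e))"
            using runnable_rotate[OF D, of "[State q', Symbol b, Symbol a']"] by simp
          then have "runnable (encode ([Symbol b, State q, Symbol a] @ ?D)) (emitted u)"
            using runnable_rule[OF machine_rule.left[OF letters(4) 3 a(1) b(1) tr[unfolded Move_Left]],
              of ?D "emitted u"] by simp
          then show ?thesis
            using runnable_rotate[of "State q # Symbol a # ?D" "[Symbol b]"] D a letters
            by (simp add: cyclic_part_def Cons)
        qed
      qed
    qed
    show ?thesis
    proof (cases rs)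
      case Nil
      let ?C = "rev (map Symbol ls) :: 'i config_letter list"
      have "runnable (encode ([State q, Symbol Blank, Border] @ ?C)) (emitted u)"
        using full rs Nil by (simp add: cyclic_part_def)
      then have "runnable (encode (?C @ [State q, Symbol Blank, Border])) (emitted u)"
        using runnable_rotate[of ?C "[State q, Symbol Blank, Border]"] letters by simp
      then show ?thesis
        using runnable_rule[OF machine_rule.extend[OF letters(4) 3], of ?C "emitted u"]
        by (simp add: cyclic_part_def Nil)
    next
      case (Cons b rs'')
      then show ?thesis using full rs by simp
    qed
  qed
qed

text \<open>
During loading the queue is the remaining text, then \<open>End\<close>, then the code of the letters \<open>l\<close> that
have been read. The text need not determine the word that it spells; whichever word \<open>l'\<close> is guessed,
it spells the text and is accepted.
\<close>

lemma loading_sound: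
  assumes "set rl \<subseteq> program" "set v \<inter> {End, Zero, One} = {}" "l \<in> lists I"
    "runs S L (bracket rl) (v @ End # encode (map (Symbol \<circ> Input) l)) []"
  shows "\<exists>l'\<in>lists I. v = concat (map load l') \<and>
    accepts (start_state M, [], map Input (l @ l'), [])"
  using assms
proof (induction rl arbitrary: v l)
  case (Cons r rl)
  let ?q = "v @ End # encode (map (Symbol \<circ> Input) l)"
  have hd: "hd ?q \<notin> {Zero, One}" using Cons.prems(2) by (cases v) auto
  have run: "runs S L (r @ Close # bracket rl) ?q []" using Cons.prems(4) by (simp add: comp_def)
  have "r \<in> program" using Cons.prems(1) by simp
  then consider (rule) x e a y where "machine_rule M x e a y" "r = rule_cells x e a y"
    | (load) c where "c \<in> I" "r = load_cells c" | (start) "r = start_cells"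
    | (accept) "r = accept_cells"
    unfolding program_def by blast
  then show ?case
  proof cases
    case rule
    obtain z where z: "?q = encode x @ z" using run unfolding rule(2) runs_rule by blast
    have "x \<noteq> []" using machine_rule_letters[OF rule(1)] by blast
    then have "hd (encode x @ z) \<in> {Zero, One}" using code_hd by (cases x) auto
    then show ?thesis using hd z by simp
  next
    case load
    obtain z where z: "?q = load c @ z"
      and run': "runs S L (Close # bracket rl) (z @ code (Symbol (Input c))) []"
      using run unfolding load(2) runs_load by blast
    have "End \<notin> set (load c)" using load_letters[OF load(1)] by auto
    then obtain v' where v': "v = load c @ v'" "z = v' @ End # encode (map (Symbol \<circ> Input) l)"
      using prefix_before_marker[OF z] by blast
    have "\<exists>l'\<in>lists I. v' = concat (map load l') \<and>
        accepts (start_state M, [], map Input ((l @ [c]) @ l'), [])"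
    proof (rule Cons.IH)
      show "runs S L (bracket rl) (v' @ End # encode (map (Symbol \<circ> Input) (l @ [c]))) []"
        using run' v' by simp
    qed (use Cons.prems load v' in auto)
    then obtain l' where "l' \<in> lists I" "v' = concat (map load l')"
      "accepts (start_state M, [], map Input (l @ c # l'), [])" by auto
    then show ?thesis using v' load(1) by (intro bexI[of _ "c # l'"]) auto
  next
    case start
    have v: "v = []" using run Cons.prems(2) unfolding start runs_start by (cases v) auto
    let ?W = "(map (Symbol \<circ> Input) l @ [Border]) @ State (start_state M) # []"
    have "runs S L (bracket rl) (encode ?W) (emitted [])"
      using run unfolding start runs_start by (auto simp: v)
    moreover have "depicts ?W (start_state M, [], map Input l, [])"
      by (rule depictsI) (simp add: cyclic_part_def)
    moreover have "well_formed (start_state M, [], map Input l, [])"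
      using Cons.prems(3) machine_members by (auto simp: well_formed_def)
    ultimately have "accepts (start_state M, [], map Input l, [])"
      using loaded_sound Cons.prems(1) by auto
    then show ?thesis using v by (intro bexI[of _ "[]"]) auto
  next
    case accept
    then show ?thesis using run hd code_hd unfolding accept runs_accept by metis
  qed
qed simp

lemma loading_complete:
  assumes "runnable (End # encode (map (Symbol \<circ> Input) (l @ l'))) []" "l' \<in> lists I"
  shows "runnable (concat (map load l') @ End # encode (map (Symbol \<circ> Input) l)) []"
  using assms
proof (induction l' arbitrary: l)
  case (Cons c l')
  have "runnable (concat (map load l') @ End # encode (map (Symbol \<circ> Input) (l @ [c]))) []"
    using Cons.prems by (intro Cons.IH) auto
  then obtain rl where rl: "set rl \<subseteq> program"
    "runs S L (bracket rl) (concat (map load l') @ End # encode (map (Symbol \<circ> Input) (l @ [c]))) []"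
    by (auto simp: runnable_def)
  have c: "load_cells c \<in> program" using Cons.prems by (auto simp: program_def)
  have "runs S L (load_cells c @ Close # bracket rl)
      (concat (map load (c # l')) @ End # encode (map (Symbol \<circ> Input) l)) []"
    using rl(2) by (simp add: runs_load)
  then show ?case by (rule runnableI[OF _ rl(1) c])
qed simp

text \<open>
The simulation. The existentially quantified list of rules is the witness that listings contain.
\<close>

lemma queue_program_accepts_iff:
  assumes "set v \<inter> {End, Zero, One} = {}"
  shows "(\<exists>rl. set rl \<subseteq> program \<and> runs S L (bracket rl) (v @ [End]) []) \<longleftrightarrow>
    (\<exists>l\<in>lists I. v = concat (map load l) \<and> machine_accepts M LM l)"
proof
  assume "\<exists>rl. set rl \<subseteq> program \<and> runs S L (bracket rl) (v @ [End]) []"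
  then show "\<exists>l\<in>lists I. v = concat (map load l) \<and> machine_accepts M LM l"
    using loading_sound[of _ v "[]"] assms by (auto simp: machine_accepts_iff_accepts_from)
next
  assume "\<exists>l\<in>lists I. v = concat (map load l) \<and> machine_accepts M LM l"
  then obtain l n where l: "l \<in> lists I" "v = concat (map load l)"
    and n: "fst ((segment_step M LM ^^ n) (start_state M, [], map Input l, [])) = accept_state M"
    by (auto simp: machine_accepts_iff_accepts_from accepts_from_def)
  have "well_formed (start_state M, [], map Input l, [])"
    using l machine_members by (auto simp: well_formed_def)
  then have "runnable (encode ([State (start_state M)] @ map (Symbol \<circ> Input) l @ [Border])) []"
    using loaded_complete[OF _ n] by (simp add: cyclic_part_def)
  moreover have letters: "set (map (Symbol \<circ> Input) l @ [Border]) \<subseteq> config_alphabet"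
    using l(1) machine_members(2) by (auto simp: config_alphabet_def)
  ultimately have "runnable (encode ((map (Symbol \<circ> Input) l @ [Border]) @ [State (start_state M)])) []"
    using runnable_rotate[of "map (Symbol \<circ> Input) l @ [Border]" "[State (start_state M)]"]
      letters by simp
  then obtain rl where rl: "set rl \<subseteq> program"
      "runs S L (bracket rl) (encode (map (Symbol \<circ> Input) l @ [Border, State (start_state M)])) []"
    by (auto simp: runnable_def)
  then have "runnable (End # encode (map (Symbol \<circ> Input) ([] @ l))) []"
    by (intro runnableI[of start_cells rl]) (auto simp: runs_start program_def)
  from loading_complete[OF this l(1)] l(2)
  show "\<exists>rl. set rl \<subseteq> program \<and> runs S L (bracket rl) (v @ [End]) []" by (simp add: runnable_def)
qed

end

section \<open>Programs written along a row\<close>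

lemma drop_bracket_at_Open:
  assumes "j < length (bracket rl)" "bracket rl ! j = Open" "\<forall>r\<in>set rl. Open \<notin> set r"
  shows "\<exists>r\<in>set rl. \<exists>rest. drop j (bracket rl) = Open # r @ Close # rest"
  using assms
proof (induction rl arbitrary: j)
  case (Cons r rl)
  show ?case
  proof (cases j)
    case 0
    then show ?thesis by auto
  next
    case (Suc i)
    show ?thesis
    proof (cases "i < Suc (length r)")
      case True
      then have "bracket (r # rl) ! j = (r @ [Close]) ! i" using Suc by (simp add: nth_append)
      moreover have "(r @ [Close]) ! i \<in> set (r @ [Close])" using True by (intro nth_mem) simp
      ultimately show ?thesis using Cons.prems by auto
    next
      case False
      define k where "k = i - Suc (length r)"
      have j: "j = length (Open # r @ [Close]) + k" using False Suc by (simp add: k_def)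
      have b: "bracket (r # rl) = (Open # r @ [Close]) @ bracket rl" by simp
      have "k < length (bracket rl)" using Cons.prems(1) j by simp
      moreover have "bracket rl ! k = Open"
        using Cons.prems(2) unfolding b j nth_append_length_plus .
      moreover have "drop j (bracket (r # rl)) = drop k (bracket rl)"
        unfolding b j by simp
      ultimately show ?thesis using Cons.IH[of k] Cons.prems(3) by auto
    qed
  qed
qed simp

text \<open>
A stream holds in the periodic row with period \<open>P\<close>.
\<close>

definition matches :: "cell list \<Rightarrow> (nat \<times> cell) list \<Rightarrow> bool" where
  "matches P bs \<longleftrightarrow> (\<forall>(n, c)\<in>set bs. P ! (n mod length P) = c)"

lemma matches_simps [simp]:
  "matches P []"
  "matches P ((n, c) # bs) \<longleftrightarrow> P ! (n mod length P) = c \<and> matches P bs"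
  "matches P (bs @ bs') \<longleftrightarrow> matches P bs \<and> matches P bs'" by (simp_all add: matches_def ball_Un)

lemma continues_along_rule:
  assumes "continues n bs" "matches P bs" "drop (Suc (n mod length P)) P = r @ Close # rest"
    "Close \<notin> set r"
  shows "\<exists>bs'. map snd bs = r @ Close # map snd bs' \<and> opens bs' \<and> matches P bs'"
  using assms
proof (induction r arbitrary: n bs)
  case Nil
  then obtain c bs1 where bs: "bs = (Suc n, c) # bs1" by (cases bs) auto
  have "Suc (n mod length P) < length P" using Nil.prems(3) by (cases "Suc (n mod length P) < length P") auto
  then have m: "Suc n mod length P = Suc (n mod length P)" by (simp add: mod_Suc)
  have "c = Close" using Nil.prems(2,3) bs m
    by (metis append_Nil matches_simps(2) nth_via_drop)
  then show ?case using Nil.prems bs by auto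
next
  case (Cons x r)
  then obtain c bs1 where bs: "bs = (Suc n, c) # bs1" by (cases bs) auto
  have lt: "Suc (n mod length P) < length P"
    using Cons.prems(3) by (cases "Suc (n mod length P) < length P") auto
  then have m: "Suc n mod length P = Suc (n mod length P)" by (simp add: mod_Suc)
  have c: "c = x" using Cons.prems(2,3) bs m
    by (metis append_Cons matches_simps(2) nth_via_drop)
  have "drop (Suc (Suc n mod length P)) P = r @ Close # rest"
    using Cons.prems(3) Cons_nth_drop_Suc[OF lt] m by simp
  then show ?case using Cons.IH[of "Suc n" bs1] Cons.prems bs c by auto
qed

text \<open>
A block begins at some \<open>Open\<close> of the row, and because its heights are consecutive it continues with
the cells written there until the first \<open>Close\<close>. Hence it is one of the rules in the row.
\<close>

lemma opens_matching_is_bracket: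
  assumes "opens bs" "matches P bs" "P \<noteq> []"
    "\<And>j. j < length P \<Longrightarrow> P ! j = Open \<Longrightarrow> \<exists>r\<in>R. \<exists>rest. drop j P = Open # r @ Close # rest"
    "\<And>r. r \<in> R \<Longrightarrow> Close \<notin> set r"
  shows "\<exists>rl. set rl \<subseteq> R \<and> map snd bs = bracket rl"
  using assms(1,2)
proof (induction "length bs" arbitrary: bs rule: less_induct)
  case less
  show ?case
  proof (cases bs)
    case Nil
    then show ?thesis by (intro exI[of _ "[]"]) auto
  next
    case (Cons p bs1)
    obtain n where p: "p = (n, Open)" "continues n bs1" using less.prems(1) Cons by (cases p) auto
    let ?j = "n mod length P"
    have j: "?j < length P" using assms(3) by simp
    have "P ! ?j = Open" using less.prems(2) Cons p by simp
    then obtain r rest where r: "r \<in> R" "drop ?j P = Open # r @ Close # rest"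
      using assms(4)[OF j] by blast
    have "drop (Suc ?j) P = r @ Close # rest" using r(2) Cons_nth_drop_Suc[OF j] by simp
    from continues_along_rule[OF p(2) _ this assms(5)[OF r(1)]] less.prems(2) Cons p(1)
    obtain bs' where bs': "map snd bs1 = r @ Close # map snd bs'" "opens bs'" "matches P bs'"
      by auto
    have "length (map snd bs1) = length (r @ Close # map snd bs')" using bs'(1) by (rule arg_cong)
    then have "length bs' < length bs" using Cons by simp
    from less.hyps[OF this bs'(2,3)] obtain rl where "set rl \<subseteq> R" "map snd bs' = bracket rl" by blast
    then show ?thesis using Cons p r bs' by (intro exI[of _ "r # rl"]) auto
  qed
qed

lemma continues_through_rule:
  assumes "opens bs" "set r \<inter> {Open, Close, Mark} = {}"
  shows "continues n (List.enumerate (Suc n) (r @ [Close]) @ bs)"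
  using assms(2)
proof (induction r arbitrary: n)
  case Nil
  then show ?case using assms(1) by simp
next
  case (Cons x r)
  then show ?case using Cons.IH[of "Suc n"] by auto
qed

lemma bracket_is_matched:
  assumes "set rl \<subseteq> R" "\<And>r. r \<in> R \<Longrightarrow> set r \<inter> {Open, Close, Mark} = {}"
    "\<And>r. r \<in> R \<Longrightarrow> \<exists>pre rest. P = pre @ Open # r @ Close # rest"
  shows "\<exists>bs. opens bs \<and> matches P bs \<and> map snd bs = bracket rl"
  using assms(1)
proof (induction rl)
  case Nil
  then show ?case by (intro exI[of _ "[]"]) auto
next
  case (Cons r rl)
  then obtain bs where bs: "opens bs" "matches P bs" "map snd bs = bracket rl" by auto
  have r: "r \<in> R" using Cons.prems by simp
  obtain pre rest where P: "P = pre @ Open # r @ Close # rest" using assms(3)[OF r] by blast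
  let ?n = "length pre"
  let ?z = "List.enumerate (Suc ?n) (r @ [Close])"
  have "matches P ?z" unfolding matches_def
  proof clarify
    fix m c assume "(m, c) \<in> set ?z"
    then have "Suc ?n \<le> m" "m < length (r @ [Close]) + Suc ?n" "(r @ [Close]) ! (m - Suc ?n) = c"
      unfolding in_set_enumerate_eq by simp_all
    then obtain i where i: "i < length (r @ [Close])" "m = Suc ?n + i" "c = (r @ [Close]) ! i"
      by (intro that[of "m - Suc ?n"]) auto
    have P': "P = (pre @ [Open]) @ (r @ [Close]) @ rest" using P by simp
    have "m = length (pre @ [Open]) + i" using i(2) by simp
    then have "P ! m = ((r @ [Close]) @ rest) ! i" unfolding P' by (simp only: nth_append_length_plus)
    moreover have "m < length P" using i unfolding P by simp
    ultimately show "P ! (m mod length P) = c" using i by (simp add: nth_append)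
  qed
  moreover have "P ! (?n mod length P) = Open" using P by simp
  ultimately have "opens ((?n, Open) # ?z @ bs) \<and> matches P ((?n, Open) # ?z @ bs) \<and>
      map snd ((?n, Open) # ?z @ bs) = bracket (r # rl)"
    using bs continues_through_rule[OF bs(1) assms(2)[OF r], of ?n] by simp
  then show ?case by blast
qed

section \<open>Listings\<close>

lemma encode_listing_simps [simp]:
  "encode_listing [] = []"
  "encode_listing ((w, a) # l) = map Inl w @ Inr a # encode_listing l"
  "encode_listing (l @ l') = encode_listing l @ encode_listing l'"
  by (simp_all add: encode_listing_def)

lemma Inl_Inr_cancel:
  "map Inl w @ Inr a # r = map Inl w' @ Inr a' # r' \<Longrightarrow> w = w' \<and> a = a' \<and> r = r'"
proof (induction w arbitrary: w')
  case Nil then show ?case by (cases w') auto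
next
  case (Cons s w) then show ?case by (cases w') auto
qed

lemma encode_listing_inj: "encode_listing l = encode_listing l' \<Longrightarrow> l = l'"
proof (induction l arbitrary: l')
  case Nil
  then show ?case by (cases l') auto
next
  case (Cons p l)
  obtain w a where p: "p = (w, a)" by (cases p)
  obtain w' a' l1 where l': "l' = (w', a') # l1" using Cons.prems p
    by (cases l') auto
  show ?case using Inl_Inr_cancel[of w a "encode_listing l" w' a' "encode_listing l1"]
      Cons.prems Cons.IH[of l1] p l' by auto
qed

lemma text_is_listing:
  assumes "text_ends e v" "set v \<subseteq> S <+> B"
  shows "if v = [] then e else \<exists>l. l \<noteq> [] \<and> set l \<subseteq> lists S \<times> B \<and> encode_listing l = v"
  using assms
proof (induction e v rule: text_ends.induct)
  case (2 e s w)
  then have "w \<noteq> []" by auto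
  then obtain l where l: "l \<noteq> []" "set l \<subseteq> lists S \<times> B" "encode_listing l = w"
    using 2 by auto
  then obtain u b l1 where l1: "l = (u, b) # l1" by (cases l) auto
  have "set ((s # u, b) # l1) \<subseteq> lists S \<times> B" using l(2) l1 2(3) by auto
  moreover have "encode_listing ((s # u, b) # l1) = Inl s # w" using l(3) l1 by simp
  ultimately show ?case by (metis list.distinct(1))
next
  case (3 e b w)
  then consider "w = []" | l where "set l \<subseteq> lists S \<times> B" "encode_listing l = w"
    by (cases "w = []") auto
  then show ?case
  proof cases
    case 1
    then show ?thesis using 3(3) by (auto intro!: exI[of _ "[([], b)]"])
  next
    case 2
    have "set (([], b) # l) \<subseteq> lists S \<times> B" using 2(1) 3(3) by auto
    moreover have "encode_listing (([], b) # l) = Inr b # w" using 2(2) by simp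
    ultimately show ?thesis by (metis list.distinct(1))
  qed
qed simp

lemma text_is_listing_True:
  assumes "text_ends True v" "set v \<subseteq> S <+> B"
  shows "\<exists>l. set l \<subseteq> lists S \<times> B \<and> encode_listing l = v"
proof (cases "v = []")
  case True
  then show ?thesis by (intro exI[of _ "[]"]) simp
next
  case False
  then show ?thesis using text_is_listing[OF assms] by auto
qed

lemma text_queue_append: "text_queue S (v @ w) = text_queue S v @ text_queue S w"
  by (induction S v rule: text_queue.induct) auto

lemma text_queue_inj:
  assumes "text_queue S v = text_queue S v'" "text_ends e v" "text_ends e' v'"
    "set v \<subseteq> S <+> range (to_nat :: cell \<Rightarrow> nat)" "set v' \<subseteq> S <+> range (to_nat :: cell \<Rightarrow> nat)"
    "countable S"
  shows "v = v'"
  using assms(1-5)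
proof (induction v arbitrary: v' e e')
  case Nil
  show ?case
  proof (cases v')
    case (Cons y w)
    then show ?thesis using Nil.prems(1) by (cases y) auto
  qed simp
next
  case (Cons x v)
  show ?case
  proof (cases v')
    case Nil
    then show ?thesis using Cons.prems(1) by (cases x) auto
  next
    case (Cons y w)
    have "x = y \<and> text_queue S v = text_queue S w"
      using Cons.prems assms(6) \<open>v' = y # w\<close>
      by (cases x; cases y) (auto simp: image_iff)
    moreover have "\<exists>d. text_ends d v" "\<exists>d. text_ends d w"
      using Cons.prems(2,3) \<open>v' = y # w\<close> by (cases x; cases y; auto)+
    ultimately show ?thesis using Cons.IH[of w] Cons.prems(4,5) \<open>v' = y # w\<close> by auto
  qed
qed

lemma text_queue_letters:
  assumes "set v \<subseteq> S <+> B"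
  shows "set (text_queue S v) \<inter> {End, Zero, One} = {}"
  using assms by (induction S v rule: text_queue.induct) auto

lemma encode_block_listing:
  "encode_listing (map (\<lambda>(n, c). (replicate n t, to_nat c)) bs) = block_word t bs"
proof (induction bs)
  case (Cons p bs)
  then show ?case by (cases p) simp
qed simp

section \<open>The universal subshift\<close>

lemma word_value_times_integers:
  "word_value (times_integers G) w = (word_value G (map fst w), sum_list (map snd w))"
  by (induction w) (simp_all add: mult_DirProd')

text \<open>
The universal subshift depends only on the group and a generating set. Its own generating set contains \<open>up\<close> as the unary
digit of heights and \<open>down\<close> as its inverse.
\<close>

locale fiber_interpreter =
  fixes G :: "('g, 'm) monoid_scheme" and SG :: "'g set"
  assumes group_G: "group G" and SG: "symmetric_generating_set G SG"
begin

interpretation group G by (rule group_G)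

abbreviation K where "K \<equiv> times_integers G"

lemma group_K: "group K"
  by (rule DirProd_group[OF group_G group_integer_group])

definition up :: "'g \<times> int" where "up = (\<one>\<^bsub>G\<^esub>, 1)"
definition down :: "'g \<times> int" where "down = (\<one>\<^bsub>G\<^esub>, -1)"
definition S :: "('g \<times> int) set" where "S = SG \<times> {0} \<union> {up, down}"

abbreviation "Bt \<equiv> row_alphabet S"

lemma SG_simps: "finite SG" "SG \<subseteq> carrier G" "\<one>\<^bsub>G\<^esub> \<in> SG" "generate G SG = carrier G"
    "s \<in> SG \<Longrightarrow> inv\<^bsub>G\<^esub> s \<in> SG"
  using SG by (auto simp: symmetric_generating_set_def)

lemma ex_word_G: "g \<in> carrier G \<Longrightarrow> \<exists>w. w \<noteq> [] \<and> set w \<subseteq> SG \<and> word_value G w = g"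
  using generate_word_value[OF group_G SG_simps(2,5,3)] SG_simps(4) by simp

lemma finite_S: "finite S" and S_carrier: "S \<subseteq> carrier K" and up_S: "up \<in> S" and down_S: "down \<in> S"
  using SG_simps by (auto simp: S_def up_def down_def)

lemma word_value_generate: "set w \<subseteq> S \<Longrightarrow> word_value K w \<in> generate K S"
  by (induction w) (auto intro: generate.intros simp del: one_DirProd)

lemma sum_list_replicate_int: "sum_list (replicate n (c::int)) = int n * c"
  by (induction n) (auto simp: algebra_simps)

lemma word_value_ones: "set w \<subseteq> {\<one>\<^bsub>G\<^esub>} \<Longrightarrow> word_value G w = \<one>\<^bsub>G\<^esub>"
  by (induction w) auto

lemma word_value_replicate_one: "word_value G (replicate n \<one>\<^bsub>G\<^esub>) = \<one>\<^bsub>G\<^esub>"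
  by (rule word_value_ones) auto

lemma word_value_lift: "word_value K (map (\<lambda>g. (g, 0)) w) = (word_value G w, 0)"
  by (simp add: word_value_times_integers comp_def map_replicate_const sum_list_replicate_int)

lemma word_value_up: "word_value K (replicate n up) = (\<one>\<^bsub>G\<^esub>, int n)"
  by (simp add: word_value_times_integers up_def sum_list_replicate_int word_value_replicate_one)

lemma word_value_down: "word_value K (replicate n down) = (\<one>\<^bsub>G\<^esub>, - int n)"
  by (simp add: word_value_times_integers down_def sum_list_replicate_int word_value_replicate_one)

lemma symmetric_generating_set_S: "symmetric_generating_set K S"
proof -
  have "x \<in> generate K S" if x_K: "x \<in> carrier K" for x
  proof -
    obtain g n where x: "x = (g, n)" "g \<in> carrier G" using x_K by (cases x) auto
    obtain w where w: "set w \<subseteq> SG" "word_value G w = g" using ex_word_G[OF x(2)] by blast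
    let ?z = "if n \<ge> 0 then replicate (nat n) up else replicate (nat (- n)) down"
    have z: "set ?z \<subseteq> S" "word_value K ?z = (\<one>\<^bsub>G\<^esub>, n)"
      using up_S down_S by (auto simp: word_value_up word_value_down)
    have l: "set (map (\<lambda>g. (g, 0)) w) \<subseteq> S" using w(1) by (auto simp: S_def)
    have "word_value K (map (\<lambda>g. (g, 0)) w @ ?z) = (g, n)"
      using l z S_carrier w x(2)
      by (subst word_value_append[OF group_K]) (auto simp: word_value_lift simp del: carrier_DirProd)
    then show ?thesis using word_value_generate[of "map (\<lambda>g. (g, 0)) w @ ?z"] l z x by auto
  qed
  moreover have "generate K S \<subseteq> carrier K" by (rule group.generate_incl[OF group_K S_carrier])
  moreover have "inv\<^bsub>K\<^esub> s \<in> S" if "s \<in> S" for s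
  proof -
    obtain g n where s: "s = (g, n)" by (cases s)
    have "g \<in> carrier G" using that S_carrier s by auto
    then have "inv\<^bsub>K\<^esub> s = (inv\<^bsub>G\<^esub> g, - n)"
      using s by (simp add: inv_DirProd[OF group_G group_integer_group])
    then show ?thesis using that s SG_simps by (auto simp: S_def up_def down_def)
  qed
  moreover have "\<one>\<^bsub>K\<^esub> \<in> S" using SG_simps by (auto simp: S_def)
  ultimately show ?thesis
    using finite_S S_carrier by (auto simp: symmetric_generating_set_def simp del: carrier_DirProd)
qed

abbreviation WP where "WP \<equiv> word_problem K S"

abbreviation stream_listing where
  "stream_listing bs \<equiv> map (\<lambda>(n, c). (replicate n up, to_nat c)) bs"

sublocale interpreter_oracle S up down WP
proof
  fix n m
  have "set (replicate n up @ up # replicate m down) \<subseteq> S" using up_S down_S by auto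
  moreover have "word_value K (replicate n up @ up # replicate m down) = (\<one>\<^bsub>G\<^esub>, int n + 1 - int m)"
    by (auto simp: word_value_times_integers up_def down_def sum_list_replicate_int
        intro!: word_value_ones)
  ultimately show "replicate n up @ up # replicate m down \<in> WP \<longleftrightarrow> m = Suc n"
    by (auto simp: word_problem_def)
qed

abbreviation interpreted where
  "interpreted \<equiv> machine_accepts (interpreter S up down) WP"

definition listings :: "(('g \<times> int) list \<times> nat) list set" where
  "listings = {l \<in> lists (lists S \<times> Bt).
     machine_accepts (interpreter S up down) WP (encode_listing l)}"

definition universal :: "('g \<times> int \<Rightarrow> nat) set" where
  "universal = subshift_of_codings K Bt (set ` listings)"

lemma encode_listing_lists:
  "l \<in> lists (lists S' \<times> B) \<Longrightarrow> encode_listing l \<in> lists (S' <+> B)"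
  by (induction l) auto

lemma row_alphabet_cells: "Bt \<subseteq> range (to_nat :: cell \<Rightarrow> nat)" "to_nat Mark \<in> Bt" "to_nat Flag \<in> Bt"
  using alphabet_simps(10)[of _ S] by (auto simp: row_alphabet_def simp del: alphabet_simps)

lemma mem_listings_iff:
  "l \<in> listings \<longleftrightarrow> l \<in> lists (lists S \<times> Bt) \<and>
    (\<exists>bs lv. l = stream_listing bs @ ([], to_nat Mark) # lv \<and>
      opens bs \<and> text_ends True (encode_listing lv) \<and>
      runs S WP (map snd bs) (text_queue S (encode_listing lv) @ [End]) [])"
proof (cases "l \<in> lists (lists S \<times> Bt)")
  case True
  have "(\<exists>bs v. encode_listing l = block_word up bs @ Inr (to_nat Mark) # v \<and> opens bs \<and>
        text_ends True v \<and> runs S WP (map snd bs) (text_queue S v @ [End]) []) \<longleftrightarrow>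
    (\<exists>bs lv. l = stream_listing bs @ ([], to_nat Mark) # lv \<and>
      opens bs \<and> text_ends True (encode_listing lv) \<and>
      runs S WP (map snd bs) (text_queue S (encode_listing lv) @ [End]) [])"
    (is "?l \<longleftrightarrow> ?r")
  proof
    assume ?l
    then obtain bs v where v: "encode_listing l = block_word up bs @ Inr (to_nat Mark) # v"
      "opens bs" "text_ends True v"
      "runs S WP (map snd bs) (text_queue S v @ [End]) []" by blast
    have "set (encode_listing l) \<subseteq> S <+> Bt" using encode_listing_lists[OF True] by auto
    then have "set v \<subseteq> S <+> Bt" unfolding v(1) by auto
    then obtain lv where lv: "encode_listing lv = v"
      using text_is_listing_True[OF v(3)] by blast
    have "l = stream_listing bs @ ([], to_nat Mark) # lv"
      by (rule encode_listing_inj) (simp add: v(1) lv encode_block_listing)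
    then show ?r using v lv by blast
  next
    assume ?r
    then obtain bs lv where "l = stream_listing bs @ ([], to_nat Mark) # lv"
      "opens bs" "text_ends True (encode_listing lv)"
      "runs S WP (map snd bs) (text_queue S (encode_listing lv) @ [End]) []"
      by blast
    then show ?l
      by (intro exI[of _ bs] exI[of _ "encode_listing lv"]) (simp add: encode_block_listing)
  qed
  moreover have "l \<in> listings \<longleftrightarrow>
      machine_accepts (interpreter S up down) WP (encode_listing l)"
    using True unfolding listings_def by blast
  ultimately show ?thesis using True interpreter_accepts_iff[OF encode_listing_lists[OF True]]
    by blast
next
  case False
  then show ?thesis unfolding listings_def by blast
qed

lemma accepted_words_are_listings:
  "{w \<in> lists (S <+> Bt). machine_accepts (interpreter S up down) WP w} =
     encode_listing ` listings"
proof (intro Set.set_eqI iffI)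
  fix w
  assume "w \<in> {w \<in> lists (S <+> Bt). machine_accepts (interpreter S up down) WP w}"
  then have w: "w \<in> lists (S <+> Bt)" "machine_accepts (interpreter S up down) WP w"
    by auto
  then obtain bs v where v: "w = block_word up bs @ Inr (to_nat Mark) # v" "text_ends True v"
    using interpreter_accepts_iff by blast
  have "set v \<subseteq> S <+> Bt" using w(1) v(1) by auto
  then obtain lv where lv: "encode_listing lv = v" "set lv \<subseteq> lists S \<times> Bt"
    using text_is_listing_True[OF v(2)] by blast
  let ?l = "stream_listing bs @ ([], to_nat Mark) # lv"
  have bs: "to_nat (snd p) \<in> Bt" if p: "p \<in> set bs" for p
  proof -
    have "\<exists>c\<in>snd ` set bs. to_nat (snd p) = to_nat c" using p by blast
    then have "Inr (to_nat (snd p)) \<in> set w"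
      unfolding v(1) set_append Un_iff Inr_in_block_word by blast
    then have "Inr (to_nat (snd p)) \<in> S <+> Bt" using w(1) in_listsD by blast
    then show ?thesis by auto
  qed
  have "set (stream_listing bs) \<subseteq> lists S \<times> Bt"
    unfolding set_map
  proof (rule image_subsetI)
    fix p assume p: "p \<in> set bs"
    obtain n c where nc: "p = (n, c)" by (rule prod.exhaust)
    have "to_nat c \<in> Bt" using bs[OF p] unfolding nc snd_conv .
    moreover have "replicate n up \<in> lists S" using up_S by (simp add: in_lists_conv_set)
    ultimately show "(case p of (n, c) \<Rightarrow> (replicate n up, to_nat c)) \<in> lists S \<times> Bt"
      unfolding nc prod.case by (intro SigmaI)
  qed
  then have "set ?l \<subseteq> lists S \<times> Bt"
    unfolding set_append list.set(2) using lv(2) row_alphabet_cells(2) lists.Nil by blast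
  then have l: "?l \<in> lists (lists S \<times> Bt)" by (rule subsetD[OF equalityD2[OF lists_eq_set], OF CollectI])
  have e: "encode_listing ?l = w" by (simp add: v(1) lv encode_block_listing)
  have "?l \<in> listings" unfolding listings_def mem_Collect_eq e using l w(2) by (rule conjI)
  from imageI[OF this, of encode_listing] show "w \<in> encode_listing ` listings" unfolding e .
next
  fix w assume "w \<in> encode_listing ` listings"
  then obtain l where l: "w = encode_listing l" "l \<in> listings" by blast
  note l' = l(2)[unfolded listings_def mem_Collect_eq]
  show "w \<in> {w \<in> lists (S <+> Bt). machine_accepts (interpreter S up down) WP w}"
    unfolding l(1) mem_Collect_eq using encode_listing_lists[OF conjunct1[OF l']] conjunct2[OF l'] by (rule conjI)
qed

lemma codings: "\<forall>c\<in>set ` listings. is_pattern_coding S Bt c"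
  by (auto simp: listings_def is_pattern_coding_def)

lemma effectively_closed_universal: "effectively_closed K Bt universal"
  unfolding effectively_closed_def
proof (intro exI conjI)
  show "re_codings_with_oracle S Bt WP (set ` listings)"
    unfolding re_codings_with_oracle_def re_language_with_oracle_def
  proof (intro exI[of _ listings] conjI)
    show "listings \<subseteq> lists (lists S \<times> Bt)" unfolding listings_def by blast
    show "\<exists>M. oracle_machine_over (S <+> Bt) S M \<and>
        encode_listing ` listings = {w \<in> lists (S <+> Bt). machine_accepts M WP w}"
      using oracle_machine_over_interpreter[OF finite_S up_S down_S]
        accepted_words_are_listings[symmetric] by (intro exI conjI)
  qed (rule refl)
qed (use symmetric_generating_set_S codings universal_def in auto)

lemma subshift_universal: "subshift K Bt universal"
  unfolding universal_def
  by (rule subshift_subshift_of_codings[OF group_K symmetric_generating_set_S codings])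

end

section \<open>Constraints on windows\<close>

text \<open>
Local rules are given below as conditions on a finite window; they become forbidden patterns by
collecting the windows that violate them.
\<close>

lemma avoids_forbidden_windows_iff:
  assumes "group K" "D \<subseteq> carrier K" "z \<in> full_shift K C"
    "\<And>y y'. (\<And>d. d \<in> D \<Longrightarrow> y d = y' d) \<Longrightarrow> P y \<longleftrightarrow> P y'"
  shows "z \<notin> (\<Union>p\<in>{p. dom p = D \<and> ran p \<subseteq> C \<and> \<not> P (\<lambda>d. the (p d))}.
      \<Union>h\<in>carrier K. pattern_cylinder K C p h) \<longleftrightarrow>
    (\<forall>h\<in>carrier K. P (\<lambda>d. z (h \<otimes>\<^bsub>K\<^esub> d)))"
proof -
  interpret group K by fact
  have "(\<exists>p. dom p = D \<and> ran p \<subseteq> C \<and> \<not> P (\<lambda>d. the (p d)) \<and> z \<in> pattern_cylinder K C p h) \<longleftrightarrow>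
      \<not> P (\<lambda>d. z (h \<otimes>\<^bsub>K\<^esub> d))" if h: "h \<in> carrier K" for h
  proof
    assume "\<exists>p. dom p = D \<and> ran p \<subseteq> C \<and> \<not> P (\<lambda>d. the (p d)) \<and> z \<in> pattern_cylinder K C p h"
    then obtain p where p: "dom p = D" "\<not> P (\<lambda>d. the (p d))" "z \<in> pattern_cylinder K C p h"
      by blast
    have "the (p d) = z (h \<otimes>\<^bsub>K\<^esub> d)" if "d \<in> D" for d
      using p(1,3) that by (auto simp: pattern_cylinder_def cylinder_def)
    then show "\<not> P (\<lambda>d. z (h \<otimes>\<^bsub>K\<^esub> d))" using assms(4) p(2) by meson
  next
    assume P: "\<not> P (\<lambda>d. z (h \<otimes>\<^bsub>K\<^esub> d))"
    define p where "p = (\<lambda>d. if d \<in> D then Some (z (h \<otimes>\<^bsub>K\<^esub> d)) else None)"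
    have "dom p = D" by (auto simp: p_def split: if_splits)
    moreover have "ran p \<subseteq> C"
    proof
      fix c assume "c \<in> ran p"
      then obtain d where "d \<in> D" "c = z (h \<otimes>\<^bsub>K\<^esub> d)" by (auto simp: p_def ran_def split: if_splits)
      then show "c \<in> C" using assms(2,3) h by (auto simp: full_shift_def)
    qed
    moreover have "\<not> P (\<lambda>d. the (p d))"
      using P assms(4)[of "\<lambda>d. the (p d)" "\<lambda>d. z (h \<otimes>\<^bsub>K\<^esub> d)"] by (simp add: p_def)
    moreover have "z \<in> pattern_cylinder K C p h"
      using assms(3) \<open>dom p = D\<close> by (auto simp: pattern_cylinder_def cylinder_def p_def)
    ultimately show "\<exists>p. dom p = D \<and> ran p \<subseteq> C \<and> \<not> P (\<lambda>d. the (p d)) \<and>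
        z \<in> pattern_cylinder K C p h" by blast
  qed
  then show ?thesis by blast
qed

lemma int_step_constant:
  fixes f :: "int \<Rightarrow> 'a"
  assumes "\<And>n. f (n + 1) = f n"
  shows "f n = f 0"
proof (induction n rule: int_induct[where k = 0])
  case (step2 i)
  then show ?case using assms[of "i - 1"] by simp
qed (use assms in auto)

lemma full_shift_pair:
  assumes "u \<in> full_shift K B" "v \<in> full_shift K C"
  shows "(\<lambda>h\<in>carrier K. (u h, v h)) \<in> full_shift K (B \<times> C)"
  using assms by (auto simp: full_shift_def)

section \<open>Simulating one subshift\<close>

text \<open>
Now \<open>M\<close> semi-decides the forbidden listings of a subshift over \<open>A\<close>, with respect
to an arbitrary generating set \<open>SX\<close> of \<open>G\<close>.
\<close>

locale effective_subshift = fiber_interpreter G SG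
  for G :: "('g, 'm) monoid_scheme" and SG +
  fixes A :: "nat set" and SX :: "'g set" and E :: "('g list \<times> nat) list set"
    and M :: "('g + nat, 'g) oracle_machine"
  assumes finite_A: "finite A" and SX: "symmetric_generating_set G SX"
    and E_lists: "E \<subseteq> lists (lists SX \<times> A)"
    and M_over: "oracle_machine_over (SX <+> A) SX M"
    and E_eq: "encode_listing ` E =
      {w \<in> lists (SX <+> A). machine_accepts M (word_problem G SX) w}"
begin

lemma SX_simps: "finite SX" "SX \<subseteq> carrier G"
  using SX by (auto simp: symmetric_generating_set_def)

text \<open>
Generators in \<open>SX\<close> are replaced by words over the fixed generating set. The words are nonempty so
that every loading rule consumes a part of the text.
\<close>

definition word_of :: "'g \<Rightarrow> ('g \<times> int) list" where
  "word_of s = map (\<lambda>g. (g, 0)) (SOME w. w \<noteq> [] \<and> set w \<subseteq> SG \<and> word_value G w = s)"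

lemma word_of:
  assumes "s \<in> SX"
  shows "word_of s \<noteq> []" "set (word_of s) \<subseteq> S" "word_value K (word_of s) = (s, 0)"
proof -
  have "\<exists>w. w \<noteq> [] \<and> set w \<subseteq> SG \<and> word_value G w = s"
    using ex_word_G SX_simps(2) assms by blast
  from someI_ex[OF this]
  show "word_of s \<noteq> []" "set (word_of s) \<subseteq> S" "word_value K (word_of s) = (s, 0)"
    unfolding word_of_def word_value_lift by (auto simp: S_def)
qed

lemma words_of:
  assumes "set w \<subseteq> SX"
  shows "set (concat (map word_of w)) \<subseteq> S" "word_value K (concat (map word_of w)) = (word_value G w, 0)"
proof -
  show "set (concat (map word_of w)) \<subseteq> S" using assms word_of(2) by fastforce
  have "word_value K (concat (map word_of w)) = word_value K (map (\<lambda>s. (s, 0)) w)"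
  proof (rule word_value_concat_map[OF group_K])
    fix s assume "s \<in> set w"
    then have "s \<in> SX" using assms by blast
    then show "set (word_of s) \<subseteq> carrier K \<and> word_value K (word_of s) = (s, 0)"
      using word_of S_carrier by blast
  qed
  then show "word_value K (concat (map word_of w)) = (word_value G w, 0)"
    by (simp only: word_value_lift)
qed

abbreviation offset :: "nat \<Rightarrow> nat" where "offset a \<equiv> to_nat_on A a"

lemma offset_less: "a \<in> A \<Longrightarrow> offset a < card A"
  using to_nat_on_finite[OF finite_A] by (auto simp: bij_betw_def)

lemma offset_inj: "a \<in> A \<Longrightarrow> b \<in> A \<Longrightarrow> offset a = offset b \<longleftrightarrow> a = b"
  using finite_A by (simp add: countable_finite)

text \<open>
A letter of the alphabet \<open>A\<close> is spelled by the position of its flag in the row. A listing spelled in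
this way keeps its meaning: the pair \<open>(w, a)\<close> becomes the word \<open>w\<close> followed by the step to that
position.
\<close>

definition letter_text :: "'g + nat \<Rightarrow> (('g \<times> int) + nat) list" where
  "letter_text c = (case c of Inl s \<Rightarrow> map Inl (word_of s)
     | Inr a \<Rightarrow> map Inl (replicate (Suc (offset a)) up) @ [Inr (to_nat Flag)])"

definition letter_queue :: "'g + nat \<Rightarrow> queue_letter list" where
  "letter_queue c = text_queue S (letter_text c)"

definition generator_emission :: "'g \<Rightarrow> nat list" where
  "generator_emission s = map (to_nat_on S) (word_of s)"

lemma letter_text_simps [simp]:
  "letter_text (Inl s) = map Inl (word_of s)"
  "letter_text (Inr a) = map Inl (replicate (Suc (offset a)) up) @ [Inr (to_nat Flag)]"
  by (simp_all add: letter_text_def)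

lemma letter_text_letters:
  assumes "c \<in> SX <+> A"
  shows "set (letter_text c) \<subseteq> S <+> {to_nat Flag}"
proof (cases c)
  case (Inl s)
  then have "set (word_of s) \<subseteq> S" using word_of(2) assms by auto
  then show ?thesis using Inl by auto
next
  case (Inr a)
  then show ?thesis using up_S by auto
qed

lemma letter_text_nonempty: "c \<in> SX <+> A \<Longrightarrow> letter_text c \<noteq> []"
  using word_of(1) by (auto simp: letter_text_def)

lemma text_queue_alphabet: "set v \<subseteq> S <+> B \<Longrightarrow> set (text_queue S v) \<subseteq> insert Star (Gen ` generator_codes S)"
  unfolding generator_codes_def
  by (induction S v rule: text_queue.induct) auto

sublocale queue_simulation M "SX <+> A" SX "word_problem G SX" S WP
    letter_queue generator_emission
proof
  fix c assume c: "c \<in> SX <+> A"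
  show "letter_queue c \<noteq> []"
    using letter_text_nonempty[OF c] unfolding letter_queue_def
    by (cases "letter_text c"; cases "hd (letter_text c)") auto
  show "set (letter_queue c) \<subseteq> queue_alphabet S - {End, Zero, One}"
    using text_queue_alphabet[OF letter_text_letters[OF c]]
    by (auto simp: letter_queue_def queue_alphabet_def)
next
  fix b assume "b \<in> SX"
  then show "set (generator_emission b) \<subseteq> generator_codes S"
    using word_of(2) by (auto simp: generator_emission_def generator_codes_def)
next
  fix u assume u: "u \<in> lists SX"
  have "map (from_nat_into S) (concat (map generator_emission u)) = concat (map word_of u)"
    using u
  proof (induction u)
    case (Cons s u)
    have "map (from_nat_into S) (generator_emission s) = map id (word_of s)"
      unfolding generator_emission_def map_map
    proof (rule map_cong[OF refl])
      fix x assume "x \<in> set (word_of s)"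
      then have "x \<in> S" using word_of(2) Cons.hyps by blast
      then show "(from_nat_into S \<circ> to_nat_on S) x = id x"
        using finite_S by (simp add: countable_finite)
    qed
    then show ?case using Cons by simp
  qed simp
  moreover have "set u \<subseteq> SX" using u by auto
  note words_of[OF this]
  ultimately show "map (from_nat_into S) (concat (map generator_emission u)) \<in> WP \<longleftrightarrow>
      u \<in> word_problem G SX"
    using u by (auto simp: word_problem_def in_lists_conv_set)
qed (use M_over SX_simps in auto)

definition translate :: "'g list \<times> nat \<Rightarrow> ('g \<times> int) list \<times> nat" where
  "translate p = (concat (map word_of (fst p)) @ replicate (Suc (offset (snd p))) up, to_nat Flag)"

lemma encode_listing_translate:
  "encode_listing (map translate l) = concat (map letter_text (encode_listing l))"
proof (induction l)
  case (Cons p l)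
  have "map Inl (concat (map word_of w)) = concat (map letter_text (map Inl w))" for w
    by (induction w) simp_all
  then show ?case using Cons by (cases p) (simp add: translate_def)
qed simp

lemma text_queue_translate:
  "text_queue S (encode_listing (map translate l)) = concat (map letter_queue (encode_listing l))"
proof -
  have "text_queue S (concat (map letter_text v)) = concat (map letter_queue v)" for v
    by (induction v) (simp_all add: text_queue_append letter_queue_def)
  then show ?thesis by (simp add: encode_listing_translate)
qed

lemma text_ends_append: "text_ends e (map Inl w @ Inr b # v) \<longleftrightarrow> from_nat b = Flag \<and> text_ends True v"
  by (induction w arbitrary: e) auto

lemma text_ends_translate: "text_ends True (encode_listing (map translate l))"
proof (induction l)
  case (Cons p l)
  obtain w where "translate p = (w, to_nat Flag)" by (simp add: translate_def)
  then show ?case using Cons by (simp add: text_ends_append)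
qed simp

lemma translate_closed:
  assumes "p \<in> lists SX \<times> A"
  shows "translate p \<in> lists S \<times> Bt"
proof -
  have "set (concat (map word_of (fst p))) \<subseteq> S" using assms by (intro words_of) auto
  moreover have "set (replicate (Suc (offset (snd p))) up) \<subseteq> S"
    using up_S by (simp only: set_replicate_Suc insert_subset empty_subsetI)
  ultimately have "concat (map word_of (fst p)) @ replicate (Suc (offset (snd p))) up \<in> lists S"
    by (simp only: in_lists_conv_set set_append Un_iff) blast
  then show ?thesis using row_alphabet_cells(3) by (simp add: translate_def)
qed

lemma translate_value:
  assumes "(w, a) \<in> lists SX \<times> A"
  shows "word_value K (fst (translate (w, a))) = (word_value G w, int (Suc (offset a)))"
proof -
  have w: "set w \<subseteq> SX" using assms by auto
  then have "word_value G w \<in> carrier G"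
    using SX_simps(2) by (intro word_value_closed[OF group_G]) auto
  moreover have "set (concat (map word_of w)) \<subseteq> carrier K" "set (replicate (Suc (offset a)) up) \<subseteq> carrier K"
    using words_of(1)[OF w] up_S S_carrier by (auto simp del: carrier_DirProd)
  ultimately show ?thesis
    unfolding translate_def fst_conv snd_conv
    by (subst word_value_append[OF group_K])
      (simp_all only: words_of(2)[OF w] word_value_up mult_DirProd mult_integer_group
        monoid.r_one[OF group.is_monoid[OF group_G]] add_0)
qed

definition rules :: "cell list list" where
  "rules = (SOME rl. set rl = program)"

lemma set_rules: "set rules = program"
  unfolding rules_def using finite_list[OF finite_program] by (rule someI_ex)

text \<open>
The zone has one cell for each letter of \<open>A\<close>; the flag marks the letter of the fiber. It follows
\<open>Mark\<close>, so that the flag of \<open>a\<close> has height \<open>Suc (offset a)\<close> above the marker.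
\<close>

definition letter_zone :: "nat \<Rightarrow> cell list" where
  "letter_zone a = map (\<lambda>i. if i = offset a then Flag else Void) [0..<card A]"

definition row :: "nat \<Rightarrow> cell list" where
  "row a = Mark # letter_zone a @ bracket rules"

definition period :: nat where
  "period = Suc (card A + length (bracket rules))"

abbreviation phase :: "int \<Rightarrow> nat" where "phase i \<equiv> nat (i mod int period)"

lemma length_row [simp]: "length (row a) = period"
  by (simp add: row_def letter_zone_def period_def)

lemma period_pos: "0 < period"
  by (simp add: period_def)

lemma rule_cells_disjoint:
  assumes "r \<in> program"
  shows "set r \<inter> {Void, Mark, Flag, Open, Close} = {}" "set r \<subseteq> cell_alphabet S"
  using program_cells[OF assms] by blast+

lemma set_bracket: "set (bracket rl) \<subseteq> {Open, Close} \<union> \<Union> (set ` set rl)"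
  by (induction rl) auto

lemma rules_bracket_letter:
  assumes "c \<in> set (bracket rules)"
  shows "c \<notin> {Void, Mark, Flag} \<and> c \<in> cell_alphabet S"
proof -
  have "c \<in> {Open, Close} \<or> (\<exists>r\<in>set rules. c \<in> set r)"
    using set_bracket[of rules] assms by blast
  then show ?thesis
  proof
    assume "c \<in> {Open, Close}"
    then show ?thesis by (auto simp: cell_alphabet_def)
  next
    assume "\<exists>r\<in>set rules. c \<in> set r"
    then obtain r where "r \<in> program" "c \<in> set r" using set_rules by blast
    then show ?thesis using rule_cells_disjoint[of r] by blast
  qed
qed

lemma rules_bracket: "set (bracket rules) \<inter> {Void, Mark, Flag} = {}"
    "set (bracket rules) \<subseteq> cell_alphabet S"
  using rules_bracket_letter by blast+

lemma row_cells: "set (row a) \<subseteq> cell_alphabet S"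
  using rules_bracket(2) by (auto simp: row_def letter_zone_def cell_alphabet_def)

lemma row_nth_alphabet: "i < period \<Longrightarrow> to_nat (row a ! i) \<in> Bt"
  unfolding row_alphabet_def by (rule imageI, rule subsetD[OF row_cells], rule nth_mem) simp

lemma row_nth_cases:
  assumes "i < period"
  obtains "i = 0" "row a ! i = Mark"
  | j where "j < card A" "i = Suc j" "row a ! i = (if j = offset a then Flag else Void)"
  | k where "k < length (bracket rules)" "i = Suc (card A) + k" "row a ! i = bracket rules ! k"
      "row a ! i \<notin> {Void, Mark, Flag}"
proof (cases i)
  case 0
  then show ?thesis using that(1) by (simp add: row_def)
next
  case (Suc j)
  show ?thesis
  proof (cases "j < card A")
    case True
    then show ?thesis using that(2)[of j] Suc by (simp add: row_def letter_zone_def nth_append)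
  next
    case False
    let ?k = "j - card A"
    have k: "i = Suc (card A) + ?k" "?k < length (bracket rules)"
      using False Suc assms by (auto simp: period_def)
    have eq: "row a ! i = bracket rules ! ?k"
      using Suc False by (simp add: row_def letter_zone_def nth_append)
    have "row a ! i \<in> set (bracket rules)" unfolding eq using k(2) by (rule nth_mem)
    then have "row a ! i \<notin> {Void, Mark, Flag}" using rules_bracket(1) by blast
    then show ?thesis using that(3)[OF k(2,1) eq] by blast
  qed
qed

lemma row_Mark_iff: "i < period \<Longrightarrow> row a ! i = Mark \<longleftrightarrow> i = 0"
  by (rule row_nth_cases[of i a]) auto

lemma row_Flag_iff:
  assumes "a \<in> A" "i < period"
  shows "row a ! i = Flag \<longleftrightarrow> i = Suc (offset a)"
  using offset_less[OF assms(1)] by - (rule row_nth_cases[OF assms(2), of a]; auto)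

lemma row_Open:
  assumes "i < period" "row a ! i = Open"
  shows "\<exists>r\<in>program. \<exists>rest. drop i (row a) = Open # r @ Close # rest"
proof -
  obtain k where k: "k < length (bracket rules)" "i = Suc (card A) + k" "row a ! i = bracket rules ! k"
    using assms(2) by - (rule row_nth_cases[OF assms(1), of a]; auto split: if_splits)
  have "drop i (row a) = drop k (bracket rules)"
    unfolding k(2) by (simp add: row_def letter_zone_def)
  moreover have "\<forall>r\<in>set rules. Open \<notin> set r" using rule_cells_disjoint(1) set_rules by blast
  ultimately show ?thesis
    using drop_bracket_at_Open[OF k(1)] k(3) assms(2) set_rules by auto
qed

lemma rule_in_row:
  assumes "r \<in> program"
  shows "\<exists>pre rest. row a = pre @ Open # r @ Close # rest"
proof -
  obtain rl1 rl2 where "rules = rl1 @ r # rl2" using assms set_rules split_list by metis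
  then have "row a = (Mark # letter_zone a @ bracket rl1) @ Open # r @ Close # bracket rl2"
    by (simp add: row_def bracket_def)
  then show ?thesis by blast
qed

text \<open>
Streams which hold in the row amount to sequences of rules, and these accept exactly the texts that
spell the listings of the given subshift. The text determines its translated listing because reading
a text into the queue is injective.
\<close>

lemma row_runs_iff:
  assumes "text_ends True v" "set v \<subseteq> S <+> Bt"
  shows "(\<exists>bs. opens bs \<and> matches (row a) bs \<and>
      runs S WP (map snd bs) (text_queue S v @ [End]) []) \<longleftrightarrow>
    (\<exists>l\<in>E. v = encode_listing (map translate l))" (is "?l \<longleftrightarrow> ?r")
proof -
  have disjoint: "set (text_queue S v) \<inter> {End, Zero, One} = {}"
    by (rule text_queue_letters[OF assms(2)])
  have "?l \<longleftrightarrow> (\<exists>rl. set rl \<subseteq> program \<and>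
      runs S WP (bracket rl) (text_queue S v @ [End]) [])" (is "_ \<longleftrightarrow> ?m")
  proof
    assume ?l
    then obtain bs where bs: "opens bs" "matches (row a) bs"
      "runs S WP (map snd bs) (text_queue S v @ [End]) []" by blast
    have "\<exists>rl. set rl \<subseteq> program \<and> map snd bs = bracket rl"
    proof (rule opens_matching_is_bracket[OF bs(1,2)])
      show "row a \<noteq> []" by (simp add: row_def)
      show "\<exists>r\<in>program. \<exists>rest. drop j (row a) = Open # r @ Close # rest"
        if "j < length (row a)" "row a ! j = Open" for j
        using row_Open that by simp
      show "Close \<notin> set r" if "r \<in> program" for r using rule_cells_disjoint(1)[OF that] by blast
    qed
    then show ?m using bs(3) by auto
  next
    assume ?m
    then obtain rl where rl: "set rl \<subseteq> program"
      "runs S WP (bracket rl) (text_queue S v @ [End]) []" by blast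
    have "\<exists>bs. opens bs \<and> matches (row a) bs \<and> map snd bs = bracket rl"
    proof (rule bracket_is_matched[OF rl(1)])
      show "set r \<inter> {Open, Close, Mark} = {}" if "r \<in> program" for r
        using rule_cells_disjoint(1)[OF that] by blast
    qed (rule rule_in_row)
    then show ?l using rl(2) by auto
  qed
  also have "\<dots> \<longleftrightarrow> (\<exists>l\<in>lists (SX <+> A). text_queue S v = concat (map letter_queue l) \<and>
      machine_accepts M (word_problem G SX) l)"
    by (rule queue_program_accepts_iff[OF disjoint])
  also have "\<dots> \<longleftrightarrow> (\<exists>w\<in>encode_listing ` E. text_queue S v = concat (map letter_queue w))"
    unfolding E_eq by blast
  also have "\<dots> \<longleftrightarrow> (\<exists>l\<in>E. text_queue S v = text_queue S (encode_listing (map translate l)))"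
    unfolding text_queue_translate by blast
  also have "\<dots> \<longleftrightarrow> ?r"
  proof (rule bex_cong[OF refl])
    fix l assume "l \<in> E"
    then have "map translate l \<in> lists (lists S \<times> Bt)"
      using E_lists translate_closed by (fastforce simp: in_lists_conv_set)
    then have "set (encode_listing (map translate l)) \<subseteq> S <+> Bt"
      using encode_listing_lists by blast
    moreover have "S <+> Bt \<subseteq> S <+> range (to_nat :: cell \<Rightarrow> nat)"
      using row_alphabet_cells(1) by blast
    ultimately show "text_queue S v = text_queue S (encode_listing (map translate l)) \<longleftrightarrow>
        v = encode_listing (map translate l)"
      using text_queue_inj[OF _ assms(1) text_ends_translate] assms(2) finite_S
      by (meson countable_finite order_trans)
  qed
  finally show ?thesis .
qed

text \<open>
If a listing holds in \<open>z\<close> at \<open>(g, n)\<close>, the marker forces \<open>n\<close> to be the start of a period. Its stream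
then executes the program, so that its text is a translated coding from \<open>E\<close>, and the flags show that
this coding holds in \<open>x\<close> at \<open>g\<close>. Conversely, a coding which holds in \<open>x\<close> at \<open>g\<close> is witnessed by a
stream in the row of \<open>g\<close>, and the resulting listing holds in \<open>z\<close> at the start of a period.
\<close>

lemma universal_iff:
  assumes x: "x \<in> full_shift G A" and z: "z \<in> full_shift K Bt"
    and rows: "\<And>g n. g \<in> carrier G \<Longrightarrow> z (g, n) = to_nat (row (x g) ! phase (n + p))"
  shows "z \<in> universal \<longleftrightarrow> x \<in> subshift_of_codings G A (set ` E)"
proof -
  have ind: "phase i < period" for i
    using period_pos by (simp add: nat_less_iff)
  have stream: "(\<forall>q\<in>set (stream_listing bs).
        z ((g, n) \<otimes>\<^bsub>K\<^esub> word_value K (fst q)) = snd q) \<longleftrightarrow> matches (row (x g)) bs"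
    if g: "g \<in> carrier G" and n: "(n + p) mod int period = 0" for g n bs
  proof -
    have "z ((g, n) \<otimes>\<^bsub>K\<^esub> word_value K (replicate k up)) = to_nat c \<longleftrightarrow>
        row (x g) ! (k mod length (row (x g))) = c" for k c
    proof -
      have "(n + int k + p) mod int period = int (k mod period)"
        using n by (metis add.commute add.left_commute add_0 mod_add_left_eq zmod_int)
      then show ?thesis using g rows[OF g, of "n + int k"]
        by (simp add: word_value_up monoid.r_one[OF group.is_monoid[OF group_G]])
    qed
    then show ?thesis by (auto simp: matches_def)
  qed
  have text_pair: "z ((g, n) \<otimes>\<^bsub>K\<^esub> word_value K (fst (translate (w, a)))) = to_nat Flag \<longleftrightarrow>
      x (g \<otimes>\<^bsub>G\<^esub> word_value G w) = a"
    if g: "g \<in> carrier G" and n: "(n + p) mod int period = 0" and wa: "(w, a) \<in> lists SX \<times> A" for g n w a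
  proof -
    have "set w \<subseteq> carrier G" using wa SX_simps(2) by auto
    then have gw: "g \<otimes>\<^bsub>G\<^esub> word_value G w \<in> carrier G"
      using g word_value_closed[OF group_G] group.is_monoid[OF group_G] by (simp add: monoid.m_closed)
    then have xA: "x (g \<otimes>\<^bsub>G\<^esub> word_value G w) \<in> A" using x by (auto simp: full_shift_def)
    have a: "Suc (offset a) < period" using wa offset_less[of a] by (simp add: period_def)
    have "(n + int (Suc (offset a)) + p) mod int period = int (Suc (offset a) mod period)"
      using n by (metis add.commute add.left_commute add_0 mod_add_left_eq zmod_int)
    then have "z ((g, n) \<otimes>\<^bsub>K\<^esub> word_value K (fst (translate (w, a)))) =
        to_nat (row (x (g \<otimes>\<^bsub>G\<^esub> word_value G w)) ! Suc (offset a))"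
      using rows[OF gw, of "n + int (Suc (offset a))"] a unfolding translate_value[OF wa] by (simp del: of_nat_Suc)
    then show ?thesis using row_Flag_iff[OF xA a] wa offset_inj[OF _ xA, of a] by auto
  qed
  show ?thesis
  proof (rule iffI; rule ccontr)
    assume "x \<notin> subshift_of_codings G A (set ` E)" and U: "z \<in> universal"
    then obtain g l where g: "g \<in> carrier G" and l: "l \<in> E"
      and match: "\<forall>q\<in>set l. x (g \<otimes>\<^bsub>G\<^esub> word_value G (fst q)) = snd q"
      using mem_subshift_of_codings[OF x] by blast
    have l': "set l \<subseteq> lists SX \<times> A" using l E_lists by auto
    let ?v = "encode_listing (map translate l)"
    have tr: "map translate l \<in> lists (lists S \<times> Bt)"
      using l' translate_closed by (fastforce simp: in_lists_conv_set)
    then have v: "set ?v \<subseteq> S <+> Bt" using encode_listing_lists by blast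
    obtain bs where bs: "opens bs" "matches (row (x g)) bs"
      "runs S WP (map snd bs) (text_queue S ?v @ [End]) []"
      using row_runs_iff[OF text_ends_translate v, of "x g"] l by blast
    let ?l = "stream_listing bs @ ([], to_nat Mark) # map translate l"
    \<comment> \<open>Height \<open>- p\<close> is the start of a period, where the row contains the marker.\<close>
    have n: "(- p + p) mod int period = 0" by simp
    have all: "z ((g, - p) \<otimes>\<^bsub>K\<^esub> word_value K (fst q)) = snd q" if q: "q \<in> set ?l" for q
    proof -
      consider "q \<in> set (stream_listing bs)"
        | "q = ([], to_nat Mark)" | wa where "wa \<in> set l" "q = translate wa"
      proof -
        have "q \<in> set (stream_listing bs) \<or> q = ([], to_nat Mark) \<or>
            q \<in> translate ` set l"
          using q by (simp only: set_append list.set(2) Un_iff insert_iff set_map)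
        then show thesis using that by blast
      qed
      then show ?thesis
      proof cases
        case 1
        then show ?thesis using stream[OF g n, of bs] bs(2) by blast
      next
        case 2
        then show ?thesis using rows[OF g, of "- p"] g
          by (simp add: row_def monoid.r_one[OF group.is_monoid[OF group_G]])
      next
        case 3
        obtain w a where wa: "wa = (w, a)" by (cases wa)
        then have "(w, a) \<in> lists SX \<times> A" "x (g \<otimes>\<^bsub>G\<^esub> word_value G w) = a"
          using 3(1) l' match by auto
        from text_pair[OF g n this(1)] this(2) show ?thesis
          unfolding 3(2) wa by (simp add: translate_def)
      qed
    qed
    have "?l \<in> lists (lists S \<times> Bt)"
    proof -
      have "q \<in> lists S \<times> Bt" if q: "q \<in> set (stream_listing bs)" for q
      proof -
        obtain k c where kc: "(k, c) \<in> set bs" "q = (replicate k up, to_nat c)" using q by auto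
        have "row (x g) ! (k mod period) = c" using bs(2) kc(1) by (auto simp: matches_def)
        then have "to_nat c \<in> Bt" using row_nth_alphabet[of "k mod period" "x g"] period_pos by auto
        moreover have "replicate k up \<in> lists S" using up_S by (simp add: in_lists_conv_set)
        ultimately show ?thesis unfolding kc(2) by (rule SigmaI[rotated])
      qed
      moreover have "q \<in> lists S \<times> Bt" if "q \<in> set (map translate l)" for q
        using in_listsD[OF tr] that by blast
      moreover have "([], to_nat Mark) \<in> lists S \<times> Bt"
        using lists.Nil row_alphabet_cells(2) by (rule SigmaI)
      moreover have "q \<in> set (stream_listing bs) \<or>
          q = ([], to_nat Mark) \<or> q \<in> set (map translate l)" if "q \<in> set ?l" for q
        using that by (simp only: set_append list.set(2) Un_iff insert_iff)
      ultimately show ?thesis by (intro in_listsI ballI) metis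
    qed
    then have "?l \<in> listings"
      unfolding mem_listings_iff using bs text_ends_translate by blast
    moreover have "(g, - p) \<in> carrier K" using g by simp
    ultimately have "\<exists>q\<in>set ?l. z ((g, - p) \<otimes>\<^bsub>K\<^esub> word_value K (fst q)) \<noteq> snd q"
      using U unfolding universal_def mem_subshift_of_codings[OF z] by blast
    then show False using all by blast
  next
    assume "z \<notin> universal" and X: "x \<in> subshift_of_codings G A (set ` E)"
    then obtain h l where h: "h \<in> carrier K" and l: "l \<in> listings"
      and match: "\<forall>q\<in>set l. z (h \<otimes>\<^bsub>K\<^esub> word_value K (fst q)) = snd q"
      unfolding universal_def mem_subshift_of_codings[OF z] by blast
    obtain g n where h': "h = (g, n)" by (cases h)
    then have g: "g \<in> carrier G" using h by simp
    obtain bs lv where lv: "l = stream_listing bs @ ([], to_nat Mark) # lv"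
      "opens bs" "text_ends True (encode_listing lv)"
      "runs S WP (map snd bs) (text_queue S (encode_listing lv) @ [End]) []"
      and l': "l \<in> lists (lists S \<times> Bt)"
      using l unfolding mem_listings_iff by blast
    have all: "z ((g, n) \<otimes>\<^bsub>K\<^esub> word_value K (fst q)) = snd q" if "q \<in> set l" for q
      using match that h' by blast
    have "z ((g, n) \<otimes>\<^bsub>K\<^esub> word_value K []) = to_nat Mark"
      using all[of "([], to_nat Mark)"] lv(1) by simp
    then have "row (x g) ! phase (n + p) = Mark"
      using rows[OF g] g by (simp add: monoid.r_one[OF group.is_monoid[OF group_G]])
    then have "phase (n + p) = 0" using row_Mark_iff[OF ind] by blast
    moreover have "0 \<le> (n + p) mod int period" using period_pos by simp
    ultimately have n: "(n + p) mod int period = 0" by linarith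
    have "matches (row (x g)) bs" using stream[OF g n, of bs] all lv(1) by auto
    moreover have "lv \<in> lists (lists S \<times> Bt)" using l' lv(1) by auto
    then have "set (encode_listing lv) \<subseteq> S <+> Bt" using encode_listing_lists by blast
    ultimately obtain e where e: "e \<in> E" "encode_listing lv = encode_listing (map translate e)"
      using row_runs_iff[OF lv(3), of "x g"] lv(2,4) by blast
    have lv_e: "lv = map translate e" by (rule encode_listing_inj[OF e(2)])
    have "x (g \<otimes>\<^bsub>G\<^esub> word_value G w) = a" if wa: "(w, a) \<in> set e" for w a
    proof -
      have "translate (w, a) \<in> set l" using wa lv(1) lv_e by auto
      from all[OF this] have "z ((g, n) \<otimes>\<^bsub>K\<^esub> word_value K (fst (translate (w, a)))) = to_nat Flag"
        by (simp add: translate_def)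
      moreover have "(w, a) \<in> lists SX \<times> A" using wa e(1) E_lists by auto
      ultimately show ?thesis using text_pair[OF g n] by blast
    qed
    then have "\<forall>q\<in>set e. x (g \<otimes>\<^bsub>G\<^esub> word_value G (fst q)) = snd q" by simp
    then show False using X g e(1) unfolding mem_subshift_of_codings[OF x] by blast
  qed
qed

section \<open>Local rules\<close>

definition layer_alphabet :: "nat set" where
  "layer_alphabet = prod_encode ` (A \<times> {..<period})"

definition window :: "('g \<times> int) set" where
  "window = SG \<times> {0, 1}"

text \<open>
The first layer carries the cell that the second layer prescribes, the letter is constant and
the position advances along the fiber, and positions agree in neighbouring fibers.
\<close>

definition locally_consistent :: "('g \<times> int \<Rightarrow> nat \<times> nat) \<Rightarrow> bool" where
  "locally_consistent y \<longleftrightarrow> (\<exists>a\<in>A. \<exists>j<period.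
     y (\<one>\<^bsub>G\<^esub>, 0) = (to_nat (row a ! j), prod_encode (a, j)) \<and>
     snd (y (\<one>\<^bsub>G\<^esub>, 1)) = prod_encode (a, Suc j mod period) \<and>
     (\<forall>s\<in>SG. snd (prod_decode (snd (y (s, 0)))) = j))"

definition forbidden :: "('g \<times> int \<rightharpoonup> nat \<times> nat) set" where
  "forbidden = {p. dom p = window \<and> ran p \<subseteq> Bt \<times> layer_alphabet \<and>
     \<not> locally_consistent (\<lambda>d. the (p d))}"

abbreviation violating :: "('g \<times> int \<Rightarrow> nat \<times> nat) set" where
  "violating \<equiv> (\<Union>p\<in>forbidden. \<Union>h\<in>carrier K. pattern_cylinder K (Bt \<times> layer_alphabet) p h)"

abbreviation avoiding :: "('g \<times> int \<Rightarrow> nat \<times> nat) set" where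
  "avoiding \<equiv> config_product K universal (full_shift K layer_alphabet) -
     violating"

definition read_letter :: "('g \<times> int \<Rightarrow> nat \<times> nat) \<Rightarrow> 'g \<times> int \<Rightarrow> nat" where
  "read_letter y = (\<lambda>h\<in>carrier K. fst (prod_decode (snd (y h))))"

lemma finite_layer_alphabet: "finite layer_alphabet"
  using finite_A by (simp add: layer_alphabet_def)

lemma window_carrier: "window \<subseteq> carrier K" and finite_window: "finite window"
  using SG_simps by (auto simp: window_def)

lemma finite_Bt: "finite Bt"
  by (rule finite_alphabets(4)[OF finite_S])

lemma finite_forbidden: "finite forbidden"
proof (rule finite_subset)
  show "forbidden \<subseteq> {p. dom p = window \<and> ran p \<subseteq> Bt \<times> layer_alphabet}"
    by (auto simp: forbidden_def)
  show "finite {p. dom p = window \<and> ran p \<subseteq> Bt \<times> layer_alphabet}"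
    by (rule finite_set_of_finite_maps[OF finite_window])
      (use finite_layer_alphabet finite_Bt in simp)
qed

lemma forbidden_patterns: "\<forall>p\<in>forbidden. is_pattern K (Bt \<times> layer_alphabet) p"
  using finite_window window_carrier by (auto simp: forbidden_def is_pattern_def)

lemma one_block_code_read_letter: "one_block_code K (Bt \<times> layer_alphabet) A read_letter"
  unfolding one_block_code_def
  by (rule bexI[of _ "\<lambda>c. fst (prod_decode (snd c))"])
    (auto simp: read_letter_def layer_alphabet_def)

lemma avoiding_iff:
  assumes "y \<in> full_shift K (Bt \<times> layer_alphabet)"
  shows "y \<notin> violating \<longleftrightarrow>
    (\<forall>h\<in>carrier K. locally_consistent (\<lambda>d. y (h \<otimes>\<^bsub>K\<^esub> d)))"
  unfolding forbidden_def
proof (rule avoids_forbidden_windows_iff[OF group_K window_carrier assms])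
  fix y y' :: "'g \<times> int \<Rightarrow> nat \<times> nat"
  assume eq: "\<And>d. d \<in> window \<Longrightarrow> y d = y' d"
  have "y (\<one>\<^bsub>G\<^esub>, 0) = y' (\<one>\<^bsub>G\<^esub>, 0)" "y (\<one>\<^bsub>G\<^esub>, 1) = y' (\<one>\<^bsub>G\<^esub>, 1)"
    "\<forall>s\<in>SG. y (s, 0) = y' (s, 0)"
    using SG_simps(3) by (auto intro!: eq simp: window_def)
  then show "locally_consistent y \<longleftrightarrow> locally_consistent y'"
    unfolding locally_consistent_def by simp
qed

text \<open>
The difference between position and height is constant modulo the period along a fiber, and constant
at height 0 along words over the generating set, hence on all of \<open>G\<close>.
\<close>

lemma locally_consistent_rows:
  assumes "\<forall>h\<in>carrier K. locally_consistent (\<lambda>d. y (h \<otimes>\<^bsub>K\<^esub> d))"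
  shows "\<exists>x p. x \<in> full_shift G A \<and> (\<forall>g\<in>carrier G. \<forall>n.
      y (g, n) = (to_nat (row (x g) ! phase (n + p)),
        prod_encode (x g, phase (n + p))))"
proof -
  interpret group G by (rule group_G)
  define a j where "a g n = fst (prod_decode (snd (y (g, n))))" and
    "j g n = snd (prod_decode (snd (y (g, n))))" for g and n :: int
  have local: "a g n \<in> A \<and> j g n < period \<and>
      y (g, n) = (to_nat (row (a g n) ! j g n), prod_encode (a g n, j g n)) \<and>
      a g (n + 1) = a g n \<and> j g (n + 1) = Suc (j g n) mod period \<and>
      (\<forall>s\<in>SG. j (g \<otimes>\<^bsub>G\<^esub> s) n = j g n)" if g: "g \<in> carrier G" for g n
  proof -
    have "locally_consistent (\<lambda>d. y ((g, n) \<otimes>\<^bsub>K\<^esub> d))" using assms g by simp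
    then obtain b i where b: "b \<in> A" "i < period"
      "y (g, n) = (to_nat (row b ! i), prod_encode (b, i))"
      "snd (y (g, n + 1)) = prod_encode (b, Suc i mod period)"
      "\<forall>s\<in>SG. snd (prod_decode (snd (y (g \<otimes>\<^bsub>G\<^esub> s, n)))) = i"
      using g unfolding locally_consistent_def by auto
    then show ?thesis by (simp add: a_def j_def)
  qed
  have a_const: "a g n = a g 0" if g: "g \<in> carrier G" for g n
    by (rule int_step_constant) (use local[OF g] in blast)
  have j_shift: "j g n = phase (n + int (j g 0))" if g: "g \<in> carrier G" for g n
  proof -
    have "(int (j g (m + 1)) - (m + 1)) mod int period = (int (j g m) - m) mod int period" for m
    proof -
      have "int (j g (m + 1)) = (int (j g m) + 1) mod int period"
        using local[OF g, of m] by (simp add: zmod_int add.commute)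
      then have "(int (j g (m + 1)) - (m + 1)) mod int period = (int (j g m) + 1 - (m + 1)) mod int period"
        by (simp add: mod_diff_left_eq)
      then show ?thesis by simp
    qed
    then have "(int (j g n) - n) mod int period = (int (j g 0) - 0) mod int period"
      by (rule int_step_constant[of "\<lambda>m. (int (j g m) - m) mod int period"])
    then have "(n + int (j g 0)) mod int period = (n + (int (j g n) - n)) mod int period"
      by (metis diff_zero mod_add_right_eq)
    then have "(n + int (j g 0)) mod int period = int (j g n)"
      using local[OF g, of n] by simp
    then show ?thesis by simp
  qed
  have j_word: "j (h \<otimes>\<^bsub>G\<^esub> word_value G w) 0 = j h 0" if "h \<in> carrier G" "set w \<subseteq> SG" for h w
    using that
  proof (induction w arbitrary: h)
    case (Cons s w)
    have s: "s \<in> carrier G" "set w \<subseteq> carrier G" using Cons.prems SG_simps(2) by auto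
    have "j (h \<otimes>\<^bsub>G\<^esub> word_value G (s # w)) 0 = j ((h \<otimes>\<^bsub>G\<^esub> s) \<otimes>\<^bsub>G\<^esub> word_value G w) 0"
      using Cons.prems(1) s word_value_closed[OF group_G s(2)] by (simp add: m_assoc)
    also have "\<dots> = j (h \<otimes>\<^bsub>G\<^esub> s) 0" using Cons s by simp
    also have "\<dots> = j h 0" using local[OF Cons.prems(1)] Cons.prems(2) by simp
    finally show ?case .
  qed simp
  have j_eq: "j g 0 = j \<one>\<^bsub>G\<^esub> 0" if g: "g \<in> carrier G" for g
  proof -
    obtain w where "set w \<subseteq> SG" "word_value G w = g" using ex_word_G[OF g] by blast
    then show ?thesis using j_word[of "\<one>\<^bsub>G\<^esub>" w] g by simp
  qed
  let ?x = "\<lambda>g\<in>carrier G. a g 0"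
  have "?x \<in> full_shift G A" using local by (auto simp: full_shift_def)
  moreover have "y (g, n) = (to_nat (row (?x g) ! phase (n + int (j \<one>\<^bsub>G\<^esub> 0))),
        prod_encode (?x g, phase (n + int (j \<one>\<^bsub>G\<^esub> 0))))"
    if g: "g \<in> carrier G" for g n
  proof -
    have "y (g, n) = (to_nat (row (a g n) ! j g n), prod_encode (a g n, j g n))"
      using local[OF g] by blast
    then show ?thesis using a_const[OF g, of n] j_shift[OF g, of n] j_eq[OF g] g by simp
  qed
  ultimately show ?thesis by blast
qed

lemma projective_subdynamics_avoiding:
  "projective_subdynamics G A (read_letter ` avoiding) = subshift_of_codings G A (set ` E)"
proof (intro Set.set_eqI iffI)
  fix x assume "x \<in> projective_subdynamics G A (read_letter ` avoiding)"
  then obtain y where x: "x \<in> full_shift G A" and y: "y \<in> avoiding"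
    and xy: "\<forall>g\<in>carrier G. x g = read_letter y (g, 0)"
    by (auto simp: projective_subdynamics_def)
  obtain u b where u: "u \<in> universal" and b: "b \<in> full_shift K layer_alphabet"
    and y_eq: "y = (\<lambda>h\<in>carrier K. (u h, b h))"
    using y by (auto simp: config_product_def)
  have u_full: "u \<in> full_shift K Bt" using u by (simp add: universal_def subshift_of_codings_def)
  have y_full: "y \<in> full_shift K (Bt \<times> layer_alphabet)"
    unfolding y_eq by (rule full_shift_pair[OF u_full b])
  have "\<forall>h\<in>carrier K. locally_consistent (\<lambda>d. y (h \<otimes>\<^bsub>K\<^esub> d))"
    by (rule iffD1[OF avoiding_iff[OF y_full]], rule DiffE[OF y])
  from locally_consistent_rows[OF this] obtain x' p where x': "x' \<in> full_shift G A" "\<forall>g\<in>carrier G. \<forall>n.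
      y (g, n) = (to_nat (row (x' g) ! phase (n + p)),
        prod_encode (x' g, phase (n + p)))"
    by (elim exE conjE)
  have "x' g = x g" if "g \<in> carrier G" for g
    using that x'(2) xy by (simp add: read_letter_def)
  then have "x' = x" using PiE_ext x x'(1) unfolding full_shift_def by blast
  moreover have "u (g, n) = to_nat (row (x' g) ! phase (n + p))" if "g \<in> carrier G" for g n
    using that x'(2) y_eq by simp
  ultimately show "x \<in> subshift_of_codings G A (set ` E)"
    using universal_iff[OF x u_full, of p] u by simp
next
  interpret group G by (rule group_G)
  fix x assume X: "x \<in> subshift_of_codings G A (set ` E)"
  then have x: "x \<in> full_shift G A" by (simp add: subshift_of_codings_def)
  then have xA: "x g \<in> A" if "g \<in> carrier G" for g using that by (auto simp: full_shift_def)
  have ind: "phase i < period" for i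
    using period_pos by (simp add: nat_less_iff)
  define u b where "u = (\<lambda>h\<in>carrier K. to_nat (row (x (fst h)) ! nat (snd h mod int period)))" and
    "b = (\<lambda>h\<in>carrier K. prod_encode (x (fst h), nat (snd h mod int period)))"
  have u: "u \<in> full_shift K Bt"
    using row_nth_alphabet[OF ind] by (auto simp: u_def full_shift_def)
  have b: "b \<in> full_shift K layer_alphabet"
    using xA ind by (auto simp: b_def full_shift_def layer_alphabet_def)
  have "u (g, n) = to_nat (row (x g) ! phase (n + 0))" if "g \<in> carrier G" for g n
    using that by (simp add: u_def)
  from universal_iff[OF x u this] have U: "u \<in> universal" using X by blast
  let ?y = "\<lambda>h\<in>carrier K. (u h, b h)"
  have y_full: "?y \<in> full_shift K (Bt \<times> layer_alphabet)" by (rule full_shift_pair[OF u b])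
  have "locally_consistent (\<lambda>d. ?y (h \<otimes>\<^bsub>K\<^esub> d))" if h: "h \<in> carrier K" for h
  proof -
    obtain g n where gn: "h = (g, n)" "g \<in> carrier G" using h by (cases h) auto
    have "phase (n + 1) = Suc (phase n) mod period"
    proof -
      have "int (Suc (phase n) mod period) = (n mod int period + 1) mod int period"
        using period_pos by (simp add: zmod_int add.commute)
      also have "\<dots> = (n + 1) mod int period" by (simp add: mod_add_left_eq)
      finally show ?thesis by simp
    qed
    then show ?thesis
      unfolding locally_consistent_def
      by (intro bexI[of _ "x g"] exI[of _ "phase n"])
        (use gn xA[of g] ind SG_simps(2) in \<open>auto simp: u_def b_def\<close>)
  qed
  then have "?y \<notin> violating"
    by (intro iffD2[OF avoiding_iff[OF y_full]] ballI)
  moreover have "?y \<in> config_product K universal (full_shift K layer_alphabet)"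
    unfolding config_product_def using U b by blast
  ultimately have y: "?y \<in> avoiding" by (rule DiffI[rotated])
  have "x g = read_letter ?y (g, 0)" if "g \<in> carrier G" for g
    using that by (simp add: read_letter_def b_def)
  then show "x \<in> projective_subdynamics G A (read_letter ` avoiding)"
    using x y unfolding projective_subdynamics_def by blast
qed

end

section \<open>The simulation theorem\<close>

theorem theorem3p8:
  fixes G :: "('g, 'm) monoid_scheme"
  assumes "finitely_generated_group G"
  shows "\<exists>(Bt :: nat set) (U :: ('g \<times> int \<Rightarrow> nat) set).
    finite Bt \<and>
    subshift (times_integers G) Bt U \<and>
    effectively_closed (times_integers G) Bt U \<and>
    (\<forall>(A :: nat set) (X :: ('g \<Rightarrow> nat) set).
       finite A \<and> subshift G A X \<and> effectively_closed G A X \<and>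
       contains_uniform_configuration G A X \<longrightarrow>
       (\<exists>(B :: nat set) (F :: ('g \<times> int \<rightharpoonup> nat \<times> nat) set) \<phi>.
          finite B \<and>
          finite F \<and> (\<forall>p\<in>F. is_pattern (times_integers G) (Bt \<times> B) p) \<and>
          one_block_code (times_integers G) (Bt \<times> B) A \<phi> \<and>
          projective_subdynamics G A
            (\<phi> ` (config_product (times_integers G) U (full_shift (times_integers G) B) -
              (\<Union>p\<in>F. \<Union>h\<in>carrier (times_integers G).
                 pattern_cylinder (times_integers G) (Bt \<times> B) p h))) = X))"
proof -
  have G: "group G" using assms by (simp add: finitely_generated_group_def)
  obtain SG where SG: "symmetric_generating_set G SG"
    using ex_symmetric_generating_set[OF assms] by blast
  interpret fiber_interpreter G SG using G SG by (rule fiber_interpreter.intro)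
  show ?thesis
  proof (rule exI[of _ Bt], rule exI[of _ universal], intro conjI allI impI)
    show "finite Bt" by (rule finite_alphabets(4)[OF finite_S])
    show "subshift K Bt universal" by (rule subshift_universal)
    show "effectively_closed K Bt universal" by (rule effectively_closed_universal)
    fix A :: "nat set" and X :: "('g \<Rightarrow> nat) set"
    assume X: "finite A \<and> subshift G A X \<and> effectively_closed G A X \<and>
       contains_uniform_configuration G A X"
    then obtain SX C E M where SX: "symmetric_generating_set G SX"
      and E: "E \<subseteq> lists (lists SX \<times> A)" "C = set ` E"
      and M: "oracle_machine_over (SX <+> A) SX M"
        "encode_listing ` E = {w \<in> lists (SX <+> A). machine_accepts M (word_problem G SX) w}"
      and X_eq: "X = subshift_of_codings G A C"
      unfolding effectively_closed_def re_codings_with_oracle_def re_language_with_oracle_def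
      by blast
    interpret effective_subshift G SG A SX E M
      using X SX E(1) M
      by (intro effective_subshift.intro effective_subshift_axioms.intro fiber_interpreter_axioms) auto
    show "\<exists>(B :: nat set) (F :: ('g \<times> int \<rightharpoonup> nat \<times> nat) set) \<phi>. finite B \<and>
          finite F \<and> (\<forall>p\<in>F. is_pattern K (Bt \<times> B) p) \<and>
          one_block_code K (Bt \<times> B) A \<phi> \<and>
          projective_subdynamics G A (\<phi> ` (config_product K universal (full_shift K B) -
              (\<Union>p\<in>F. \<Union>h\<in>carrier K. pattern_cylinder K (Bt \<times> B) p h))) = X"
      using finite_layer_alphabet finite_forbidden forbidden_patterns one_block_code_read_letter
        projective_subdynamics_avoiding X_eq E(2)
      by (intro exI[of _ layer_alphabet] exI[of _ forbidden] exI[of _ read_letter] conjI) simp_all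
  qed
qed

end
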